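(* Let $\kappa=1+\max_{\mathbf k\in\mathcal K}\sum_ik_i$ and let $p\in(1-1/(8\kappa),1)$. For each $r$ in a sequence $r\to\infty$, consider the system operated under the GRAND($Z^p$)-FF algorithm in steady state. Then: - for every $\delta>0$, $\mathbb P\{U^r(\infty)-q^*r\le\delta r\}\to1$, i.e. $0\vee (U^r(\infty)-rq^* )/r\Longrightarrow0$; - consequently $U^r(\infty)/r\Longrightarrow q^*$. Here $\Longrightarrow$ denotes convergence in distribution.
   Context: Model. There are $I$ customer types $i\in\mathcal I=\{1,\dots,I\}$. Type-$i$ customers arrive as a Poisson process of rate $\Lambda_i=\lambda_i r$ ($\lambda_i>0$ fixed, $r>0$ a scaling parameter). A type-$i$ service time is exponential with mean $1/\mu_i$. All arrival processes and service times are mutually independent. Set $\rho_i=\lambda_i/\mu_i$ and assume $\sum_i\rho_i=1$. There is a countably infinite set of servers with distinct ranks $\ell=1,2,3,\dots$. A configuration is a vector $\mathbf k=(k_1,\dots,k_I)$ of nonnegative integers. There is a finite set $\bar{\mathcal K}$ of allowed configurations. It is monotone: if $\mathbf k\in\bar{\mathcal K}$ and $0\le k'_i\le k_i$ for all $i$, then $\mathbf k'\in\bar{\mathcal K}$. It contains $\mathbf 0$ and every unit vector $\mathbf e_i$. Set $\mathcal K=\bar{\mathcal K}\setminus\{\mathbf 0\}$. A type-$i$ customer may be added to a server in configuration $\mathbf k$ iff $\mathbf k+\mathbf e_i\in\mathcal K$. Each arriving customer is placed immediately into some server. It stays there until its service ends (no migration); the server's configuration then changes from $\mathbf k$ to $\mathbf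 k-\mathbf e_i$. Service times are unaffected by other customers in the same server. A server is occupied if its configuration is not $\mathbf 0$. Notation: - $X^r_{\mathbf k}(t)$: number of servers in configuration $\mathbf k\in\mathcal K$ at time $t$. - $Z^r(t)=\sum_i\sum_{\mathbf k\in\mathcal K}k_iX^r_{\mathbf k}(t)$: total number of customers. - $Q^r(t)=\sum_{\mathbf k\in\mathcal K}X^r_{\mathbf k}(t)$: number of occupied servers. - $U^r(t)$: rank of the right-most (highest-ranked) occupied server. Under the algorithms considered, the system is a positive recurrent Markov chain. The suffix $(\infty)$ denotes the value in the stationary regime. GRAND($Z^p$)-FF algorithm (parameter $0<p<1$). Set $X_{\mathbf 0}(t)=\lceil Z(t)^p\rceil$, $X_{(i),\diamond}(t)=\sum_{\mathbf k\in\mathcal K:\ \mathbf k+\mathbf e_i\in\mathcal K}X_{\mathbf k}(t)$ and $X_{(i)}(t)=X_{\mathbf 0}(t)+X_{(i),\diamond}(t)$. A type-$i$ customer arriving at time $t$ is placed as follows: - with probability $X_{\mathbf 0}(t)/X_{(i)}(t)$ it goes into an empty server; - otherwise it goes into one of the $X_{(i),\diamond}(t)$ occupied servers able to accept it, chosen uniformly at random; - if $X_{(i)}(t)=0$ it goes into an empty server. Whenever an empty server is to be used, the lowest-ranked empty server is taken (First-Fit). Optimization quantities. Let $\mathcal X=\{\mathbf x\in\mathbb R_+^{|\mathcal K|}:\ \sum_{\mathbf k\in\mathcal K}k_ix_{\mathbf k}=\rho_i\ \forall i\}$ and $q^*=\min_{\mathbf x\in\mathcal X}\sum_{\mathbf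 k\in\mathcal K}x_{\mathbf k}$. *)

theory Defs
  imports "HOL-Probability.Probability"
begin

text \<open>Customer types are the elements of a finite type 'i. A configuration is a
function 'i \<Rightarrow> nat. A system state assigns a configuration to every server rank
(ranks are 1,2,3,...; index 0 is unused and kept at the empty configuration).\<close>

type_synonym 'i config = "'i \<Rightarrow> nat"
type_synonym 'i state = "nat \<Rightarrow> 'i config"

definition unitv :: "'i \<Rightarrow> 'i config" where
  "unitv i = (\<lambda>_. 0)(i := 1)"

definition add_cust :: "'i config \<Rightarrow> 'i \<Rightarrow> 'i config" where
  "add_cust k i = k(i := k i + 1)"

definition rem_cust :: "'i config \<Rightarrow> 'i \<Rightarrow> 'i config" where
  "rem_cust k i = k(i := k i - 1)"

definition allowed_set :: "'i config set \<Rightarrow> bool" where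
  "allowed_set Kb \<longleftrightarrow> finite Kb \<and> (\<lambda>_. 0) \<in> Kb \<and> (\<forall>i. unitv i \<in> Kb) \<and>
     (\<forall>k\<in>Kb. \<forall>k'. (\<forall>i. k' i \<le> k i) \<longrightarrow> k' \<in> Kb)"

definition valid_state :: "'i config set \<Rightarrow> 'i state \<Rightarrow> bool" where
  "valid_state Kb s \<longleftrightarrow> s 0 = (\<lambda>_. 0) \<and> (\<forall>l. s l \<in> Kb) \<and> finite {l. s l \<noteq> (\<lambda>_. 0)}"

definition occ :: "'i state \<Rightarrow> nat set" where
  "occ s = {l. 0 < l \<and> s l \<noteq> (\<lambda>_. 0)}"

definition Ztot :: "('i::finite) state \<Rightarrow> nat" where
  "Ztot s = (\<Sum>l\<in>occ s. \<Sum>i\<in>UNIV. s l i)"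

definition Urank :: "'i state \<Rightarrow> nat" where
  "Urank s = Max (insert 0 (occ s))"

definition X0 :: "real \<Rightarrow> ('i::finite) state \<Rightarrow> nat" where
  "X0 p s = nat \<lceil>real (Ztot s) powr p\<rceil>"

definition acc :: "'i config set \<Rightarrow> 'i state \<Rightarrow> 'i \<Rightarrow> nat set" where
  "acc Kb s i = {l \<in> occ s. add_cust (s l) i \<in> Kb}"

definition Xi :: "'i config set \<Rightarrow> real \<Rightarrow> ('i::finite) state \<Rightarrow> 'i \<Rightarrow> nat" where
  "Xi Kb p s i = X0 p s + card (acc Kb s i)"

definition first_empty :: "'i state \<Rightarrow> nat" where
  "first_empty s = (LEAST l. 0 < l \<and> s l = (\<lambda>_. 0))"

definition arr_prob :: "'i config set \<Rightarrow> real \<Rightarrow> ('i::finite) state \<Rightarrow> 'i \<Rightarrow> 'i state \<Rightarrow> real" where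
  "arr_prob Kb p s i s' =
     (if s' = s(first_empty s := unitv i) then
        (if Xi Kb p s i = 0 then 1 else real (X0 p s) / real (Xi Kb p s i)) else 0)
     + (\<Sum>l\<in>acc Kb s i. if s' = s(l := add_cust (s l) i) then 1 / real (Xi Kb p s i) else 0)"

definition trans_rate :: "'i config set \<Rightarrow> ('i \<Rightarrow> real) \<Rightarrow> ('i \<Rightarrow> real) \<Rightarrow> real \<Rightarrow> real
    \<Rightarrow> ('i::finite) state \<Rightarrow> 'i state \<Rightarrow> real" where
  "trans_rate Kb lam mu p r s s' =
     (\<Sum>i\<in>UNIV. lam i * r * arr_prob Kb p s i s')
     + (\<Sum>l\<in>occ s. \<Sum>i\<in>UNIV.
          if 0 < s l i \<and> s' = s(l := rem_cust (s l) i) then mu i * real (s l i) else 0)"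

definition out_rate :: "('i \<Rightarrow> real) \<Rightarrow> ('i \<Rightarrow> real) \<Rightarrow> real \<Rightarrow> ('i::finite) state \<Rightarrow> real" where
  "out_rate lam mu r s = (\<Sum>i\<in>UNIV. lam i * r) + (\<Sum>l\<in>occ s. \<Sum>i\<in>UNIV. mu i * real (s l i))"

definition stationary :: "'i config set \<Rightarrow> ('i \<Rightarrow> real) \<Rightarrow> ('i \<Rightarrow> real) \<Rightarrow> real \<Rightarrow> real
    \<Rightarrow> ('i::finite) state pmf \<Rightarrow> bool" where
  "stationary Kb lam mu p r \<pi> \<longleftrightarrow>
     set_pmf \<pi> \<subseteq> {s. valid_state Kb s} \<and>
     (\<forall>s'. (\<integral>\<^sup>+ s. ennreal (trans_rate Kb lam mu p r s s') \<partial>measure_pmf \<pi>)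
            = ennreal (pmf \<pi> s' * out_rate lam mu r s'))"

definition q_star :: "('i::finite) config set \<Rightarrow> ('i \<Rightarrow> real) \<Rightarrow> ('i \<Rightarrow> real) \<Rightarrow> real" where
  "q_star Kb lam mu = Inf {(\<Sum>k\<in>Kb - {\<lambda>_. 0}. x k) | x.
      (\<forall>k\<in>Kb - {\<lambda>_. 0}. 0 \<le> x k) \<and>
      (\<forall>i. (\<Sum>k\<in>Kb - {\<lambda>_. 0}. real (k i) * x k) = lam i / mu i)}"

definition kappa :: "('i::finite) config set \<Rightarrow> nat" where
  "kappa Kb = 1 + Max ((\<lambda>k. \<Sum>i\<in>UNIV. k i) ` (Kb - {\<lambda>_. 0}))"

end

theory Submission
  imports Defs "HOL-Real_Asymp.Real_Asymp"
begin

text \<open>The proof uses only the balance equations: the generator applied to a test function has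
  stationary mean zero. Customer numbers are independent of the placement rule, so each \<open>Z\<^sub>i\<close> is
  Poisson with mean \<open>\<rho>\<^sub>i r\<close>, and outside an event of superpolynomially small probability all
  \<open>\<bar>Z\<^sub>i - \<rho>\<^sub>i r\<bar>\<close> are at most \<open>r powr (5/8)\<close>.

  Let \<open>L\<close> be the entropy of the configuration counts relative to weights of order \<open>r\<^sup>p\<close>. Its drift is
  minus the dissipation \<open>\<Sum> (v - w) ln (v / w)\<close>, summed over all edges between configurations \<open>k\<close> and
  \<open>k + e\<^sub>i\<close> with arrival flow \<open>v\<close> and departure flow \<open>w\<close>, up to an error of order
  \<open>r powr (3/4) * ln r\<close>, which is smaller than \<open>r\<^sup>p\<close>. If the dissipation is below a small multiple of
  \<open>r\<^sup>p\<close>, then all flows are balanced up to a factor 2 and the counts are of product form up to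
  constants: \<open>ln X\<^sub>k = p ln r + \<Sum>\<^sub>i k\<^sub>i \<alpha>\<^sub>i + O(1)\<close>. Since \<open>X\<^sub>k = O(r)\<close>, the vector
  \<open>\<alpha> / ((1 - p) ln r)\<close> is almost feasible for the dual linear program and almost satisfies
  complementary slackness, so weak duality bounds the number \<open>Q\<close> of occupied servers by
  \<open>q\<^sup>* r + O(r / ln r)\<close>. Hence \<open>L\<close> drifts down whenever \<open>Q \<ge> (q\<^sup>* + \<delta>) r\<close>. As \<open>L\<close> equals
  \<open>(1 - p) ln r * Q + O(r)\<close>, the test function \<open>exp (K L / r)\<close> yields
  \<open>P(Q \<ge> (q\<^sup>* + \<delta>) r) \<le> r powr - M\<close> for every \<open>M\<close>.

  Under First-Fit a server of rank above \<open>N = (q\<^sup>* + \<delta>) r\<close> is opened only while \<open>Q \<ge> N\<close>, and an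
  occupied server empties after a time polynomial in \<open>r\<close>. A test function that sums a birth-death
  Lyapunov function over the servers above \<open>N\<close> therefore bounds \<open>P(U > N)\<close> by a power of \<open>r\<close> times
  \<open>P(Q \<ge> N)\<close>.\<close>

section \<open>Generator and stationary balance\<close>

definition nconf :: "('i::finite) config \<Rightarrow> nat" where
  "nconf k = (\<Sum>i\<in>UNIV. k i)"

definition Zc :: "'i state \<Rightarrow> 'i \<Rightarrow> nat" where
  "Zc s i = (\<Sum>l\<in>occ s. s l i)"

definition Xc :: "'i state \<Rightarrow> 'i config \<Rightarrow> nat" where
  "Xc s k = card {l \<in> occ s. s l = k}"

definition up :: "'i state \<Rightarrow> nat \<Rightarrow> 'i \<Rightarrow> 'i state" where
  "up s l i = s(l := add_cust (s l) i)"

definition down :: "'i state \<Rightarrow> nat \<Rightarrow> 'i \<Rightarrow> 'i state" where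
  "down s l i = s(l := rem_cust (s l) i)"

text \<open>The bound \<open>7 / 8 < p\<close> is the form in which the range of \<open>p\<close>
  enters: it gives \<open>1 - p + 5/8 < 3/4\<close>, so the errors below are of order
  \<open>r powr (3/4) * ln r\<close>, and these are small against \<open>r powr p\<close>.\<close>

locale grand_ff =
  fixes Kb :: "('i::finite) config set"
    and lam mu :: "'i \<Rightarrow> real"
    and p :: real
  assumes Kb: "allowed_set Kb"
    and lam_pos: "\<And>i. 0 < lam i"
    and mu_pos: "\<And>i. 0 < mu i"
    and load: "(\<Sum>i\<in>UNIV. lam i / mu i) = 1"
    and p_low: "7 / 8 < p"
    and p_up: "p < 1"
begin

abbreviation "fe \<equiv> first_empty"

definition w0 :: "'i state \<Rightarrow> 'i \<Rightarrow> real" where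
  "w0 s i = (if Xi Kb p s i = 0 then 1 else real (X0 p s) / real (Xi Kb p s i))"

text \<open>The transition rates out of \<open>s\<close> applied to \<open>f\<close>, listed by
  transitions (type and server) instead of target states.\<close>

definition push :: "real \<Rightarrow> ('i state \<Rightarrow> real) \<Rightarrow> 'i state \<Rightarrow> real" where
  "push r f s =
     (\<Sum>i\<in>UNIV. lam i * r * (w0 s i * f (up s (fe s) i)
        + (\<Sum>l\<in>acc Kb s i. f (up s l i) / real (Xi Kb p s i))))
     + (\<Sum>l\<in>occ s. \<Sum>i\<in>UNIV. mu i * real (s l i) * f (down s l i))"

text \<open>The generator, written through increments of \<open>f\<close> so that bounds on single
  jumps carry over to it term by term.\<close>

definition drift :: "real \<Rightarrow> ('i state \<Rightarrow> real) \<Rightarrow> 'i state \<Rightarrow> real" where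
  "drift r f s =
     (\<Sum>i\<in>UNIV. lam i * r * (w0 s i * (f (up s (fe s) i) - f s)
        + (\<Sum>l\<in>acc Kb s i. (f (up s l i) - f s) / real (Xi Kb p s i))))
     + (\<Sum>l\<in>occ s. \<Sum>i\<in>UNIV. mu i * real (s l i) * (f (down s l i) - f s))"

abbreviation "out \<equiv> out_rate lam mu"

definition Lam :: real where "Lam = (\<Sum>i\<in>UNIV. lam i)"

text \<open>A finite set containing every target of positive rate; it may also contain targets of
  rate zero, which are harmless.\<close>

definition succ :: "'i state \<Rightarrow> 'i state set" where
  "succ s = (\<Union>i. insert (up s (fe s) i) ((\<lambda>l. up s l i) ` acc Kb s i))
     \<union> (\<Union>i. (\<lambda>l. down s l i) ` {l \<in> occ s. 0 < s l i})"

lemma Lam_pos: "0 < Lam"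
  unfolding Lam_def by (intro sum_pos) (auto simp: lam_pos)

lemma finite_Kb: "finite Kb" and zero_Kb: "(\<lambda>_. 0) \<in> Kb" and unitv_Kb: "unitv i \<in> Kb"
  using Kb by (auto simp: allowed_set_def)

lemma Kb_mono: "k \<in> Kb \<Longrightarrow> (\<And>i. k' i \<le> k i) \<Longrightarrow> k' \<in> Kb"
  using Kb unfolding allowed_set_def by blast

lemma finite_occ: "valid_state Kb s \<Longrightarrow> finite (occ s)"
  unfolding valid_state_def occ_def by (auto elim: rev_finite_subset)

lemma finite_acc: "valid_state Kb s \<Longrightarrow> finite (acc Kb s i)"
  using finite_occ unfolding acc_def by auto

lemma first_empty:
  assumes "valid_state Kb s"
  shows "0 < fe s" "s (fe s) = (\<lambda>_. 0)" "fe s \<notin> occ s" "\<And>l. 0 < l \<Longrightarrow> l < fe s \<Longrightarrow> l \<in> occ s"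
proof -
  have "finite (insert 0 (occ s))" using finite_occ[OF assms] by simp
  then obtain l where "l \<notin> insert 0 (occ s)" using ex_new_if_finite[of "insert 0 (occ s)"] by auto
  then have *: "0 < l \<and> s l = (\<lambda>_. 0)" by (auto simp: occ_def)
  have "0 < fe s \<and> s (fe s) = (\<lambda>_. 0)"
    unfolding first_empty_def by (rule LeastI[where P = "\<lambda>l. 0 < l \<and> s l = (\<lambda>_. 0)", OF *])
  then show "0 < fe s" "s (fe s) = (\<lambda>_. 0)" "fe s \<notin> occ s" by (auto simp: occ_def)
  show "l \<in> occ s" if "0 < l" "l < fe s" for l
    using not_less_Least[of l "\<lambda>l. 0 < l \<and> s l = (\<lambda>_. 0)"] that
    unfolding first_empty_def occ_def by auto
qed

lemma add_zero [simp]: "add_cust (\<lambda>_. 0) i = unitv i"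
  by (simp add: add_cust_def unitv_def)

lemma weights_sum:
  assumes "valid_state Kb s"
  shows "w0 s i + real (card (acc Kb s i)) / real (Xi Kb p s i) = 1"
  by (cases "Xi Kb p s i = 0") (auto simp: w0_def Xi_def add_divide_distrib[symmetric])

lemma w0_nonneg: "0 \<le> w0 s i"
  by (simp add: w0_def)

lemma drift_eq_push:
  assumes "valid_state Kb s"
  shows "drift r f s = push r f s - f s * out r s"
proof -
  have "lam i * r * (w0 s i * (f (up s (fe s) i) - f s)
        + (\<Sum>l\<in>acc Kb s i. (f (up s l i) - f s) / real (Xi Kb p s i)))
     = lam i * r * (w0 s i * f (up s (fe s) i)
        + (\<Sum>l\<in>acc Kb s i. f (up s l i) / real (Xi Kb p s i))) - f s * (lam i * r)" (is "?a = ?b") for i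
  proof -
    have "(\<Sum>l\<in>acc Kb s i. (f (up s l i) - f s) / real (Xi Kb p s i)) =
       (\<Sum>l\<in>acc Kb s i. f (up s l i) / real (Xi Kb p s i)) - f s * (real (card (acc Kb s i)) / real (Xi Kb p s i))"
      by (simp add: diff_divide_distrib sum_subtractf)
    then have "?a = lam i * r * (w0 s i * f (up s (fe s) i) + (\<Sum>l\<in>acc Kb s i. f (up s l i) / real (Xi Kb p s i))
       - f s * (w0 s i + real (card (acc Kb s i)) / real (Xi Kb p s i)))"
      by (simp only:) (simp only: algebra_simps)
    also have "\<dots> = ?b" unfolding weights_sum[OF assms] by (simp add: algebra_simps)
    finally show ?thesis .
  qed
  moreover have "(\<Sum>l\<in>occ s. \<Sum>i\<in>UNIV. mu i * real (s l i) * (f (down s l i) - f s)) =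
    (\<Sum>l\<in>occ s. \<Sum>i\<in>UNIV. mu i * real (s l i) * f (down s l i))
    - f s * (\<Sum>l\<in>occ s. \<Sum>i\<in>UNIV. mu i * real (s l i))"
    by (simp add: right_diff_distrib sum_subtractf sum_distrib_left mult_ac)
  moreover have "(\<Sum>i\<in>UNIV. f s * (lam i * r)) = f s * (\<Sum>i\<in>UNIV. lam i * r)"
    by (simp add: sum_distrib_left)
  ultimately show ?thesis
    unfolding drift_def push_def out_rate_def by (simp add: sum_subtractf distrib_left)
qed

lemma push_nonneg:
  assumes "0 < r" "\<And>s. 0 \<le> f s"
  shows "0 \<le> push r f s"
  unfolding push_def using assms lam_pos mu_pos w0_nonneg
  by (intro add_nonneg_nonneg sum_nonneg mult_nonneg_nonneg divide_nonneg_nonneg) (auto simp: less_imp_le)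

lemma out_nonneg: "0 < r \<Longrightarrow> 0 \<le> out r s"
  unfolding out_rate_def using lam_pos mu_pos
  by (intro add_nonneg_nonneg sum_nonneg mult_nonneg_nonneg) (auto simp: less_imp_le)

lemma finite_succ: "valid_state Kb s \<Longrightarrow> finite (succ s)"
  unfolding succ_def using finite_acc finite_occ by auto

lemma trans_rate_outside_succ:
  assumes "valid_state Kb s" "s' \<notin> succ s"
  shows "trans_rate Kb lam mu p r s s' = 0"
proof -
  have "arr_prob Kb p s i s' = 0" for i
    unfolding arr_prob_def using assms first_empty(2)[OF assms(1)]
    by (fastforce simp: succ_def up_def intro!: sum.neutral)
  moreover have "(\<Sum>l\<in>occ s. \<Sum>i\<in>UNIV.
          if 0 < s l i \<and> s' = s(l := rem_cust (s l) i) then mu i * real (s l i) else 0) = 0"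
    using assms by (fastforce simp: succ_def down_def intro!: sum.neutral)
  ultimately show ?thesis by (simp add: trans_rate_def)
qed

lemma trans_rate_nonneg: "0 < r \<Longrightarrow> 0 \<le> trans_rate Kb lam mu p r s s'"
  unfolding trans_rate_def arr_prob_def using lam_pos mu_pos
  by (intro add_nonneg_nonneg sum_nonneg mult_nonneg_nonneg) (auto simp: less_imp_le)

text \<open>Exchanging the sum over target states with the sums over types and servers leaves one
  point mass per transition, and \<open>succ s\<close> contains its target.\<close>

lemma push_eq_trans_rate:
  assumes "valid_state Kb s"
  shows "(\<Sum>s'\<in>succ s. f s' * trans_rate Kb lam mu p r s s') = push r f s"
proof -
  note fin = finite_succ[OF assms]
  have 1: "(\<Sum>s'\<in>succ s. f s' * arr_prob Kb p s i s') =
     w0 s i * f (up s (fe s) i) + (\<Sum>l\<in>acc Kb s i. f (up s l i) / real (Xi Kb p s i))" for i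
  proof -
    have "(\<Sum>s'\<in>succ s. f s' * arr_prob Kb p s i s') =
      (\<Sum>s'\<in>succ s. (if s' = up s (fe s) i then f s' * w0 s i else 0))
      + (\<Sum>s'\<in>succ s. \<Sum>l\<in>acc Kb s i. if s' = up s l i then f s' / real (Xi Kb p s i) else 0)"
      unfolding arr_prob_def w0_def up_def first_empty(2)[OF assms] sum.distrib[symmetric]
      by (intro sum.cong refl) (auto simp: distrib_left sum_distrib_left intro!: sum.cong)
    also have "(\<Sum>s'\<in>succ s. (if s' = up s (fe s) i then f s' * w0 s i else 0)) = w0 s i * f (up s (fe s) i)"
      by (subst sum.delta[OF fin]) (auto simp: succ_def)
    also have "(\<Sum>s'\<in>succ s. \<Sum>l\<in>acc Kb s i. if s' = up s l i then f s' / real (Xi Kb p s i) else 0)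
      = (\<Sum>l\<in>acc Kb s i. f (up s l i) / real (Xi Kb p s i))"
      by (subst sum.swap, intro sum.cong refl, subst sum.delta[OF fin]) (auto simp: succ_def)
    finally show ?thesis .
  qed
  have 2: "(\<Sum>s'\<in>succ s. f s' * (\<Sum>l\<in>occ s. \<Sum>i\<in>UNIV.
          if 0 < s l i \<and> s' = s(l := rem_cust (s l) i) then mu i * real (s l i) else 0))
     = (\<Sum>l\<in>occ s. \<Sum>i\<in>UNIV. mu i * real (s l i) * f (down s l i))"
  proof -
    have "(\<Sum>s'\<in>succ s. f s' * (\<Sum>l\<in>occ s. \<Sum>i\<in>UNIV.
          if 0 < s l i \<and> s' = s(l := rem_cust (s l) i) then mu i * real (s l i) else 0))
      = (\<Sum>l\<in>occ s. \<Sum>i\<in>UNIV. \<Sum>s'\<in>succ s. if s' = down s l i then mu i * real (s l i) * f s' else 0)"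
    proof -
      have "(\<Sum>s'\<in>succ s. f s' * (\<Sum>l\<in>occ s. \<Sum>i\<in>UNIV.
          if 0 < s l i \<and> s' = s(l := rem_cust (s l) i) then mu i * real (s l i) else 0))
        = (\<Sum>s'\<in>succ s. \<Sum>l\<in>occ s. \<Sum>i\<in>UNIV. if s' = down s l i then mu i * real (s l i) * f s' else 0)"
        unfolding sum_distrib_left down_def by (intro sum.cong refl) auto
      also have "\<dots> = (\<Sum>l\<in>occ s. \<Sum>s'\<in>succ s. \<Sum>i\<in>UNIV. if s' = down s l i then mu i * real (s l i) * f s' else 0)"
        by (rule sum.swap)
      also have "\<dots> = (\<Sum>l\<in>occ s. \<Sum>i\<in>UNIV. \<Sum>s'\<in>succ s. if s' = down s l i then mu i * real (s l i) * f s' else 0)"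
        by (intro sum.cong refl sum.swap)
      finally show ?thesis .
    qed
    also have "\<dots> = (\<Sum>l\<in>occ s. \<Sum>i\<in>UNIV. mu i * real (s l i) * f (down s l i))"
      by (intro sum.cong refl, subst sum.delta[OF fin]) (auto simp: succ_def)
    finally show ?thesis .
  qed
  have "(\<Sum>s'\<in>succ s. f s' * trans_rate Kb lam mu p r s s')
     = (\<Sum>i\<in>UNIV. lam i * r * (\<Sum>s'\<in>succ s. f s' * arr_prob Kb p s i s'))
       + (\<Sum>s'\<in>succ s. f s' * (\<Sum>l\<in>occ s. \<Sum>i\<in>UNIV.
          if 0 < s l i \<and> s' = s(l := rem_cust (s l) i) then mu i * real (s l i) else 0))"
    unfolding trans_rate_def distrib_left sum.distrib
    apply (simp add: sum_distrib_left)
    apply (subst sum.swap)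
    apply (simp add: mult_ac)
    done
  then show ?thesis unfolding 1 2 push_def .
qed

text \<open>The drift is a combination of increments with nonnegative weights of total mass
  \<open>out r s\<close>, so an affine comparison of increments passes to the drifts.\<close>

lemma drift_le:
  assumes "valid_state Kb s" "0 < r"
    and le: "\<And>s'. s' \<in> succ s \<Longrightarrow> f s' - f s \<le> a * (g s' - g s) + b"
  shows "drift r f s \<le> a * drift r g s + b * out r s"
proof -
  have u: "f (up s (fe s) i) - f s \<le> a * (g (up s (fe s) i) - g s) + b" for i
    by (rule le) (auto simp: succ_def)
  have v: "f (up s l i) - f s \<le> a * (g (up s l i) - g s) + b" if "l \<in> acc Kb s i" for i l
    by (rule le) (use that in \<open>auto simp: succ_def\<close>)
  have w: "f (down s l i) - f s \<le> a * (g (down s l i) - g s) + b" if "l \<in> occ s" "0 < s l i" for i l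
    by (rule le) (use that in \<open>auto simp: succ_def\<close>)
  have "lam i * r * (w0 s i * (f (up s (fe s) i) - f s)
        + (\<Sum>l\<in>acc Kb s i. (f (up s l i) - f s) / real (Xi Kb p s i)))
     \<le> lam i * r * (a * (w0 s i * (g (up s (fe s) i) - g s)
        + (\<Sum>l\<in>acc Kb s i. (g (up s l i) - g s) / real (Xi Kb p s i))) + b)" for i
  proof (intro mult_left_mono)
    have "w0 s i * (f (up s (fe s) i) - f s) \<le> w0 s i * (a * (g (up s (fe s) i) - g s) + b)"
      by (intro mult_left_mono u w0_nonneg)
    moreover have "(\<Sum>l\<in>acc Kb s i. (f (up s l i) - f s) / real (Xi Kb p s i))
       \<le> (\<Sum>l\<in>acc Kb s i. (a * (g (up s l i) - g s) + b) / real (Xi Kb p s i))"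
      by (intro sum_mono divide_right_mono v) auto
    moreover have "(\<Sum>l\<in>acc Kb s i. (a * (g (up s l i) - g s) + b) / real (Xi Kb p s i))
       = a * (\<Sum>l\<in>acc Kb s i. (g (up s l i) - g s) / real (Xi Kb p s i))
         + b * (real (card (acc Kb s i)) / real (Xi Kb p s i))"
      by (simp add: add_divide_distrib sum.distrib sum_distrib_left)
    moreover have "b * w0 s i + b * (real (card (acc Kb s i)) / real (Xi Kb p s i)) = b"
      unfolding distrib_left[symmetric] weights_sum[OF assms(1)] by simp
    ultimately show "w0 s i * (f (up s (fe s) i) - f s)
        + (\<Sum>l\<in>acc Kb s i. (f (up s l i) - f s) / real (Xi Kb p s i))
     \<le> a * (w0 s i * (g (up s (fe s) i) - g s)
        + (\<Sum>l\<in>acc Kb s i. (g (up s l i) - g s) / real (Xi Kb p s i))) + b"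
      by (simp add: algebra_simps)
  qed (use assms lam_pos in \<open>auto simp: less_imp_le\<close>)
  moreover have "mu i * real (s l i) * (f (down s l i) - f s)
     \<le> mu i * real (s l i) * (a * (g (down s l i) - g s) + b)" if "l \<in> occ s" for l i
    using w[OF that, of i] mu_pos[of i] by (cases "s l i = 0") (auto intro!: mult_left_mono)
  ultimately have "drift r f s \<le> (\<Sum>i\<in>UNIV. lam i * r * (a * (w0 s i * (g (up s (fe s) i) - g s)
        + (\<Sum>l\<in>acc Kb s i. (g (up s l i) - g s) / real (Xi Kb p s i))) + b))
     + (\<Sum>l\<in>occ s. \<Sum>i\<in>UNIV. mu i * real (s l i) * (a * (g (down s l i) - g s) + b))"
    unfolding drift_def by (intro add_mono sum_mono) auto
  also have "\<dots> = a * drift r g s + b * out r s"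
  proof -
    have 1: "(\<Sum>i\<in>UNIV. lam i * r * (a * F i + b)) = a * (\<Sum>i\<in>UNIV. lam i * r * F i) + b * (\<Sum>i\<in>UNIV. lam i * r)" for F
      by (simp add: sum_distrib_left sum.distrib distrib_left mult_ac)
    have 2: "(\<Sum>l\<in>occ s. \<Sum>i\<in>UNIV. mu i * real (s l i) * (a * F l i + b)) =
       a * (\<Sum>l\<in>occ s. \<Sum>i\<in>UNIV. mu i * real (s l i) * F l i) + b * (\<Sum>l\<in>occ s. \<Sum>i\<in>UNIV. mu i * real (s l i))" for F
      by (simp add: sum_distrib_left sum.distrib distrib_left mult_ac)
    show ?thesis unfolding drift_def out_rate_def 1 2 by (simp add: distrib_left)
  qed
  finally show ?thesis .
qed

section \<open>Balance equations tested against functions\<close>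

text \<open>The balance equation at \<open>s'\<close> is multiplied by \<open>f s'\<close> and
  summed over \<open>s'\<close>. All terms are nonnegative, so the order of summation may be
  exchanged even when both sides are infinite.\<close>

lemma balance_nn:
  assumes st: "stationary Kb lam mu p r \<pi>" and r: "0 < r" and f: "\<And>s. 0 \<le> f s"
  shows "(\<integral>\<^sup>+ s. ennreal (push r f s) \<partial>measure_pmf \<pi>) = (\<integral>\<^sup>+ s. ennreal (f s * out r s) \<partial>measure_pmf \<pi>)"
proof -
  define C where "C = set_pmf \<pi>"
  let ?q = "trans_rate Kb lam mu p r"
  have C: "countable C" by (simp add: C_def)
  have valid: "valid_state Kb s" if "s \<in> C" for s
    using st that by (auto simp: stationary_def C_def)
  have bal: "(\<integral>\<^sup>+ s. ennreal (?q s s') \<partial>measure_pmf \<pi>) = ennreal (pmf \<pi> s' * out r s')" for s'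
    using st by (auto simp: stationary_def)
  \<comment> \<open>Balance at a state of probability zero says that its inflow vanishes. Hence the
    support is closed under transitions and all sums may be restricted to this countable
    set.\<close>
  have closed: "?q s s' = 0" if "s \<in> C" "s' \<notin> C" for s s'
  proof -
    have "(\<integral>\<^sup>+ s. ennreal (?q s s') \<partial>measure_pmf \<pi>) = 0"
      using that(2) unfolding bal C_def by (simp add: set_pmf_iff)
    then have "AE s in measure_pmf \<pi>. ennreal (?q s s') = 0"
      by (subst (asm) nn_integral_0_iff_AE) auto
    then have "ennreal (?q s s') = 0" using that(1) by (auto simp: AE_measure_pmf_iff C_def)
    then show ?thesis using trans_rate_nonneg[OF r, of s s'] by simp
  qed
  have "(\<integral>\<^sup>+ s. ennreal (f s * out r s) \<partial>measure_pmf \<pi>)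
      = (\<integral>\<^sup>+ s'. ennreal (f s') * ennreal (pmf \<pi> s' * out r s') \<partial>count_space C)"
    unfolding nn_integral_measure_pmf C_def
    by (subst (2) nn_integral_count_space_indicator)
       (auto intro!: nn_integral_cong simp: indicator_def set_pmf_iff ennreal_mult[symmetric] f out_nonneg[OF r] mult_ac)
  also have "\<dots> = (\<integral>\<^sup>+ s'. (\<integral>\<^sup>+ s. ennreal (f s') * ennreal (?q s s') \<partial>measure_pmf \<pi>) \<partial>count_space C)"
    unfolding bal[symmetric] by (intro nn_integral_cong nn_integral_cmult[symmetric]) auto
  also have "\<dots> = (\<integral>\<^sup>+ s. (\<integral>\<^sup>+ s'. ennreal (f s') * ennreal (?q s s') \<partial>count_space C) \<partial>measure_pmf \<pi>)"
    by (rule nn_integral_count_space_nn_integral[symmetric]) (auto simp: C)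
  also have "\<dots> = (\<integral>\<^sup>+ s. ennreal (push r f s) \<partial>measure_pmf \<pi>)"
  proof (intro nn_integral_cong_AE, unfold AE_measure_pmf_iff, intro ballI)
    fix s assume "s \<in> set_pmf \<pi>"
    then have s: "s \<in> C" by (simp add: C_def)
    note fin = finite_succ[OF valid[OF s]]
    have "(\<integral>\<^sup>+ s'. ennreal (f s') * ennreal (?q s s') \<partial>count_space C)
       = (\<Sum>s'\<in>succ s \<inter> C. ennreal (f s') * ennreal (?q s s'))"
      by (rule nn_integral_count_space') (use fin trans_rate_outside_succ[OF valid[OF s]] in auto)
    also have "\<dots> = (\<Sum>s'\<in>succ s. ennreal (f s') * ennreal (?q s s'))"
      using fin closed[OF s] by (intro sum.mono_neutral_left) auto
    also have "\<dots> = ennreal (push r f s)"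
      unfolding push_eq_trans_rate[OF valid[OF s], symmetric]
      by (subst sum_ennreal[symmetric]) (auto simp: f trans_rate_nonneg[OF r] ennreal_mult[symmetric])
    finally show "(\<integral>\<^sup>+ s'. ennreal (f s') * ennreal (?q s s') \<partial>count_space C) = ennreal (push r f s)" .
  qed
  finally show ?thesis by simp
qed

text \<open>Integrability of \<open>f s * out r s\<close> makes both sides of
  \<open>balance_nn\<close> finite, so that they can be subtracted.\<close>

lemma balance:
  assumes st: "stationary Kb lam mu p r \<pi>" and r: "0 < r" and f: "\<And>s. 0 \<le> f s"
    and int: "integrable (measure_pmf \<pi>) (\<lambda>s. f s * out r s)"
  shows "integrable (measure_pmf \<pi>) (drift r f)" "(\<integral>s. drift r f s \<partial>measure_pmf \<pi>) = 0"
proof -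
  note nn = balance_nn[OF st r f]
  have fin: "(\<integral>\<^sup>+ s. ennreal (f s * out r s) \<partial>measure_pmf \<pi>) < \<infinity>"
    using int by (subst nn_integral_eq_integral) (auto simp: f out_nonneg[OF r])
  have ip: "integrable (measure_pmf \<pi>) (push r f)"
    using fin unfolding nn[symmetric]
    by (intro integrableI_nonneg) (auto simp: push_nonneg[OF r f])
  have eq: "(\<integral>s. push r f s \<partial>measure_pmf \<pi>) = (\<integral>s. f s * out r s \<partial>measure_pmf \<pi>)"
    using nn by (subst (1 2) integral_eq_nn_integral) (auto simp: push_nonneg[OF r f] f out_nonneg[OF r])
  have ae: "AE s in measure_pmf \<pi>. push r f s - f s * out r s = drift r f s"
    using st drift_eq_push by (auto simp: AE_measure_pmf_iff stationary_def)
  have "integrable (measure_pmf \<pi>) (\<lambda>s. push r f s - f s * out r s)"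
    using ip int by auto
  then show "integrable (measure_pmf \<pi>) (drift r f)"
    using ae by (subst (asm) integrable_cong_AE) auto
  have "(\<integral>s. drift r f s \<partial>measure_pmf \<pi>) = (\<integral>s. push r f s - f s * out r s \<partial>measure_pmf \<pi>)"
    using ae by (intro integral_cong_AE) auto
  also have "\<dots> = 0" using ip int eq by simp
  finally show "(\<integral>s. drift r f s \<partial>measure_pmf \<pi>) = 0" .
qed

end

section \<open>Customer numbers\<close>

lemma exp_le_quadratic:
  assumes "\<bar>t\<bar> \<le> (1::real)"
  shows "exp t \<le> 1 + t + t\<^sup>2"
proof (cases "0 \<le> t")
  case True
  then show ?thesis using exp_bound[of t] assms by auto
next
  case False
  define u where "u = - t"
  have u: "0 < u" "u \<le> 1" using False assms by (auto simp: u_def)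
  have pos: "0 < 1 - u + u\<^sup>2" using u by (intro add_nonneg_pos) auto
  \<comment> \<open>For negative arguments the claim is that \<open>exp u\<close> times the
    quadratic is at least 1; the second-order Taylor lower bound of \<open>exp u\<close> already
    suffices.\<close>
  have "1 \<le> (1 - u + u\<^sup>2) * (1 + u + u\<^sup>2 / 2)"
  proof -
    have "(1 - u + u\<^sup>2) * (1 + u + u\<^sup>2 / 2) = 1 + u\<^sup>2 / 2 + u^3 / 2 + u^4 / 2"
      by (simp add: power2_eq_square power3_eq_cube power4_eq_xxxx field_simps)
    then show ?thesis using u by simp
  qed
  also have "\<dots> \<le> (1 - u + u\<^sup>2) * exp u"
    using exp_lower_Taylor_quadratic[of u] u pos by (intro mult_left_mono) auto
  finally have "exp (- u) * 1 \<le> exp (- u) * ((1 - u + u\<^sup>2) * exp u)"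
    by (intro mult_left_mono) auto
  also have "\<dots> = 1 - u + u\<^sup>2"
    by (simp add: exp_minus field_simps)
  finally show ?thesis by (simp add: u_def)
qed

text \<open>Exponential tilting: weighting the Poisson masses of parameter \<open>a\<close> by
  \<open>x ^ n\<close> gives those of parameter \<open>a * x\<close> up to a constant.\<close>

lemma poisson_pmf_exp_moment:
  assumes "0 < a" "0 < x"
  shows "(\<integral>\<^sup>+ n. ennreal (x ^ n) \<partial>measure_pmf (poisson_pmf a)) = ennreal (exp (a * x - a))"
proof -
  have "(\<integral>\<^sup>+ n. ennreal (x ^ n) \<partial>measure_pmf (poisson_pmf a))
     = (\<integral>\<^sup>+ n. ennreal (exp (a * x - a)) * ennreal (pmf (poisson_pmf (a * x)) n) \<partial>count_space UNIV)"
    unfolding nn_integral_measure_pmf using assms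
    by (intro nn_integral_cong)
       (simp add: ennreal_mult[symmetric] power_mult_distrib exp_diff exp_minus field_simps)
  also have "\<dots> = ennreal (exp (a * x - a)) * (\<integral>\<^sup>+ n. ennreal (pmf (poisson_pmf (a * x)) n) \<partial>count_space UNIV)"
    by (rule nn_integral_cmult) auto
  also have "\<dots> = ennreal (exp (a * x - a))"
    unfolding nn_integral_pmf by (simp add: measure_pmf.emeasure_eq_measure)
  finally show ?thesis .
qed

lemma poisson_pmf_chernoff:
  assumes "0 < a" "\<bar>t\<bar> \<le> 1"
  shows "measure (measure_pmf (poisson_pmf a)) {n. c \<le> t * (real n - a)} \<le> exp (a * t\<^sup>2 - c)"
proof -
  let ?P = "measure_pmf (poisson_pmf a)"
  have "emeasure ?P {n. c \<le> t * (real n - a)} \<le> (\<integral>\<^sup>+ n. ennreal (exp (- t * a - c)) * ennreal (exp t ^ n) \<partial>?P)"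
  proof -
    have "emeasure ?P {n. c \<le> t * (real n - a)} = (\<integral>\<^sup>+ n. indicator {n. c \<le> t * (real n - a)} n \<partial>?P)"
      by simp
    also have "\<dots> \<le> (\<integral>\<^sup>+ n. ennreal (exp (- t * a - c)) * ennreal (exp t ^ n) \<partial>?P)"
    proof (intro nn_integral_mono)
      fix n
      have "exp (- t * a - c) * exp t ^ n = exp (t * (real n - a) - c)"
        by (simp add: exp_of_nat_mult[symmetric] exp_add[symmetric] algebra_simps)
      then show "indicator {n. c \<le> t * (real n - a)} n \<le> ennreal (exp (- t * a - c)) * ennreal (exp t ^ n)"
        by (auto simp: indicator_def ennreal_mult[symmetric])
    qed
    finally show ?thesis .
  qed
  also have "\<dots> = ennreal (exp (- t * a - c)) * ennreal (exp (a * exp t - a))"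
    by (subst nn_integral_cmult) (use assms in \<open>auto simp: poisson_pmf_exp_moment\<close>)
  also have "\<dots> = ennreal (exp (- t * a - c + (a * exp t - a)))"
    by (simp add: ennreal_mult[symmetric] exp_add[symmetric])
  also have "\<dots> \<le> ennreal (exp (a * t\<^sup>2 - c))"
  proof -
    have "a * exp t \<le> a * (1 + t + t\<^sup>2)" using exp_le_quadratic[of t] assms by auto
    then show ?thesis by (intro ennreal_leI) (simp add: algebra_simps)
  qed
  finally show ?thesis
    by (simp add: measure_pmf.emeasure_eq_measure)
qed

text \<open>The recursion fixes all masses up to the factor \<open>c\<close>, and total mass 1 on
  both sides forces \<open>c = 1\<close>.\<close>

lemma poisson_pmf_unique:
  assumes a: "0 < a" and rec: "\<And>n. real (Suc n) * pmf q (Suc n) = a * pmf q n"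
  shows "q = poisson_pmf a"
proof -
  define c where "c = pmf q 0 * exp a"
  have c: "0 \<le> c" by (simp add: c_def)
  have eq: "pmf q n = c * pmf (poisson_pmf a) n" for n
  proof (induction n)
    case 0
    then show ?case using a by (simp add: c_def exp_minus)
  next
    case (Suc n)
    have "pmf q (Suc n) = a * pmf q n / real (Suc n)"
      using rec[of n] by (simp add: field_simps)
    then show ?case using a unfolding Suc by (simp add: field_simps)
  qed
  have "1 = (\<integral>\<^sup>+ n. ennreal (pmf q n) \<partial>count_space UNIV)"
    unfolding nn_integral_pmf by (simp add: measure_pmf.emeasure_eq_measure)
  also have "\<dots> = (\<integral>\<^sup>+ n. ennreal c * ennreal (pmf (poisson_pmf a) n) \<partial>count_space UNIV)"
    unfolding eq by (simp add: ennreal_mult c)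
  also have "\<dots> = ennreal c * (\<integral>\<^sup>+ n. ennreal (pmf (poisson_pmf a) n) \<partial>count_space UNIV)"
    by (rule nn_integral_cmult) auto
  also have "\<dots> = ennreal c"
    unfolding nn_integral_pmf by (simp add: measure_pmf.emeasure_eq_measure)
  finally have "c = 1" using c by (metis ennreal_1 ennreal_inj zero_le_one)
  then show ?thesis using eq by (intro pmf_eqI) simp
qed

text \<open>Shifting the summation index by one and inserting the recursion bounds each truncated
  moment by \<open>a\<close> times a moment of one order less. Truncation keeps all sums finite
  until the final limit.\<close>

lemma pmf_nat_second_moment:
  assumes a: "0 \<le> a" and rec: "\<And>n. real (Suc n) * pmf q (Suc n) \<le> a * pmf q n"
  shows "(\<integral>\<^sup>+ n. ennreal ((real n)\<^sup>2) \<partial>measure_pmf q) \<le> ennreal (a * (a + 1))"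
proof -
  have s0: "(\<Sum>n<N. pmf q n) \<le> 1" for N
    by (subst measure_measure_pmf_finite[symmetric]) auto
  have split: "(\<Sum>n<N. real n * h n) \<le> (\<Sum>n<N. real (Suc n) * h (Suc n))" if "\<And>n. 0 \<le> h n" for h :: "nat \<Rightarrow> real" and N
  proof -
    have "(\<Sum>n<N. real n * h n) \<le> (\<Sum>n<Suc N. real n * h n)"
      using that by (intro sum_mono2) auto
    also have "\<dots> = (\<Sum>n<N. real (Suc n) * h (Suc n))"
      by (subst sum.lessThan_Suc_shift) simp
    finally show ?thesis .
  qed
  have s1: "(\<Sum>n<N. real n * pmf q n) \<le> a" for N
  proof -
    have "(\<Sum>n<N. real n * pmf q n) \<le> (\<Sum>n<N. real (Suc n) * pmf q (Suc n))"
      by (rule split) auto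
    also have "\<dots> \<le> (\<Sum>n<N. a * pmf q n)" by (intro sum_mono rec)
    also have "\<dots> \<le> a * 1" unfolding sum_distrib_left[symmetric] using s0 a by (intro mult_left_mono) auto
    finally show ?thesis by simp
  qed
  have s2: "(\<Sum>n<N. (real n)\<^sup>2 * pmf q n) \<le> a * (a + 1)" for N
  proof -
    have "(\<Sum>n<N. (real n)\<^sup>2 * pmf q n) \<le> (\<Sum>n<N. real (Suc n) * (real (Suc n) * pmf q (Suc n)))"
      using split[of "\<lambda>n. real n * pmf q n" N] by (simp add: power2_eq_square mult_ac)
    also have "\<dots> \<le> (\<Sum>n<N. real (Suc n) * (a * pmf q n))"
      by (intro sum_mono mult_left_mono rec) auto
    also have "\<dots> = a * ((\<Sum>n<N. real n * pmf q n) + (\<Sum>n<N. pmf q n))"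
      by (simp add: algebra_simps sum.distrib sum_distrib_left)
    also have "\<dots> \<le> a * (a + 1)"
      using s0 s1 a by (intro mult_left_mono add_mono) auto
    finally show ?thesis .
  qed
  have "(\<integral>\<^sup>+ n. ennreal ((real n)\<^sup>2) \<partial>measure_pmf q) = (\<Sum>n. ennreal ((real n)\<^sup>2 * pmf q n))"
    unfolding nn_integral_measure_pmf nn_integral_count_space_nat
    by (simp add: ennreal_mult[symmetric] mult_ac)
  also have "\<dots> = (SUP N. ennreal (\<Sum>n<N. (real n)\<^sup>2 * pmf q n))"
    by (simp add: suminf_eq_SUP sum_ennreal)
  also have "\<dots> \<le> ennreal (a * (a + 1))"
    by (intro SUP_least ennreal_leI s2)
  finally show ?thesis .
qed

section \<open>Customer numbers under the dynamics\<close>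

text \<open>The set \<open>occ\<close> itself may gain or lose \<open>l\<close>. Since
  \<open>F\<close> vanishes on the empty configuration, both sums can be taken over
  \<open>insert l (occ s)\<close>, where only the term at \<open>l\<close> changes.\<close>

lemma occ_sum_update:
  fixes F :: "nat \<Rightarrow> 'i config \<Rightarrow> 'b::ab_group_add"
  assumes "finite (occ s)" "0 < l" and F0: "\<And>l. F l (\<lambda>_. 0) = 0"
  shows "(\<Sum>m\<in>occ (s(l := k)). F m ((s(l := k)) m)) = (\<Sum>m\<in>occ s. F m (s m)) + F l k - F l (s l)"
proof -
  define A where "A = insert l (occ s)"
  have A: "finite A" "occ (s(l := k)) \<subseteq> A" "occ s \<subseteq> A" "l \<in> A"
    using assms by (auto simp: A_def occ_def)
  have "(\<Sum>m\<in>occ (s(l := k)). F m ((s(l := k)) m)) = (\<Sum>m\<in>A. F m ((s(l := k)) m))"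
    using A F0 assms(2) by (intro sum.mono_neutral_left) (auto simp: occ_def A_def)
  also have "\<dots> = F l k + (\<Sum>m\<in>A - {l}. F m (s m))"
    using A by (subst sum.remove[of _ l]) auto
  also have "(\<Sum>m\<in>A - {l}. F m (s m)) = (\<Sum>m\<in>A. F m (s m)) - F l (s l)"
    using A by (subst sum.remove[of A l]) auto
  also have "(\<Sum>m\<in>A. F m (s m)) = (\<Sum>m\<in>occ s. F m (s m))"
    using A F0 assms(2) by (intro sum.mono_neutral_right) (auto simp: occ_def A_def)
  finally show ?thesis by (simp only: algebra_simps)
qed

context grand_ff
begin

lemma Zc_update:
  assumes "valid_state Kb s" "0 < l"
  shows "int (Zc (s(l := k)) j) = int (Zc s j) + int (k j) - int (s l j)"
  using occ_sum_update[OF finite_occ[OF assms(1)] assms(2), of "\<lambda>_ k. int (k j)" k]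
  by (simp add: Zc_def)

lemma Zc_up:
  assumes "valid_state Kb s" "l \<in> acc Kb s i \<or> l = fe s"
  shows "Zc (up s l i) = (Zc s)(i := Zc s i + 1)"
proof
  fix j
  have "0 < l" using assms first_empty by (auto simp: acc_def occ_def)
  then have "int (Zc (up s l i) j) = int (Zc s j) + int (add_cust (s l) i j) - int (s l j)"
    unfolding up_def by (rule Zc_update[OF assms(1)])
  then show "Zc (up s l i) j = ((Zc s)(i := Zc s i + 1)) j"
    by (auto simp: add_cust_def split: if_splits)
qed

lemma Zc_down:
  assumes "valid_state Kb s" "l \<in> occ s" "0 < s l i"
  shows "Zc (down s l i) = (Zc s)(i := Zc s i - 1)"
proof
  fix j
  have "0 < l" using assms by (auto simp: occ_def)
  then have "int (Zc (down s l i) j) = int (Zc s j) + int (rem_cust (s l) i j) - int (s l j)"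
    unfolding down_def by (rule Zc_update[OF assms(1)])
  then show "Zc (down s l i) j = ((Zc s)(i := Zc s i - 1)) j"
    using assms(3) by (auto simp: rem_cust_def split: if_splits)
qed

lemma Ztot_Zc: "Ztot s = (\<Sum>i\<in>UNIV. Zc s i)"
  unfolding Ztot_def Zc_def by (rule sum.swap)

lemma out_Zc: "out r s = Lam * r + (\<Sum>i\<in>UNIV. mu i * real (Zc s i))"
proof -
  have "(\<Sum>l\<in>occ s. \<Sum>i\<in>UNIV. mu i * real (s l i)) = (\<Sum>i\<in>UNIV. \<Sum>l\<in>occ s. mu i * real (s l i))"
    by (rule sum.swap)
  then show ?thesis
    unfolding out_rate_def Zc_def Lam_def by (simp add: sum_distrib_left sum_distrib_right)
qed

text \<open>Every placement of a type \<open>i\<close> arrival changes \<open>Zc\<close> in the same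
  way and the placement probabilities sum to one, so the placement rule cancels. What remains is a
  family of infinite-server queues.\<close>

lemma drift_Zc:
  assumes v: "valid_state Kb s"
  shows "drift r (\<lambda>s. \<phi> (Zc s)) s =
    (\<Sum>i\<in>UNIV. lam i * r * (\<phi> ((Zc s)(i := Zc s i + 1)) - \<phi> (Zc s)))
    + (\<Sum>i\<in>UNIV. mu i * real (Zc s i) * (\<phi> ((Zc s)(i := Zc s i - 1)) - \<phi> (Zc s)))"
proof -
  have 1: "w0 s i * (\<phi> (Zc (up s (fe s) i)) - \<phi> (Zc s))
        + (\<Sum>l\<in>acc Kb s i. (\<phi> (Zc (up s l i)) - \<phi> (Zc s)) / real (Xi Kb p s i))
       = \<phi> ((Zc s)(i := Zc s i + 1)) - \<phi> (Zc s)" for i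
  proof -
    have "(\<Sum>l\<in>acc Kb s i. (\<phi> (Zc (up s l i)) - \<phi> (Zc s)) / real (Xi Kb p s i))
      = (\<Sum>l\<in>acc Kb s i. (\<phi> ((Zc s)(i := Zc s i + 1)) - \<phi> (Zc s)) / real (Xi Kb p s i))"
      by (intro sum.cong refl) (use Zc_up[OF v] in auto)
    also have "\<dots> = (\<phi> ((Zc s)(i := Zc s i + 1)) - \<phi> (Zc s)) * (real (card (acc Kb s i)) / real (Xi Kb p s i))"
      by simp
    finally have "w0 s i * (\<phi> (Zc (up s (fe s) i)) - \<phi> (Zc s))
        + (\<Sum>l\<in>acc Kb s i. (\<phi> (Zc (up s l i)) - \<phi> (Zc s)) / real (Xi Kb p s i))
       = (\<phi> ((Zc s)(i := Zc s i + 1)) - \<phi> (Zc s)) * (w0 s i + real (card (acc Kb s i)) / real (Xi Kb p s i))"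
      using Zc_up[OF v, of "fe s" i] by (simp add: algebra_simps)
    then show ?thesis unfolding weights_sum[OF v] by simp
  qed
  have "(\<Sum>l\<in>occ s. \<Sum>i\<in>UNIV. mu i * real (s l i) * (\<phi> (Zc (down s l i)) - \<phi> (Zc s)))
     = (\<Sum>l\<in>occ s. \<Sum>i\<in>UNIV. mu i * real (s l i) * (\<phi> ((Zc s)(i := Zc s i - 1)) - \<phi> (Zc s)))"
  proof (intro sum.cong refl)
    fix l i assume "l \<in> occ s"
    then show "mu i * real (s l i) * (\<phi> (Zc (down s l i)) - \<phi> (Zc s))
      = mu i * real (s l i) * (\<phi> ((Zc s)(i := Zc s i - 1)) - \<phi> (Zc s))"
      using Zc_down[OF v, of l i] by (cases "s l i = 0") auto
  qed
  also have "\<dots> = (\<Sum>i\<in>UNIV. \<Sum>l\<in>occ s. mu i * real (s l i) * (\<phi> ((Zc s)(i := Zc s i - 1)) - \<phi> (Zc s)))"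
    by (rule sum.swap)
  also have "\<dots> = (\<Sum>i\<in>UNIV. mu i * real (Zc s i) * (\<phi> ((Zc s)(i := Zc s i - 1)) - \<phi> (Zc s)))"
    unfolding Zc_def of_nat_sum sum_distrib_left sum_distrib_right ..
  finally show ?thesis unfolding drift_def 1 by simp
qed

definition mumin :: real where "mumin = Min (range mu)"
definition mumax :: real where "mumax = Max (range mu)"

lemma mumin: "0 < mumin" "mumin \<le> mu i" and mumax: "mu i \<le> mumax" "0 < mumax"
proof -
  have "mumin \<in> range mu" unfolding mumin_def by (rule Min_in) auto
  then show "0 < mumin" using mu_pos by auto
  show "mumin \<le> mu i" unfolding mumin_def by (rule Min_le) auto
  show m: "mu i \<le> mumax" for i unfolding mumax_def by (rule Max_ge) auto
  show "0 < mumax" using m[of undefined] mu_pos[of undefined] by linarith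
qed

lemma out_le: "out r s \<le> Lam * r + mumax * real (Ztot s)"
  unfolding out_Zc Ztot_Zc of_nat_sum sum_distrib_left
  by (intro add_left_mono sum_mono mult_right_mono mumax) auto

text \<open>The flow across the cut between \<open>n\<close> and \<open>Suc n\<close> customers is
  balanced. Departure rates depend on the types, so bounding them below by \<open>mumin\<close>
  leaves an inequality.\<close>

lemma Ztot_recursion:
  assumes st: "stationary Kb lam mu p r \<pi>" and r: "0 < r"
  shows "real (Suc n) * pmf (map_pmf Ztot \<pi>) (Suc n) \<le> Lam * r / mumin * pmf (map_pmf Ztot \<pi>) n"
proof -
  \<comment> \<open>The indicator of at most \<open>n\<close> customers makes the integrand bounded,
    so \<open>balance\<close> applies before any moment of the stationary law is known.\<close>
  define \<phi> :: "('i \<Rightarrow> nat) \<Rightarrow> real" where "\<phi> z = of_bool ((\<Sum>i\<in>UNIV. z i) \<le> n)" for z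
  let ?f = "\<lambda>s. \<phi> (Zc s)"
  have f: "?f s = of_bool (Ztot s \<le> n)" for s by (simp add: \<phi>_def Ztot_Zc)
  have int: "integrable (measure_pmf \<pi>) (\<lambda>s. ?f s * out r s)"
  proof (rule measure_pmf.integrable_const_bound[where B="Lam * r + mumax * real n"])
    show "AE s in measure_pmf \<pi>. norm (?f s * out r s) \<le> Lam * r + mumax * real n"
    proof (intro AE_I2)
      fix s :: "'i state"
      have "mumax * real (Ztot s) \<le> mumax * real n" if "Ztot s \<le> n"
        using that mumax by (intro mult_left_mono) (auto simp: less_imp_le)
      moreover have "0 \<le> Lam * r + mumax * real n"
        using Lam_pos r mumax by (intro add_nonneg_nonneg mult_nonneg_nonneg) (auto simp: less_imp_le)
      ultimately show "norm (?f s * out r s) \<le> Lam * r + mumax * real n"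
        using out_le[of r s] out_nonneg[OF r, of s] by (auto simp: f)
    qed
  qed auto
  note bal = balance[OF st r _ int]
  have upd: "(\<Sum>j\<in>UNIV. (z(i := z i + 1)) j) = Suc (\<Sum>j\<in>UNIV. z j)" for z :: "'i \<Rightarrow> nat" and i
    by (subst (1 2) sum.remove[of UNIV i]) auto
  have dnd: "Suc (\<Sum>j\<in>UNIV. (z(i := z i - 1)) j) = (\<Sum>j\<in>UNIV. z j)" if "0 < z i" for z :: "'i \<Rightarrow> nat" and i
    using that by (subst (1 2) sum.remove[of UNIV i]) auto
  have dr: "drift r ?f s = - Lam * r * indicator {s. Ztot s = n} s
      + (\<Sum>i\<in>UNIV. mu i * real (Zc s i)) * indicator {s. Ztot s = Suc n} s" if "valid_state Kb s" for s
  proof -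
    have "lam i * r * (\<phi> ((Zc s)(i := Zc s i + 1)) - \<phi> (Zc s)) = lam i * (- r * indicator {s. Ztot s = n} s)" for i
      unfolding \<phi>_def upd by (auto simp: indicator_def Ztot_Zc)
    moreover have "mu i * real (Zc s i) * (\<phi> ((Zc s)(i := Zc s i - 1)) - \<phi> (Zc s))
       = mu i * real (Zc s i) * indicator {s. Ztot s = Suc n} s" for i
      using dnd[of "Zc s" i] by (cases "Zc s i = 0") (auto simp: \<phi>_def indicator_def Ztot_Zc)
    moreover have "- Lam * r * indicator {s. Ztot s = n} s = (\<Sum>i\<in>UNIV. lam i * (- r * indicator {s. Ztot s = n} s))"
      unfolding Lam_def sum_distrib_right[symmetric] by simp
    ultimately show ?thesis
      unfolding drift_Zc[OF that] by (simp only: sum_distrib_right)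
  qed
  have "0 = (\<integral>s. drift r ?f s \<partial>measure_pmf \<pi>)" using bal by (simp add: \<phi>_def)
  also have "\<dots> \<ge> (\<integral>s. - Lam * r * indicator {s. Ztot s = n} s
      + mumin * real (Suc n) * indicator {s. Ztot s = Suc n} s \<partial>measure_pmf \<pi>)"
  proof (intro integral_mono_AE)
    show "integrable (measure_pmf \<pi>) (drift r ?f)" using bal by (simp add: \<phi>_def)
    show "integrable (measure_pmf \<pi>) (\<lambda>s. - Lam * r * indicator {s. Ztot s = n} s
      + mumin * real (Suc n) * indicator {s. Ztot s = Suc n} s)"
      by (intro Bochner_Integration.integrable_add integrable_mult_right measure_pmf.integrable_const_bound[where B=1]) auto
    have "mumin * real (Ztot s) \<le> (\<Sum>i\<in>UNIV. mu i * real (Zc s i))" for s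
      unfolding Ztot_Zc of_nat_sum sum_distrib_left by (intro sum_mono mult_right_mono mumin) auto
    then have "- Lam * r * indicator {s. Ztot s = n} s
      + mumin * real (Suc n) * indicator {s. Ztot s = Suc n} s \<le> drift r ?f s" if "valid_state Kb s" for s
      unfolding dr[OF that] by (metis (mono_tags, lifting) add_left_mono indicator_simps(1) indicator_simps(2)
          mem_Collect_eq mult.right_neutral mult_zero_right order_refl)
    then show "AE s in measure_pmf \<pi>. - Lam * r * indicator {s. Ztot s = n} s
      + mumin * real (Suc n) * indicator {s. Ztot s = Suc n} s \<le> drift r ?f s"
      using st by (auto simp: AE_measure_pmf_iff stationary_def)
  qed
  finally have "mumin * real (Suc n) * measure (measure_pmf \<pi>) {s. Ztot s = Suc n} \<le> Lam * r * measure (measure_pmf \<pi>) {s. Ztot s = n}"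
    by (subst (asm) Bochner_Integration.integral_add)
       (auto intro!: integrable_mult_right measure_pmf.integrable_const_bound[where B=1])
  then show ?thesis
    using mumin by (simp add: pmf_map vimage_def field_simps)
qed

lemma Ztot_second_moment:
  assumes st: "stationary Kb lam mu p r \<pi>" and r: "0 < r"
  shows "(\<integral>\<^sup>+ s. ennreal ((real (Ztot s))\<^sup>2) \<partial>measure_pmf \<pi>) \<le> ennreal (Lam * r / mumin * (Lam * r / mumin + 1))"
proof -
  have "0 \<le> Lam * r / mumin" using Lam_pos r mumin by (simp add: less_imp_le)
  from pmf_nat_second_moment[OF this Ztot_recursion[OF st r]] show ?thesis by simp
qed

definition Cout :: real where
  "Cout = 2 * Lam\<^sup>2 + 2 * mumax\<^sup>2 * (Lam / mumin * (Lam / mumin + 1))"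

lemma out_second_moment:
  assumes st: "stationary Kb lam mu p r \<pi>" and r: "1 \<le> r"
  shows "integrable (measure_pmf \<pi>) (\<lambda>s. (out r s)\<^sup>2)" "(\<integral>s. (out r s)\<^sup>2 \<partial>measure_pmf \<pi>) \<le> Cout * r\<^sup>2"
    "integrable (measure_pmf \<pi>) (\<lambda>s. real (Ztot s) * out r s)"
proof -
  have r0: "0 < r" using r by simp
  have iZ: "integrable (measure_pmf \<pi>) (\<lambda>s. (real (Ztot s))\<^sup>2)"
    using Ztot_second_moment[OF st r0] by (intro integrableI_nonneg) (auto intro: le_less_trans)
  have a: "0 \<le> Lam / mumin" using Lam_pos mumin by (simp add: less_imp_le)
  have "(\<integral>s. (real (Ztot s))\<^sup>2 \<partial>measure_pmf \<pi>) \<le> Lam * r / mumin * (Lam * r / mumin + 1)"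
    using Ztot_second_moment[OF st r0] a less_imp_le[OF r0] unfolding nn_integral_eq_integral[OF iZ, simplified]
    by (subst (asm) ennreal_le_iff) (auto intro!: mult_nonneg_nonneg simp: less_imp_le Lam_pos mumin)
  also have "\<dots> = (Lam / mumin) * (Lam / mumin * r\<^sup>2 + r)" by (simp add: power2_eq_square algebra_simps)
  also have "\<dots> \<le> (Lam / mumin) * (Lam / mumin * r\<^sup>2 + r\<^sup>2)"
    using a r by (intro mult_left_mono add_left_mono) (auto simp: power2_eq_square)
  finally have EZ: "(\<integral>s. (real (Ztot s))\<^sup>2 \<partial>measure_pmf \<pi>) \<le> Lam / mumin * (Lam / mumin + 1) * r\<^sup>2"
    by (simp add: algebra_simps)
  have b: "(out r s)\<^sup>2 \<le> 2 * (Lam * r)\<^sup>2 + 2 * mumax\<^sup>2 * (real (Ztot s))\<^sup>2" for s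
  proof -
    have "(out r s)\<^sup>2 \<le> (Lam * r + mumax * real (Ztot s))\<^sup>2"
      using out_le[of r s] out_nonneg[OF r0, of s] by (intro power_mono) auto
    also have "\<dots> \<le> 2 * (Lam * r)\<^sup>2 + 2 * (mumax * real (Ztot s))\<^sup>2"
      using sum_squares_bound[of "Lam * r" "mumax * real (Ztot s)"] by (simp add: power2_sum)
    finally show ?thesis by (simp add: power_mult_distrib)
  qed
  have ib: "integrable (measure_pmf \<pi>) (\<lambda>s. 2 * (Lam * r)\<^sup>2 + 2 * mumax\<^sup>2 * (real (Ztot s))\<^sup>2)"
    using iZ by auto
  show io: "integrable (measure_pmf \<pi>) (\<lambda>s. (out r s)\<^sup>2)"
    by (rule Bochner_Integration.integrable_bound[OF ib]) (use b in \<open>auto intro!: AE_I2 simp: abs_of_nonneg intro: order_trans\<close>)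
  have "(\<integral>s. (out r s)\<^sup>2 \<partial>measure_pmf \<pi>) \<le> (\<integral>s. 2 * (Lam * r)\<^sup>2 + 2 * mumax\<^sup>2 * (real (Ztot s))\<^sup>2 \<partial>measure_pmf \<pi>)"
    by (intro integral_mono io ib b)
  also have "\<dots> = 2 * (Lam * r)\<^sup>2 + 2 * mumax\<^sup>2 * (\<integral>s. (real (Ztot s))\<^sup>2 \<partial>measure_pmf \<pi>)"
    using iZ by simp
  also have "\<dots> \<le> 2 * (Lam * r)\<^sup>2 + 2 * mumax\<^sup>2 * (Lam / mumin * (Lam / mumin + 1) * r\<^sup>2)"
    using EZ by (intro add_left_mono mult_left_mono) auto
  also have "\<dots> = Cout * r\<^sup>2" by (simp add: Cout_def algebra_simps power_mult_distrib)
  finally show "(\<integral>s. (out r s)\<^sup>2 \<partial>measure_pmf \<pi>) \<le> Cout * r\<^sup>2" .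
  have "real (Ztot s) * out r s \<le> (real (Ztot s))\<^sup>2 + (out r s)\<^sup>2" for s
    using sum_squares_bound[of "real (Ztot s)" "out r s"] zero_le_power2[of "real (Ztot s)"] zero_le_power2[of "out r s"]
    by linarith
  then show "integrable (measure_pmf \<pi>) (\<lambda>s. real (Ztot s) * out r s)"
    by (intro Bochner_Integration.integrable_bound[OF Bochner_Integration.integrable_add[OF iZ io]])
       (auto intro!: AE_I2 simp: abs_of_nonneg out_nonneg[OF r0])
qed

lemma out_integrable:
  assumes st: "stationary Kb lam mu p r \<pi>" and r: "1 \<le> r"
  shows "integrable (measure_pmf \<pi>) (out r)"
proof -
  have *: "norm (out r s) \<le> norm (1 + (out r s)\<^sup>2)" for s
    using sum_squares_bound[of 1 "out r s"] zero_le_power2[of "out r s"] out_nonneg[of r s] r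
    unfolding power_one by simp
  have "integrable (measure_pmf \<pi>) (\<lambda>s. 1 + (out r s)\<^sup>2)"
    using out_second_moment(1)[OF st r] by simp
  then show ?thesis
    by (rule Bochner_Integration.integrable_bound) (use * in auto)
qed

text \<open>The cut is now taken in the single coordinate \<open>j\<close>, where the departure rate
  is exactly \<open>mu j * real (Suc n)\<close>; integrability comes from the moment bounds on
  \<open>out\<close>.\<close>

lemma Zc_poisson:
  assumes st: "stationary Kb lam mu p r \<pi>" and r: "1 \<le> r"
  shows "map_pmf (\<lambda>s. Zc s j) \<pi> = poisson_pmf (lam j / mu j * r)"
proof (rule poisson_pmf_unique)
  have r0: "0 < r" using r by simp
  show "0 < lam j / mu j * r" using lam_pos mu_pos r0 by simp
  fix n
  define \<phi> :: "('i \<Rightarrow> nat) \<Rightarrow> real" where "\<phi> z = of_bool (z j \<le> n)" for z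
  let ?f = "\<lambda>s. \<phi> (Zc s)"
  have int: "integrable (measure_pmf \<pi>) (\<lambda>s. ?f s * out r s)"
    by (rule Bochner_Integration.integrable_bound[OF out_integrable[OF st r]]) (auto intro!: AE_I2 simp: \<phi>_def)
  note bal = balance[OF st r0 _ int]
  have dr: "drift r ?f s = - (lam j * r) * indicator {s. Zc s j = n} s
      + mu j * real (Suc n) * indicator {s. Zc s j = Suc n} s" if "valid_state Kb s" for s
  proof -
    have "lam i * r * (\<phi> ((Zc s)(i := Zc s i + 1)) - \<phi> (Zc s)) =
       (if i = j then - (lam j * r) * indicator {s. Zc s j = n} s else 0)" for i
      unfolding \<phi>_def by (auto simp: indicator_def)
    moreover have "mu i * real (Zc s i) * (\<phi> ((Zc s)(i := Zc s i - 1)) - \<phi> (Zc s))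
       = (if i = j then mu j * real (Suc n) * indicator {s. Zc s j = Suc n} s else 0)" for i
      by (cases "Zc s i = 0") (auto simp: \<phi>_def indicator_def)
    ultimately show ?thesis
      unfolding drift_Zc[OF that] by simp
  qed
  have "0 = (\<integral>s. drift r ?f s \<partial>measure_pmf \<pi>)" using bal by (simp add: \<phi>_def)
  also have "\<dots> = (\<integral>s. - (lam j * r) * indicator {s. Zc s j = n} s
      + mu j * real (Suc n) * indicator {s. Zc s j = Suc n} s \<partial>measure_pmf \<pi>)"
    using st dr by (intro integral_cong_AE) (auto simp: AE_measure_pmf_iff stationary_def)
  also have "\<dots> = - (lam j * r) * measure (measure_pmf \<pi>) {s. Zc s j = n}
     + mu j * real (Suc n) * measure (measure_pmf \<pi>) {s. Zc s j = Suc n}"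
    by (subst Bochner_Integration.integral_add)
       (auto intro!: integrable_mult_right measure_pmf.integrable_const_bound[where B=1])
  finally show "real (Suc n) * pmf (map_pmf (\<lambda>s. Zc s j) \<pi>) (Suc n) = lam j / mu j * r * pmf (map_pmf (\<lambda>s. Zc s j) \<pi>) n"
    using mu_pos[of j] by (simp add: pmf_map vimage_def field_simps)
qed

section \<open>Concentration of the customer numbers\<close>

abbreviation rho :: "'i \<Rightarrow> real" where "rho i \<equiv> lam i / mu i"

lemma rho_pos: "0 < rho i" and rho_le_1: "rho i \<le> 1"
proof -
  show *: "0 < rho i" for i using lam_pos mu_pos by simp
  have "rho i = (\<Sum>i\<in>{i}. rho i)" by simp
  also have "\<dots> \<le> (\<Sum>i\<in>UNIV. rho i)" using * by (intro sum_mono2) (auto intro: less_imp_le)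
  finally show "rho i \<le> 1" using load by simp
qed

text \<open>The exponent 5/8 exceeds 1/2, which makes the exceptional probability smaller than every
  power of \<open>r\<close>, and stays below 3/4, the exponent of the tolerated drift error.\<close>

definition good :: "real \<Rightarrow> 'i state \<Rightarrow> bool" where
  "good r s \<longleftrightarrow> (\<forall>i. \<bar>real (Zc s i) - rho i * r\<bar> \<le> r powr (5/8))"

lemma prob_not_good:
  assumes st: "stationary Kb lam mu p r \<pi>" and r: "1 \<le> r"
  shows "measure (measure_pmf \<pi>) {s. \<not> good r s} \<le> 2 * real CARD('i) * exp (- (r powr (1/4) / 4))"
proof -
  \<comment> \<open>With this tilt the deviation \<open>r powr (5/8)\<close> contributes
    \<open>?c\<close>, while the quadratic Chernoff term is at most \<open>?c / 2\<close>.\<close>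
  let ?t = "r powr (- 3 / 8) / 2" and ?c = "r powr (1/4) / 2"
  have t: "\<bar>?t\<bar> \<le> 1" "\<bar>- ?t\<bar> \<le> 1" using powr_mono[of "-3/8" 0 r] r by auto
  have t2: "rho i * r * ?t\<^sup>2 - ?c \<le> - (r powr (1/4) / 4)" for i
  proof -
    have "r * ?t\<^sup>2 = r powr (1/4) / 4" using r
      by (simp add: power2_eq_square powr_add[symmetric] powr_mult_base)
    then have "rho i * r * ?t\<^sup>2 = rho i * (r powr (1/4) / 4)" by (simp only: mult.assoc)
    also have "\<dots> \<le> 1 * (r powr (1/4) / 4)" using rho_le_1 by (intro mult_right_mono) auto
    finally show ?thesis by linarith
  qed
  have one: "measure (measure_pmf \<pi>) {s. r powr (5/8) < \<bar>real (Zc s i) - rho i * r\<bar>} \<le> 2 * exp (- (r powr (1/4) / 4))" for i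
  proof -
    let ?A = "\<lambda>t. {n. ?c \<le> t * (real n - rho i * r)}"
    have pos: "0 < rho i * r" using rho_pos[of i] r by (intro mult_pos_pos) auto
    have tt: "?t * r powr (5/8) = ?c" by (simp add: powr_add[symmetric])
    have "{n. r powr (5/8) < \<bar>real n - rho i * r\<bar>} \<subseteq> ?A ?t \<union> ?A (- ?t)"
    proof
      fix n assume "n \<in> {n. r powr (5/8) < \<bar>real n - rho i * r\<bar>}"
      then have "?t * r powr (5/8) \<le> ?t * \<bar>real n - rho i * r\<bar>" by (intro mult_left_mono) auto
      then show "n \<in> ?A ?t \<union> ?A (- ?t)" unfolding tt by (cases "0 \<le> real n - rho i * r") (simp_all only: abs_of_nonneg abs_of_neg not_le mem_Collect_eq Un_iff mult_minus_left mult_minus_right simp_thms)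
    qed
    then have "measure (measure_pmf (poisson_pmf (rho i * r))) {n. r powr (5/8) < \<bar>real n - rho i * r\<bar>}
      \<le> measure (measure_pmf (poisson_pmf (rho i * r))) (?A ?t \<union> ?A (- ?t))"
      by (intro measure_pmf.finite_measure_mono) auto
    also have "\<dots> \<le> measure (measure_pmf (poisson_pmf (rho i * r))) (?A ?t) + measure (measure_pmf (poisson_pmf (rho i * r))) (?A (- ?t))"
      by (rule measure_Un_le) auto
    also have "\<dots> \<le> exp (rho i * r * ?t\<^sup>2 - ?c) + exp (rho i * r * (- ?t)\<^sup>2 - ?c)"
      by (intro add_mono poisson_pmf_chernoff[OF pos] t)
    also have "\<dots> \<le> 2 * exp (- (r powr (1/4) / 4))"
      using t2[of i] by simp
    finally show ?thesis unfolding Zc_poisson[OF st r, symmetric] by (simp add: vimage_def)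
  qed
  have "measure (measure_pmf \<pi>) {s. \<not> good r s} = measure (measure_pmf \<pi>) (\<Union>i. {s. r powr (5/8) < \<bar>real (Zc s i) - rho i * r\<bar>})"
    by (intro arg_cong[where f="measure _"]) (auto simp: good_def not_le)
  also have "\<dots> \<le> (\<Sum>i\<in>UNIV. measure (measure_pmf \<pi>) {s. r powr (5/8) < \<bar>real (Zc s i) - rho i * r\<bar>})"
    by (rule measure_pmf.finite_measure_subadditive_finite) auto
  also have "\<dots> \<le> (\<Sum>i\<in>(UNIV::'i set). 2 * exp (- (r powr (1/4) / 4)))"
    by (intro sum_mono one)
  finally show ?thesis by simp
qed

text \<open>The second bound is there because on states that are not good the drift of a bounded
  test function is controlled only by a multiple of \<open>out\<close>.\<close>

lemma eventually_not_good_small: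
  "\<forall>\<^sub>F r in at_top. \<forall>\<pi>. stationary Kb lam mu p r \<pi> \<longrightarrow>
     measure (measure_pmf \<pi>) {s. \<not> good r s} \<le> r powr - M \<and>
     (\<integral>s. out r s * indicator {s. \<not> good r s} s \<partial>measure_pmf \<pi>) \<le> r powr - M"
proof -
  let ?e = "\<lambda>r. 2 * real CARD('i) * exp (- (r powr (1/4) / 4))"
  have "\<forall>\<^sub>F r in at_top. ?e r \<le> r powr - M" by real_asymp
  moreover have "\<forall>\<^sub>F r in at_top. Cout * r\<^sup>2 * r powr (- M - 3) + ?e r * r powr (M + 3) \<le> r powr - M"
  proof -
    have "((\<lambda>r::real. Cout / r + 2 * real CARD('i) * (exp (- (r powr (1/4) / 4)) * r powr (2 * M + 3))) \<longlongrightarrow> 0 + 2 * real CARD('i) * 0) at_top"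
    proof (intro tendsto_add tendsto_mult tendsto_const)
      show "((\<lambda>r::real. Cout / r) \<longlongrightarrow> 0) at_top"
        by (intro tendsto_divide_0[OF tendsto_const] filterlim_at_top_imp_at_infinity filterlim_ident)
      show "((\<lambda>r::real. exp (- (r powr (1/4) / 4)) * r powr (2 * M + 3)) \<longlongrightarrow> 0) at_top"
        by real_asymp
    qed
    then have "\<forall>\<^sub>F r in at_top. Cout / r + 2 * real CARD('i) * (exp (- (r powr (1/4) / 4)) * r powr (2 * M + 3)) < 1"
      by (rule order_tendstoD) simp
    then show ?thesis using eventually_gt_at_top[of 0]
    proof eventually_elim
      case (elim r)
      have "Cout * r\<^sup>2 * r powr (- M - 3) + ?e r * r powr (M + 3) =
         r powr - M * (Cout / r + 2 * real CARD('i) * (exp (- (r powr (1/4) / 4)) * r powr (2 * M + 3)))"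
      proof -
        have 1: "r\<^sup>2 * r powr (- M - 3) = r powr - M / r"
        proof -
          have "r\<^sup>2 * r powr (- M - 3) = r powr 2 * r powr (- M - 3)" using elim(2) by simp
          also have "\<dots> = r powr (- M - 1)" by (subst powr_add[symmetric]) (rule arg_cong[where f="(powr) r"], simp)
          also have "\<dots> = r powr - M / r" using elim(2) by (simp only: powr_diff powr_one)
          finally show ?thesis .
        qed
        have 2: "r powr (M + 3) = r powr - M * r powr (2 * M + 3)"
          by (simp only: powr_add[symmetric]) simp
        have "Cout * r\<^sup>2 * r powr (- M - 3) + ?e r * r powr (M + 3) =
           Cout * (r\<^sup>2 * r powr (- M - 3)) + ?e r * r powr (M + 3)" by (simp only: mult.assoc)
        also have "\<dots> = r powr - M * (Cout / r + 2 * real CARD('i) * (exp (- (r powr (1/4) / 4)) * r powr (2 * M + 3)))"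
          unfolding 1 2 by (simp only: distrib_left times_divide_eq_right mult_ac)
        finally show ?thesis .
      qed
      also have "\<dots> \<le> r powr - M * 1" using elim by (intro mult_left_mono) auto
      finally show ?case by simp
    qed
  qed
  ultimately show ?thesis
    using eventually_ge_at_top[of 1]
  proof eventually_elim
    case (elim r)
    then have r0: "0 < r" by simp
    show ?case
    proof (intro allI impI conjI)
      fix \<pi> assume st: "stationary Kb lam mu p r \<pi>"
      let ?P = "measure (measure_pmf \<pi>) {s. \<not> good r s}"
      have P: "?P \<le> ?e r" by (rule prob_not_good[OF st elim(3)])
      then show "?P \<le> r powr - M" using elim by linarith
      \<comment> \<open>Weight for splitting \<open>out\<close> into its square and a constant: the
        second moment then contributes order \<open>r powr (- M - 1)\<close>, and
        \<open>1 / \<eta>\<close> is only polynomial against an exponentially small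
        probability.\<close>
      define \<eta> where "\<eta> = r powr (- M - 3)"
      have \<eta>: "0 < \<eta>" using r0 by (simp add: \<eta>_def)
      have pw: "out r s * indicator {s. \<not> good r s} s \<le> \<eta> * (out r s)\<^sup>2 + (1 / \<eta>) * indicator {s. \<not> good r s} s" for s
      proof -
        have "out r s \<le> \<eta> * (out r s)\<^sup>2 + 1 / \<eta>"
        proof -
          have "0 \<le> (\<eta> * out r s - 1)\<^sup>2 + \<eta> * out r s" using \<eta> out_nonneg[OF r0, of s] by simp
          then have "\<eta> * out r s \<le> \<eta> * (\<eta> * (out r s)\<^sup>2 + 1 / \<eta>)"
            using \<eta> by (simp add: power2_eq_square algebra_simps)
          then show ?thesis using \<eta> by (simp only: mult_le_cancel_left_pos)
        qed
        then show ?thesis using \<eta> by (auto simp: indicator_def)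
      qed
      have ind: "integrable (measure_pmf \<pi>) (indicator {s. \<not> good r s} :: 'i state \<Rightarrow> real)"
        by (rule measure_pmf.integrable_const_bound[where B=1]) auto
      have "(\<integral>s. out r s * indicator {s. \<not> good r s} s \<partial>measure_pmf \<pi>)
        \<le> (\<integral>s. \<eta> * (out r s)\<^sup>2 + (1 / \<eta>) * indicator {s. \<not> good r s} s \<partial>measure_pmf \<pi>)"
        by (rule integral_mono[OF _ _ pw])
           (use ind out_second_moment(1)[OF st elim(3)] in \<open>auto intro!: integrable_real_mult_indicator out_integrable[OF st elim(3)]
             simp del: integrable_indicator_iff\<close>)
      also have "\<dots> = \<eta> * (\<integral>s. (out r s)\<^sup>2 \<partial>measure_pmf \<pi>) + (1 / \<eta>) * ?P"
        by (subst Bochner_Integration.integral_add)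
          (use ind out_second_moment(1)[OF st elim(3)] in auto)
      also have "\<dots> \<le> \<eta> * (Cout * r\<^sup>2) + (1 / \<eta>) * ?e r"
        using \<eta> P out_second_moment(2)[OF st elim(3)] by (intro add_mono mult_left_mono) auto
      also have "\<dots> = Cout * r\<^sup>2 * r powr (- M - 3) + ?e r * r powr (M + 3)"
      proof -
        have "1 / \<eta> = r powr (M + 3)"
          unfolding \<eta>_def using powr_minus_divide[of r "- M - 3"] by (simp add: add.commute)
        then show ?thesis unfolding \<eta>_def by (simp only: mult_ac)
      qed
      finally show "(\<integral>s. out r s * indicator {s. \<not> good r s} s \<partial>measure_pmf \<pi>) \<le> r powr - M" using elim by linarith
    qed
  qed
qed

end

section \<open>Entropy and its drift\<close>

lemma powr_diff_le:
  assumes "1 \<le> a" "1 \<le> b" "0 \<le> q" "q \<le> (1::real)"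
  shows "\<bar>a powr q - b powr q\<bar> \<le> \<bar>a - b\<bar>"
proof -
  have *: "a powr q - b powr q \<le> a - b" if "b \<le> a" "1 \<le> b" for a b :: real
  proof -
    have "a powr q = b powr q * (a / b) powr q" using that by (simp add: powr_divide)
    also have "\<dots> \<le> b powr q * (a / b)"
      using that assms powr_mono[of q 1 "a / b"] by (intro mult_left_mono) auto
    finally have "a powr q - b powr q \<le> b powr q * ((a - b) / b)" using that by (simp add: field_simps)
    also have "\<dots> \<le> b * ((a - b) / b)"
      using that assms powr_mono[of q 1 b] by (intro mult_right_mono) auto
    finally show ?thesis using that by simp
  qed
  show ?thesis
    using *[of b a] *[of a b] powr_mono2[of q a b] powr_mono2[of q b a] assms by (cases "b \<le> a") auto
qed

lemma abs_ln_le: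
  assumes "1 \<le> r" "1 / r ^ 3 \<le> x" "x \<le> r ^ 3"
  shows "\<bar>ln x\<bar> \<le> 3 * ln (r::real)"
proof -
  have x: "0 < x" using assms by (intro less_le_trans[OF _ assms(2)]) auto
  have "ln x \<le> ln (r ^ 3)" using assms x by (intro ln_mono) auto
  moreover have "ln (1 / r ^ 3) \<le> ln x" using assms by (intro ln_mono) auto
  ultimately show ?thesis using assms by (auto simp: ln_realpow ln_div)
qed

lemma add_cust_neq_zero [simp]: "add_cust k i \<noteq> (\<lambda>_. 0)"
  by (metis add_cust_def add_is_0 fun_upd_same zero_neq_one)

lemma add_cust_neq [simp]: "add_cust k i \<noteq> k" "k \<noteq> add_cust k i"
  unfolding add_cust_def by (metis fun_upd_same n_not_Suc_n Suc_eq_plus1)+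

lemma rem_add_cust [simp]: "rem_cust (add_cust k i) i = k"
  by (simp add: rem_cust_def add_cust_def)

lemma add_rem_cust [simp]: "0 < k i \<Longrightarrow> add_cust (rem_cust k i) i = k"
  by (simp add: rem_cust_def add_cust_def)

lemma rem_cust_neq: "0 < k i \<Longrightarrow> rem_cust k i \<noteq> k"
  using add_cust_neq(2)[of "rem_cust k i" i] by simp

context grand_ff
begin

section \<open>Edges between configurations and the entropy\<close>

definition Kz :: "'i config set" where "Kz = Kb - {\<lambda>_. 0}"

definition edges :: "'i \<Rightarrow> 'i config set" where "edges i = {k \<in> Kb. add_cust k i \<in> Kb}"

definition cf :: "'i config \<Rightarrow> real" where "cf k = (\<Prod>i\<in>UNIV. fact (k i))"

text \<open>\<open>Lyap\<close> is a discrete version of the entropy of the counts \<open>Xc\<close> relative to the measure with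
  weights \<open>r powr p / cf k\<close>. The shift by \<open>sqrt r\<close> makes its second differences at most
  \<open>1 / sqrt r\<close>, also at small counts.\<close>

definition Psi :: "real \<Rightarrow> 'i config \<Rightarrow> nat \<Rightarrow> real" where
  "Psi r k n = (\<Sum>j<n. ln ((real j + 1 + sqrt r) * cf k / r powr p))"

definition Lyap :: "real \<Rightarrow> 'i state \<Rightarrow> real" where
  "Lyap r s = (\<Sum>k\<in>Kz. Psi r k (Xc s k))"

text \<open>Counts with the same shift as in \<open>Psi\<close>. The empty configuration gets the
  reference value \<open>r powr p\<close>, which makes its \<open>G\<close> vanish and lets it act
  as an ordinary vertex of the edges.\<close>

definition Yc :: "real \<Rightarrow> 'i state \<Rightarrow> 'i config \<Rightarrow> real" where
  "Yc r s k = (if k = (\<lambda>_. 0) then r powr p else real (Xc s k) + sqrt r)"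

text \<open>The amount by which \<open>Lyap\<close> falls when a server leaves configuration
  \<open>k\<close>; \<open>Gp\<close> is the amount by which it rises when a server enters
  \<open>k\<close>.\<close>

definition G :: "real \<Rightarrow> 'i state \<Rightarrow> 'i config \<Rightarrow> real" where
  "G r s k = ln (Yc r s k * cf k / r powr p)"

definition Gp :: "real \<Rightarrow> 'i state \<Rightarrow> 'i config \<Rightarrow> real" where
  "Gp r s k = (if k = (\<lambda>_. 0) then 0 else ln ((real (Xc s k) + 1 + sqrt r) * cf k / r powr p))"

text \<open>The counts that the placement rule really uses, with \<open>X0\<close> as the count of
  the empty configuration.\<close>

definition Xh :: "'i state \<Rightarrow> 'i config \<Rightarrow> real" where
  "Xh s k = (if k = (\<lambda>_. 0) then real (X0 p s) else real (Xc s k))"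

text \<open>Arrival flow along the edge from \<open>k\<close> to \<open>add_cust k i\<close>;
  \<open>W\<close> is the departure flow back. Both use the shifted counts, hence are positive and
  have logarithms.\<close>

definition V :: "real \<Rightarrow> 'i state \<Rightarrow> 'i \<Rightarrow> 'i config \<Rightarrow> real" where
  "V r s i k = lam i * r * Yc r s k / real (Xi Kb p s i)"

definition W :: "real \<Rightarrow> 'i state \<Rightarrow> 'i \<Rightarrow> 'i config \<Rightarrow> real" where
  "W r s i k = mu i * (real (k i) + 1) * Yc r s (add_cust k i)"

definition Diss :: "real \<Rightarrow> 'i state \<Rightarrow> real" where
  "Diss r s = (\<Sum>i\<in>UNIV. \<Sum>k\<in>edges i. (V r s i k - W r s i k) * (ln (V r s i k) - ln (W r s i k)))"

definition Occ :: "'i state \<Rightarrow> nat" where "Occ s = card (occ s)"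

lemma finite_Kz [simp]: "finite Kz" and finite_edges [simp]: "finite (edges i)"
  using finite_Kb by (auto simp: Kz_def edges_def)

lemma Occ_le_Ztot:
  assumes "valid_state Kb s"
  shows "Occ s \<le> Ztot s"
proof -
  have "1 \<le> (\<Sum>i\<in>UNIV. s l i)" if "l \<in> occ s" for l
  proof -
    from that have "s l \<noteq> (\<lambda>_. 0)" by (simp add: occ_def)
    then obtain i where "s l i \<noteq> 0" by blast
    moreover have "s l i \<le> (\<Sum>i\<in>UNIV. s l i)" by (rule member_le_sum) auto
    ultimately show ?thesis by linarith
  qed
  then show ?thesis
    unfolding Occ_def Ztot_def card_eq_sum by (intro sum_mono) auto
qed

lemma cf_pos: "0 < cf k" and cf_ge_1: "1 \<le> cf k"
  by (auto simp: cf_def intro!: prod_pos prod_ge_1 fact_ge_1)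

lemma cf_zero: "cf (\<lambda>_. 0) = 1"
  by (simp add: cf_def)

lemma cf_add: "cf (add_cust k i) = (real (k i) + 1) * cf k"
proof -
  let ?P = "\<Prod>j\<in>UNIV - {i}. fact (k j) :: real"
  have "cf (add_cust k i) = fact (k i + 1) * ?P"
    unfolding cf_def by (subst prod.remove[of UNIV i]) (auto simp: add_cust_def)
  also have "\<dots> = (real (k i) + 1) * (fact (k i) * ?P)"
    by (simp add: algebra_simps)
  also have "fact (k i) * ?P = cf k"
    unfolding cf_def by (rule prod.remove[symmetric]) auto
  finally show ?thesis .
qed

lemma valid_config:
  assumes "valid_state Kb s" "l \<in> occ s"
  shows "s l \<in> Kz"
  using assms by (auto simp: Kz_def valid_state_def occ_def)

lemma Xc_update:
  assumes "valid_state Kb s" "0 < l" "k' \<noteq> (\<lambda>_. 0)"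
  shows "int (Xc (s(l := k)) k') = int (Xc s k') + of_bool (k = k') - of_bool (s l = k')"
proof -
  have X: "int (Xc s k') = (\<Sum>l\<in>occ s. of_bool (s l = k'))" if "finite (occ s)" for s :: "'i state"
    using that by (simp add: Xc_def sum.If_cases of_bool_def Collect_conj_eq)
  have "occ (s(l := k)) \<subseteq> insert l (occ s)" by (auto simp: occ_def)
  then have f: "finite (occ (s(l := k)))" by (rule finite_subset) (simp add: finite_occ[OF assms(1)])
  show ?thesis
    using occ_sum_update[OF finite_occ[OF assms(1)] assms(2), of "\<lambda>_ k. of_bool (k = k') :: int" k] assms(3)
    unfolding X[OF f] X[OF finite_occ[OF assms(1)]] by auto
qed

text \<open>One server moves from \<open>s l\<close> to \<open>k\<close>, so only two summands of
  \<open>Lyap\<close> change. As the two configurations differ, both changes are evaluated at the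
  old counts; an empty endpoint contributes zero.\<close>

lemma Lyap_update:
  assumes v: "valid_state Kb s" and l: "0 < l" and k: "k \<in> Kb" "k \<noteq> s l" and r: "0 < r"
  shows "Lyap r (s(l := k)) - Lyap r s = Gp r s k - G r s (s l)"
proof -
  have sl: "s l \<in> Kb" using v by (auto simp: valid_state_def)
  have d: "Psi r k' (Xc (s(l := k)) k') - Psi r k' (Xc s k')
      = (if k' = k then Gp r s k else 0) - (if k' = s l then G r s (s l) else 0)" if "k' \<in> Kz" for k'
  proof -
    have k0: "k' \<noteq> (\<lambda>_. 0)" using that by (auto simp: Kz_def)
    note u = Xc_update[OF v l k0, of k]
    consider "k' = k" | "k' = s l" | "k' \<noteq> k" "k' \<noteq> s l" by blast
    then show ?thesis
    proof cases
      case 1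
      then have "Xc (s(l := k)) k' = Suc (Xc s k')" using u k(2) by auto
      then show ?thesis using 1 k(2) k0 by (simp add: Psi_def Gp_def)
    next
      case 2
      then have "Xc s k' = Suc (Xc (s(l := k)) k')" using u k(2) by auto
      then show ?thesis using 2 k(2) k0 by (auto simp: Psi_def G_def Yc_def add_ac)
    next
      case 3
      then have "Xc (s(l := k)) k' = Xc s k'" using u by auto
      then show ?thesis using 3 by simp
    qed
  qed
  have "Lyap r (s(l := k)) - Lyap r s = (\<Sum>k'\<in>Kz. (if k' = k then Gp r s k else 0) - (if k' = s l then G r s (s l) else 0))"
    unfolding Lyap_def sum_subtractf[symmetric] by (intro sum.cong refl d)
  also have "\<dots> = (if k \<in> Kz then Gp r s k else 0) - (if s l \<in> Kz then G r s (s l) else 0)"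
    by (simp add: sum_subtractf)
  also have "\<dots> = Gp r s k - G r s (s l)"
    using k sl r by (auto simp: Kz_def Gp_def G_def Yc_def cf_zero)
  finally show ?thesis .
qed

lemma occ_sum:
  assumes "valid_state Kb s"
  shows "(\<Sum>l\<in>occ s. F (s l)) = (\<Sum>k\<in>Kz. real (Xc s k) * F k)"
proof -
  have "(\<Sum>l\<in>occ s. F (s l)) = (\<Sum>k\<in>Kz. \<Sum>l | l \<in> occ s \<and> s l = k. F (s l))"
    using valid_config[OF assms] by (intro sum.group[symmetric] finite_occ[OF assms]) auto
  also have "\<dots> = (\<Sum>k\<in>Kz. real (Xc s k) * F k)"
    by (simp add: Xc_def)
  finally show ?thesis .
qed

lemma zero_in_edges: "(\<lambda>_. 0) \<in> edges i"
  using zero_Kb unitv_Kb by (auto simp: edges_def)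

text \<open>Treating the opening of an empty server as an arrival at the empty configuration turns
  all arrivals into a single sum over edges.\<close>

lemma arrival_sum:
  assumes "valid_state Kb s"
  shows "real (X0 p s) * F (\<lambda>_. 0) + (\<Sum>l\<in>acc Kb s i. F (s l)) = (\<Sum>k\<in>edges i. Xh s k * F k)"
proof -
  have "(\<Sum>l\<in>acc Kb s i. F (s l)) = (\<Sum>l\<in>occ s. if add_cust (s l) i \<in> Kb then F (s l) else 0)"
    unfolding acc_def by (rule sum.inter_filter[OF finite_occ[OF assms]])
  also have "\<dots> = (\<Sum>k\<in>Kz. real (Xc s k) * (if add_cust k i \<in> Kb then F k else 0))"
    by (rule occ_sum[OF assms])
  also have "\<dots> = (\<Sum>k\<in>edges i - {\<lambda>_. 0}. Xh s k * F k)"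
  proof -
    have "edges i - {\<lambda>_. 0} = {k \<in> Kz. add_cust k i \<in> Kb}" by (auto simp: edges_def Kz_def)
    then have "(\<Sum>k\<in>edges i - {\<lambda>_. 0}. Xh s k * F k) = (\<Sum>k\<in>Kz. if add_cust k i \<in> Kb then Xh s k * F k else 0)"
      by (simp only: sum.inter_filter[OF finite_Kz])
    also have "\<dots> = (\<Sum>k\<in>Kz. real (Xc s k) * (if add_cust k i \<in> Kb then F k else 0))"
      by (intro sum.cong refl) (simp add: Xh_def Kz_def)
    finally show ?thesis ..
  qed
  finally show ?thesis
    by (subst sum.remove[OF finite_edges zero_in_edges]) (simp add: Xh_def)
qed

lemma departure_sum:
  assumes "valid_state Kb s"
  shows "(\<Sum>l\<in>occ s. real (s l i) * F (s l)) = (\<Sum>k\<in>edges i. (real (k i) + 1) * real (Xc s (add_cust k i)) * F (add_cust k i))"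
proof -
  have "(\<Sum>l\<in>occ s. real (s l i) * F (s l)) = (\<Sum>k\<in>Kz. real (Xc s k) * (real (k i) * F k))"
    by (rule occ_sum[OF assms])
  also have "\<dots> = (\<Sum>k\<in>{k \<in> Kz. 0 < k i}. real (Xc s k) * (real (k i) * F k))"
    by (intro sum.mono_neutral_right) auto
  also have "\<dots> = (\<Sum>k\<in>edges i. (real (k i) + 1) * real (Xc s (add_cust k i)) * F (add_cust k i))"
  proof (rule sum.reindex_bij_witness[where i="\<lambda>k. add_cust k i" and j="\<lambda>k. rem_cust k i"])
    fix k assume k: "k \<in> {k \<in> Kz. 0 < k i}"
    then show "add_cust (rem_cust k i) i = k" by simp
    have "rem_cust k i \<in> Kb" by (rule Kb_mono[of k]) (use k in \<open>auto simp: Kz_def rem_cust_def\<close>)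
    then show "rem_cust k i \<in> edges i" using k by (auto simp: edges_def Kz_def)
    have "real (rem_cust k i i) + 1 = real (k i)" using k by (simp add: rem_cust_def)
    then show "(real (rem_cust k i i) + 1) * real (Xc s (add_cust (rem_cust k i) i)) * F (add_cust (rem_cust k i) i)
      = real (Xc s k) * (real (k i) * F k)" using k by simp
  next
    fix k assume "k \<in> edges i"
    then show "add_cust k i \<in> {k \<in> Kz. 0 < k i}" by (auto simp: edges_def Kz_def) (simp add: add_cust_def)
  qed simp
  finally show ?thesis .
qed

lemma Xi_sum:
  assumes "valid_state Kb s"
  shows "real (Xi Kb p s i) = (\<Sum>k\<in>edges i. Xh s k)"
  using arrival_sum[OF assms, of "\<lambda>_. 1" i] by (simp add: Xi_def)

lemma Zc_sum:
  assumes "valid_state Kb s"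
  shows "real (Zc s i) = (\<Sum>k\<in>edges i. (real (k i) + 1) * real (Xc s (add_cust k i)))"
  using departure_sum[OF assms, of i "\<lambda>_. 1"] by (simp add: Zc_def)

lemma Lyap_up:
  assumes v: "valid_state Kb s" and r: "0 < r" and l: "l \<in> acc Kb s i \<or> l = fe s"
  shows "Lyap r (up s l i) - Lyap r s = Gp r s (add_cust (s l) i) - G r s (s l)"
proof -
  have "0 < l" using l first_empty[OF v] by (auto simp: acc_def occ_def)
  moreover have "add_cust (s l) i \<in> Kb" using l first_empty(2)[OF v] unitv_Kb by (auto simp: acc_def)
  ultimately show ?thesis unfolding up_def by (intro Lyap_update v r) auto
qed

lemma Lyap_down:
  assumes v: "valid_state Kb s" and r: "0 < r" and l: "l \<in> occ s" "0 < s l i"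
  shows "Lyap r (down s l i) - Lyap r s = Gp r s (rem_cust (s l) i) - G r s (s l)"
proof -
  have "s l \<in> Kb" using v by (auto simp: valid_state_def)
  then have "rem_cust (s l) i \<in> Kb" by (rule Kb_mono) (auto simp: rem_cust_def)
  then show ?thesis unfolding down_def
    using l by (intro Lyap_update v r rem_cust_neq) (auto simp: occ_def)
qed

text \<open>Arrivals into \<open>k\<close> are paired with departures from
  \<open>add_cust k i\<close>, so each edge carries two opposite flows. Positivity of
  \<open>Xi\<close> excludes the default branch of \<open>w0\<close>.\<close>

lemma drift_Lyap:
  assumes v: "valid_state Kb s" and r: "0 < r" and X: "\<And>i. 0 < Xi Kb p s i"
  shows "drift r (Lyap r) s = (\<Sum>i\<in>UNIV. \<Sum>k\<in>edges i.
     lam i * r * Xh s k / real (Xi Kb p s i) * (Gp r s (add_cust k i) - G r s k)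
     + mu i * (real (k i) + 1) * real (Xc s (add_cust k i)) * (Gp r s k - G r s (add_cust k i)))"
proof -
  have 1: "lam i * r * (w0 s i * (Lyap r (up s (fe s) i) - Lyap r s)
        + (\<Sum>l\<in>acc Kb s i. (Lyap r (up s l i) - Lyap r s) / real (Xi Kb p s i)))
     = (\<Sum>k\<in>edges i. lam i * r * Xh s k / real (Xi Kb p s i) * (Gp r s (add_cust k i) - G r s k))" (is "?a = ?b") for i
  proof -
    have "?a = lam i * r / real (Xi Kb p s i) * (real (X0 p s) * (Gp r s (add_cust (\<lambda>_. 0) i) - G r s (\<lambda>_. 0))
      + (\<Sum>l\<in>acc Kb s i. Gp r s (add_cust (s l) i) - G r s (s l)))"
      using X[of i] Lyap_up[OF v r, of _ i] first_empty(2)[OF v]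
      by (simp add: w0_def sum_divide_distrib[symmetric] add_divide_distrib distrib_left mult_ac)
    also have "\<dots> = ?b" unfolding arrival_sum[OF v, of "\<lambda>k. Gp r s (add_cust k i) - G r s k" i]
      by (simp add: sum_distrib_left mult_ac)
    finally show ?thesis .
  qed
  have "(\<Sum>l\<in>occ s. \<Sum>i\<in>UNIV. mu i * real (s l i) * (Lyap r (down s l i) - Lyap r s))
     = (\<Sum>l\<in>occ s. \<Sum>i\<in>UNIV. mu i * (real (s l i) * (Gp r s (rem_cust (s l) i) - G r s (s l))))"
  proof (intro sum.cong refl)
    fix l i assume "l \<in> occ s"
    then show "mu i * real (s l i) * (Lyap r (down s l i) - Lyap r s)
      = mu i * (real (s l i) * (Gp r s (rem_cust (s l) i) - G r s (s l)))"
      using Lyap_down[OF v r, of l i] by (cases "s l i = 0") auto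
  qed
  also have "\<dots> = (\<Sum>i\<in>UNIV. mu i * (\<Sum>l\<in>occ s. real (s l i) * (Gp r s (rem_cust (s l) i) - G r s (s l))))"
    by (subst sum.swap) (simp add: sum_distrib_left)
  also have "\<dots> = (\<Sum>i\<in>UNIV. \<Sum>k\<in>edges i.
     mu i * (real (k i) + 1) * real (Xc s (add_cust k i)) * (Gp r s k - G r s (add_cust k i)))"
    unfolding departure_sum[OF v, of _ "\<lambda>k. Gp r s (rem_cust k _) - G r s k"]
    by (simp add: sum_distrib_left mult_ac)
  finally show ?thesis unfolding drift_def 1 by (simp add: sum.distrib)
qed

section \<open>Uniform bounds on good states\<close>

text \<open>A crude bound; it strictly exceeds the size of every allowed configuration.\<close>

definition kmax :: nat where "kmax = 1 + (\<Sum>k\<in>Kb. nconf k)"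

lemma config_le_kmax: "k \<in> Kb \<Longrightarrow> k i + 1 \<le> kmax" and nconf_le_kmax: "k \<in> Kb \<Longrightarrow> nconf k < kmax"
proof -
  assume k: "k \<in> Kb"
  have "nconf k \<le> (\<Sum>k\<in>Kb. nconf k)" by (rule member_le_sum) (use k finite_Kb in auto)
  moreover have "k i \<le> nconf k" unfolding nconf_def by (rule member_le_sum) auto
  ultimately show "k i + 1 \<le> kmax" "nconf k < kmax" by (auto simp: kmax_def)
qed

definition large :: "real \<Rightarrow> bool" where
  "large r \<longleftrightarrow> 10 \<le> r \<and> (\<forall>i. r powr (5/8) \<le> rho i * r / 2 \<and> 6 * lam i \<le> r \<and> 5 / lam i \<le> r
      \<and> 3 * mu i * real kmax \<le> r \<and> 1 / mu i \<le> r \<and> 5 / rho i \<le> r \<and> 2 * rho i \<le> r)"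

lemma eventually_large: "\<forall>\<^sub>F r in at_top. large r"
proof -
  have "\<forall>\<^sub>F r in at_top. r powr (5/8) \<le> rho i * r / 2" for i
  proof -
    have "\<forall>\<^sub>F r in at_top. 2 / rho i \<le> r powr (3/8)"
      by (rule filterlim_at_top[THEN iffD1, rule_format]) real_asymp
    then show ?thesis using eventually_gt_at_top[of 0]
    proof eventually_elim
      case (elim r)
      have "r powr (5/8) * (2 / rho i) \<le> r powr (5/8) * r powr (3/8)" using elim by (intro mult_left_mono) auto
      also have "\<dots> = r" using elim by (simp add: powr_add[symmetric])
      finally show ?case using rho_pos[of i] mu_pos[of i] lam_pos[of i] by (simp add: field_simps)
    qed
  qed
  then show ?thesis
    unfolding large_def by (intro eventually_conj eventually_ge_at_top eventually_all_finite)
qed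

lemma good_bounds:
  assumes v: "valid_state Kb s" and g: "good r s" and la: "large r"
  shows "real (Zc s i) \<le> 3 / 2 * rho i * r" "rho i * r / 2 \<le> real (Zc s i)"
    "real (Ztot s) \<le> 3 / 2 * r" "r / 2 \<le> real (Ztot s)" "\<bar>real (Ztot s) - r\<bar> \<le> real CARD('i) * r powr (5/8)"
    "Occ s \<le> Ztot s" "Xc s k \<le> Occ s"
    "r powr p / 2 \<le> real (X0 p s)" "real (X0 p s) \<le> real (Ztot s) + 1"
    "\<bar>real (X0 p s) - r powr p\<bar> \<le> 1 + real CARD('i) * r powr (5/8)"
    "r powr p / 2 \<le> real (Xi Kb p s i)" "real (Xi Kb p s i) \<le> 5 * r"
proof -
  have r: "10 \<le> r" and l: "r powr (5/8) \<le> rho i * r / 2" for i using la by (auto simp: large_def)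
  have gi: "\<bar>real (Zc s i) - rho i * r\<bar> \<le> r powr (5/8)" for i using g by (auto simp: good_def)
  have aux: "z \<le> a + a / 2 \<and> a / 2 \<le> z" if "\<bar>z - a\<bar> \<le> b" "b \<le> a / 2" for z a b :: real
    using that by linarith
  show z1: "real (Zc s i) \<le> 3 / 2 * rho i * r" for i
  proof -
    have "real (Zc s i) \<le> rho i * r + rho i * r / 2" using aux[OF gi l] by blast
    also have "\<dots> = 3 / 2 * rho i * r" using mu_pos[of i] by (simp add: field_simps)
    finally show ?thesis .
  qed
  show z2: "rho i * r / 2 \<le> real (Zc s i)" for i using aux[OF gi l] by blast
  have "real (Ztot s) \<le> (\<Sum>i\<in>UNIV. rho i * (3 / 2 * r))"
    unfolding Ztot_Zc of_nat_sum by (intro sum_mono order_trans[OF z1]) auto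
  then show Z1: "real (Ztot s) \<le> 3 / 2 * r" unfolding sum_distrib_right[symmetric] load by simp
  have "real (Ztot s) \<ge> (\<Sum>i\<in>UNIV. rho i * (r / 2))"
    unfolding Ztot_Zc of_nat_sum by (intro sum_mono order_trans[OF _ z2]) auto
  then show Z2: "r / 2 \<le> real (Ztot s)" unfolding sum_distrib_right[symmetric] load by simp
  have "real (Ztot s) - r = (\<Sum>i\<in>UNIV. real (Zc s i) - rho i * r)"
    unfolding Ztot_Zc of_nat_sum sum_subtractf sum_distrib_right[symmetric] load by simp
  also have "\<bar>\<dots>\<bar> \<le> (\<Sum>i\<in>(UNIV::'i set). r powr (5/8))"
    by (intro order_trans[OF sum_abs] sum_mono gi)
  finally show Z3: "\<bar>real (Ztot s) - r\<bar> \<le> real CARD('i) * r powr (5/8)" by simp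
  show OZ: "Occ s \<le> Ztot s" by (rule Occ_le_Ztot[OF v])
  show XO: "Xc s k \<le> Occ s" for k
    unfolding Xc_def Occ_def by (intro card_mono finite_occ[OF v]) auto
  have Zp: "1 \<le> real (Ztot s)" using Z2 r by linarith
  have X0: "real (Ztot s) powr p \<le> real (X0 p s)" "real (X0 p s) \<le> real (Ztot s) powr p + 1"
    unfolding X0_def by (auto simp: of_nat_nat intro: real_nat_ceiling_ge)
  have "r powr p / 2 \<le> (r / 2) powr p"
  proof -
    have "(1/2::real) powr 1 \<le> (1/2) powr p" using p_up by (intro powr_mono') auto
    then have "r powr p * (1/2) \<le> r powr p * (1/2) powr p" by (intro mult_left_mono) auto
    then show ?thesis using r by (simp add: powr_mult[symmetric])
  qed
  also have "\<dots> \<le> real (Ztot s) powr p" using Z2 r p_low by (intro powr_mono2) auto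
  finally show XL: "r powr p / 2 \<le> real (X0 p s)" using X0 by linarith
  have "real (Ztot s) powr p \<le> real (Ztot s)" using powr_mono[of p 1 "real (Ztot s)"] Zp p_up by simp
  then show XU: "real (X0 p s) \<le> real (Ztot s) + 1" using X0 by linarith
  have "\<bar>real (Ztot s) powr p - r powr p\<bar> \<le> \<bar>real (Ztot s) - r\<bar>"
    using Zp r p_low p_up by (intro powr_diff_le) auto
  then show "\<bar>real (X0 p s) - r powr p\<bar> \<le> 1 + real CARD('i) * r powr (5/8)"
    using Z3 X0 by linarith
  show "r powr p / 2 \<le> real (Xi Kb p s i)" using XL by (simp add: Xi_def)
  have "card (acc Kb s i) \<le> Occ s" unfolding Occ_def acc_def by (intro card_mono finite_occ[OF v]) auto
  then show "real (Xi Kb p s i) \<le> 5 * r" using OZ XU Z1 r by (simp add: Xi_def)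
qed

text \<open>The last bound collects two errors: the shift \<open>sqrt r\<close> of the counts, and
  the fluctuation of \<open>X0\<close> around \<open>r powr p\<close>, which is of order
  \<open>r powr (5/8)\<close>.\<close>

lemma Y_bounds:
  assumes v: "valid_state Kb s" and g: "good r s" and la: "large r"
  shows "sqrt r \<le> Yc r s k" "Yc r s k \<le> 3 * r" "0 < Yc r s k"
    "\<bar>Yc r s k - Xh s k\<bar> \<le> (2 + real CARD('i)) * r powr (5/8)"
proof -
  note b = good_bounds[OF v g la]
  have r: "10 \<le> r" using la by (auto simp: large_def)
  have s: "sqrt r = r powr (1/2)" using r by (simp add: powr_half_sqrt)
  have sr: "sqrt r \<le> r" using powr_mono[of "1/2" 1 r] r unfolding s by simp
  have "sqrt r \<le> r powr p" unfolding s using p_low r by (intro powr_mono) auto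
  then show 1: "sqrt r \<le> Yc r s k" by (simp add: Yc_def)
  then show "0 < Yc r s k" using r by (intro less_le_trans[OF _ 1]) auto
  have "r powr p \<le> r" using powr_mono[of p 1 r] r p_up by simp
  moreover have "real (Xc s k) \<le> 3 / 2 * r" using b(6) b(7)[of k] b(3) by linarith
  ultimately show "Yc r s k \<le> 3 * r" using sr r by (auto simp: Yc_def)
  have "sqrt r \<le> r powr (5/8)" unfolding s using r by (intro powr_mono) auto
  moreover have "1 \<le> r powr (5/8)" using r by (intro ge_one_powr_ge_zero) auto
  moreover have "0 \<le> real CARD('i) * r powr (5/8)" by simp
  moreover have "\<bar>r powr p - real (X0 p s)\<bar> \<le> 1 + real CARD('i) * r powr (5/8)" using b(10) by linarith
  moreover have "0 \<le> sqrt r" using r by simp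
  ultimately show "\<bar>Yc r s k - Xh s k\<bar> \<le> (2 + real CARD('i)) * r powr (5/8)"
    unfolding Yc_def Xh_def distrib_right by (auto; linarith)
qed

text \<open>Crude polynomial bounds are enough, because the logarithms only multiply error terms and
  thus cost a factor \<open>ln r\<close>.\<close>

lemma V_W_bounds:
  assumes v: "valid_state Kb s" and g: "good r s" and la: "large r" and k: "k \<in> edges i"
  shows "0 < V r s i k" "0 < W r s i k" "\<bar>ln (V r s i k)\<bar> \<le> 3 * ln r" "\<bar>ln (W r s i k)\<bar> \<le> 3 * ln r"
    "\<bar>ln (lam i * r / (mu i * real (Xi Kb p s i)))\<bar> \<le> 3 * ln r" "0 < Xi Kb p s i"
proof -
  note b = good_bounds[OF v g la] and y = Y_bounds[OF v g la]
  have r: "10 \<le> r" using la by (auto simp: large_def)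
  have l: "6 * lam i \<le> r" "5 / lam i \<le> r" "3 * mu i * real kmax \<le> r" "1 / mu i \<le> r" "5 / rho i \<le> r" "2 * rho i \<le> r"
    using la by (auto simp: large_def)
  have lp: "0 < lam i" and mp: "0 < mu i" and rp: "0 < rho i" by (rule lam_pos mu_pos rho_pos)+
  have s1: "1 \<le> sqrt r" using r by simp
  have rp1: "1 \<le> r powr p" using r p_low by (intro ge_one_powr_ge_zero) auto
  have X: "0 < real (Xi Kb p s i)" using b(11)[of i] rp1 by linarith
  then show "0 < Xi Kb p s i" by simp
  have r3: "1 / r ^ 3 \<le> 1 / r" using r power_increasing[of 1 3 r] by (intro divide_left_mono) auto
  have r2: "r ^ 2 \<le> r ^ 3" "r \<le> r ^ 3" using r power_increasing[of 1 3 r] by (auto intro!: power_increasing)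
  have y1: "1 \<le> Yc r s k" for k using y(1)[of k] s1 by linarith
  show Vp: "0 < V r s i k" unfolding V_def using lp r y(3) X by (intro divide_pos_pos mult_pos_pos) auto
  have ki: "real (k i) + 1 \<le> real kmax" using config_le_kmax[of k i] k by (auto simp: edges_def)
  show Wp: "0 < W r s i k" unfolding W_def using mp y(3) by (intro mult_pos_pos) auto
  show "\<bar>ln (V r s i k)\<bar> \<le> 3 * ln r"
  proof (rule abs_ln_le)
    have "1 / r \<le> lam i / 5" using l(2) lp r by (simp add: field_simps)
    also have "\<dots> = lam i * r * 1 / (5 * r)" using r by simp
    also have "\<dots> \<le> V r s i k" unfolding V_def using lp r y1[of k] X b(12)[of i]
      by (intro frac_le mult_left_mono mult_nonneg_nonneg) auto
    finally show "1 / r ^ 3 \<le> V r s i k" using r3 by linarith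
    have "V r s i k \<le> lam i * r * (3 * r) / (1 / 2)"
      unfolding V_def using lp r y(2,3)[of k] X b(11)[of i] rp1
      by (intro frac_le mult_left_mono mult_nonneg_nonneg) auto
    also have "\<dots> = (6 * lam i) * r ^ 2" by (simp add: power2_eq_square)
    also have "\<dots> \<le> r * r ^ 2" using l by (intro mult_right_mono) auto
    finally show "V r s i k \<le> r ^ 3" by (simp add: power3_eq_cube power2_eq_square)
  qed (use r in simp)
  show "\<bar>ln (W r s i k)\<bar> \<le> 3 * ln r"
  proof (rule abs_ln_le)
    have "1 / r \<le> mu i * 1 * 1" using l(4) mp r by (simp add: field_simps)
    also have "\<dots> \<le> W r s i k" unfolding W_def using mp y1 by (intro mult_mono) auto
    finally show "1 / r ^ 3 \<le> W r s i k" using r3 by linarith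
    have "W r s i k \<le> mu i * real kmax * (3 * r)"
      unfolding W_def using mp ki y(2,3) r by (intro mult_mono) (auto simp: less_imp_le)
    also have "\<dots> = (3 * mu i * real kmax) * r" by simp
    also have "\<dots> \<le> r * r" using l r by (intro mult_right_mono) auto
    finally show "W r s i k \<le> r ^ 3" using r2 by (simp add: power2_eq_square)
  qed (use r in simp)
  show "\<bar>ln (lam i * r / (mu i * real (Xi Kb p s i)))\<bar> \<le> 3 * ln r"
  proof (rule abs_ln_le)
    have "1 / r \<le> rho i / 5" using l(5) rp r lp mp by (simp add: field_simps)
    also have "\<dots> = lam i * r / (mu i * (5 * r))" using r by simp
    also have "\<dots> \<le> lam i * r / (mu i * real (Xi Kb p s i))" using lp mp r X b(12)[of i]
      by (intro divide_left_mono mult_left_mono mult_pos_pos) auto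
    finally show "1 / r ^ 3 \<le> lam i * r / (mu i * real (Xi Kb p s i))" using r3 by linarith
    have "lam i * r / (mu i * real (Xi Kb p s i)) \<le> lam i * r / (mu i * (1 / 2))"
      using lp mp r X b(11)[of i] rp1
      by (intro divide_left_mono mult_left_mono mult_pos_pos) auto
    also have "\<dots> = (2 * rho i) * r" by simp
    also have "\<dots> \<le> r * r" using l r by (intro mult_right_mono) auto
    finally show "lam i * r / (mu i * real (Xi Kb p s i)) \<le> r ^ 3" using r2 by (simp add: power2_eq_square)
  qed (use r in simp)
qed

text \<open>The identity \<open>cf_add\<close> supplies exactly the factor
  \<open>real (k i) + 1\<close> of the departure rate. So the increment of \<open>G\<close> is the
  log ratio of the two flows plus a term depending on the type only.\<close>

lemma G_step:
  assumes v: "valid_state Kb s" and g: "good r s" and la: "large r" and k: "k \<in> edges i"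
  shows "G r s (add_cust k i) - G r s k = ln (W r s i k) - ln (V r s i k) + ln (lam i * r / (mu i * real (Xi Kb p s i)))"
proof -
  note y = Y_bounds(3)[OF v g la] and X = V_W_bounds(6)[OF v g la k]
  have r: "0 < r" using la by (auto simp: large_def)
  show ?thesis
    unfolding G_def V_def W_def cf_add
    using y[of k] y[of "add_cust k i"] X r lam_pos[of i] mu_pos[of i] cf_pos[of k]
    by (simp add: ln_mult ln_div)
qed

text \<open>The estimate \<open>ln (1 + 1 / a) \<le> 1 / a\<close> with
  \<open>a \<ge> sqrt r\<close>; this is what the shift by \<open>sqrt r\<close> provides.\<close>

lemma Gp_le:
  assumes v: "valid_state Kb s" and g: "good r s" and la: "large r"
  shows "Gp r s k \<le> G r s k + 1 / sqrt r" "G r s k \<le> Gp r s k"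
proof -
  have r: "0 < r" using la by (auto simp: large_def)
  have "Gp r s k \<le> G r s k + 1 / sqrt r \<and> G r s k \<le> Gp r s k"
  proof (cases "k = (\<lambda>_. 0)")
    case True
    then show ?thesis using r by (auto simp: Gp_def G_def Yc_def cf_zero)
  next
    case False
    define a where "a = real (Xc s k) + sqrt r"
    have a: "0 < a" "sqrt r \<le> a" using r by (auto simp: a_def intro: add_nonneg_pos)
    have eq: "Gp r s k - G r s k = ln (a + 1) - ln a"
      using False r a cf_pos[of k] by (simp add: Gp_def G_def Yc_def a_def[symmetric] ln_mult ln_div add_ac)
        (simp add: a_def ln_mult ln_div add_ac)
    have "ln (a + 1) - ln a = ln ((a + 1) / a)" using a by (simp add: ln_div)
    moreover have "ln ((a + 1) / a) \<le> 1 / a" using ln_add_one_self_le_self[of "1 / a"] a by (simp add: add_divide_distrib)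
    moreover have "1 / a \<le> 1 / sqrt r" using a r by (intro divide_left_mono) auto
    moreover have "ln a \<le> ln (a + 1)" using a by simp
    ultimately show ?thesis using eq by linarith
  qed
  then show "Gp r s k \<le> G r s k + 1 / sqrt r" "G r s k \<le> Gp r s k" by auto
qed

end

text \<open>If the flows differed by more than a factor 2, the log gap would exceed
  \<open>ln 2\<close> and the difference would exceed \<open>v / 2\<close>, contradicting the bound
  on their product.\<close>

lemma half_log_gap:
  assumes v: "0 < v" and w: "0 < w" and d: "(v - w) * (ln v - ln w) \<le> v * (ln 2 / 2)"
  shows "v / 2 \<le> w" "w \<le> 2 * (v::real)"
proof -
  show "v / 2 \<le> w"
  proof (rule ccontr)
    assume "\<not> v / 2 \<le> w"
    then have a: "w < v / 2" by simp
    then have "ln w < ln (v / 2)" using w by (subst ln_less_cancel_iff) auto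
    then have "ln 2 < ln v - ln w" using v by (simp add: ln_div)
    moreover have "v / 2 < v - w" using a by simp
    ultimately have "v / 2 * ln 2 < (v - w) * (ln v - ln w)"
      using v by (intro mult_strict_mono) auto
    then show False using d by simp
  qed
  show "w \<le> 2 * v"
  proof (rule ccontr)
    assume "\<not> w \<le> 2 * v"
    then have a: "2 * v < w" by simp
    then have "ln (2 * v) < ln w" using v by (subst ln_less_cancel_iff) auto
    then have "ln 2 < ln w - ln v" using v by (simp add: ln_mult)
    moreover have "v < w - v" using a by simp
    ultimately have "v * ln 2 < (w - v) * (ln w - ln v)"
      using v by (intro mult_strict_mono) auto
    also have "\<dots> = (v - w) * (ln v - ln w)" by (simp add: algebra_simps)
    finally have "v * ln 2 < v * ln 2 / 2" using d by simp
    then show False using v by simp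
  qed
qed

text \<open>Here \<open>v\<close>, \<open>w\<close> are the true flows and \<open>v'\<close>,
  \<open>w'\<close> the shifted ones. Replacing the former by the latter costs at most
  \<open>2 * b\<close> against a log gap of at most \<open>2 * c\<close>; the \<open>a\<close> term
  is left for summation over edges.\<close>

lemma flow_terms_le:
  fixes v w v' w' :: real
  assumes gpk: "gp' \<le> g' + e" "gp \<le> g + e" and v: "0 \<le> v" and w: "0 \<le> w"
    and step: "g' - g = lw - lv + a"
    and dv: "\<bar>v' - v\<bar> \<le> b" and dw: "\<bar>w' - w\<bar> \<le> b" and lv: "\<bar>lv\<bar> \<le> c" and lw: "\<bar>lw\<bar> \<le> c"
  shows "v * (gp' - g) + w * (gp - g') \<le> - ((v' - w') * (lv - lw)) + 4 * b * c + (v - w) * a + (v + w) * e"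
proof -
  have "v * (gp' - g) \<le> v * (g' + e - g)" using gpk v by (intro mult_left_mono) auto
  moreover have "w * (gp - g') \<le> w * (g + e - g')" using gpk w by (intro mult_left_mono) auto
  moreover have "v * (g' + e - g) + w * (g + e - g') = (v - w) * (g' - g) + (v + w) * e"
    by (simp add: algebra_simps)
  moreover have "(v - w) * (g' - g) = - ((v' - w') * (lv - lw)) + ((v' - v) - (w' - w)) * (lv - lw) + (v - w) * a"
    unfolding step by (simp add: algebra_simps)
  moreover have "((v' - v) - (w' - w)) * (lv - lw) \<le> (2 * b) * (2 * c)"
  proof -
    have "\<bar>((v' - v) - (w' - w)) * (lv - lw)\<bar> \<le> (2 * b) * (2 * c)"
      unfolding abs_mult by (intro mult_mono) (use dv dw lv lw in linarith)+
    then show ?thesis by linarith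
  qed
  ultimately show ?thesis by linarith
qed

section \<open>Drift of the entropy\<close>

context grand_ff
begin

definition Cdrift :: real where
  "Cdrift = (\<Sum>i\<in>(UNIV::'i set). \<Sum>k\<in>edges i. 12 * ((2 * lam i + mu i * real kmax) * (2 + real CARD('i))))
     + (\<Sum>i\<in>(UNIV::'i set). 3 * mu i + 3 * lam i)"

text \<open>\<open>flow_terms_le\<close> is summed over all edges. The remaining terms multiply
  \<open>A i\<close>, which is constant along the edges of type \<open>i\<close>, so they collapse
  to the imbalance between total arrivals and departures of that type.\<close>

lemma drift_Lyap_le:
  assumes v: "valid_state Kb s" and g: "good r s" and la: "large r"
  shows "drift r (Lyap r) s \<le> - Diss r s + Cdrift * r powr (3/4) * ln r"
proof -
  note b = good_bounds[OF v g la] and y = Y_bounds[OF v g la] and vw = V_W_bounds[OF v g la]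
  have r: "10 \<le> r" using la by (auto simp: large_def)
  have ln1: "1 \<le> ln r"
  proof -
    have "exp 1 \<le> (10::real)" using exp_le by linarith
    then show ?thesis using r by (subst ln_ge_iff) auto
  qed
  have X: "0 < Xi Kb p s i" for i using vw(6)[OF zero_in_edges] .
  define A where "A i = ln (lam i * r / (mu i * real (Xi Kb p s i)))" for i
  define B where "B i = (2 * lam i + mu i * real kmax) * (2 + real CARD('i)) * r powr (3/4)" for i
  define vv where "vv i k = lam i * r * Xh s k / real (Xi Kb p s i)" for i k
  define ww where "ww i k = mu i * (real (k i) + 1) * real (Xc s (add_cust k i))" for i k
  have sv: "(\<Sum>k\<in>edges i. vv i k) = lam i * r" for i
    unfolding vv_def sum_divide_distrib[symmetric] sum_distrib_left[symmetric] Xi_sum[OF v, symmetric]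
    using X[of i] by simp
  have sw: "(\<Sum>k\<in>edges i. ww i k) = mu i * real (Zc s i)" for i
    unfolding ww_def Zc_sum[OF v] sum_distrib_left by (simp add: mult_ac)
  have edge: "vv i k * (Gp r s (add_cust k i) - G r s k) + ww i k * (Gp r s k - G r s (add_cust k i))
    \<le> - ((V r s i k - W r s i k) * (ln (V r s i k) - ln (W r s i k))) + 4 * B i * (3 * ln r)
      + (vv i k - ww i k) * A i + (vv i k + ww i k) * (1 / sqrt r)" if k: "k \<in> edges i" for i k
  proof (rule flow_terms_le)
    have lp: "0 < lam i" and mp: "0 < mu i" by (rule lam_pos mu_pos)+
    show "Gp r s (add_cust k i) \<le> G r s (add_cust k i) + 1 / sqrt r" "Gp r s k \<le> G r s k + 1 / sqrt r"
      by (rule Gp_le(1)[OF v g la])+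
    show "0 \<le> vv i k" "0 \<le> ww i k" unfolding vv_def ww_def using lp mp r by (auto simp: Xh_def)
    show "G r s (add_cust k i) - G r s k = ln (W r s i k) - ln (V r s i k) + A i"
      unfolding A_def by (rule G_step[OF v g la k])
    show "\<bar>ln (V r s i k)\<bar> \<le> 3 * ln r" "\<bar>ln (W r s i k)\<bar> \<le> 3 * ln r" using vw[OF k] by auto
    have B1: "2 * lam i * ((2 + real CARD('i)) * r powr (3/4)) \<le> B i"
      "mu i * real kmax * (1 * r powr (3/4)) \<le> B i"
    proof -
      have "B i = 2 * lam i * ((2 + real CARD('i)) * r powr (3/4)) + mu i * real kmax * ((2 + real CARD('i)) * r powr (3/4))"
        by (simp add: B_def algebra_simps)
      moreover have "0 \<le> 2 * lam i * ((2 + real CARD('i)) * r powr (3/4))" using lp by simp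
      moreover have "mu i * real kmax * (1 * r powr (3/4)) \<le> mu i * real kmax * ((2 + real CARD('i)) * r powr (3/4))"
        using mp by (intro mult_left_mono mult_right_mono) auto
      moreover have "0 \<le> mu i * real kmax * (1 * r powr (3/4))" using mp by simp
      ultimately show "2 * lam i * ((2 + real CARD('i)) * r powr (3/4)) \<le> B i"
        "mu i * real kmax * (1 * r powr (3/4)) \<le> B i" by linarith+
    qed
    show "\<bar>V r s i k - vv i k\<bar> \<le> B i"
    proof -
      have "V r s i k - vv i k = lam i * r / real (Xi Kb p s i) * (Yc r s k - Xh s k)"
        by (simp add: V_def vv_def diff_divide_distrib right_diff_distrib)
      then have "\<bar>V r s i k - vv i k\<bar> = lam i * r / real (Xi Kb p s i) * \<bar>Yc r s k - Xh s k\<bar>"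
        using lp r by (simp add: abs_mult)
      also have "\<dots> \<le> lam i * r / (r powr p / 2) * ((2 + real CARD('i)) * r powr (5/8))"
        using lp r X[of i] b(11)[of i] y(4)[of k]
        by (intro mult_mono divide_left_mono mult_pos_pos) auto
      also have "\<dots> = 2 * lam i * ((2 + real CARD('i)) * (r / r powr p * r powr (5/8)))" by simp
      also have "r / r powr p * r powr (5/8) = r powr (1 - p + 5/8)" 
        proof -
          have "r / r powr p * r powr (5/8) = r powr 1 / r powr p * r powr (5/8)" using r by simp
          then show ?thesis by (simp only: powr_add powr_diff)
        qed
      \<comment> \<open>This comparison of exponents is where \<open>7 / 8 < p\<close> is
        used.\<close>
      also have "2 * lam i * ((2 + real CARD('i)) * r powr (1 - p + 5/8)) \<le> 2 * lam i * ((2 + real CARD('i)) * r powr (3/4))"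
        using lp r p_low by (intro mult_left_mono powr_mono) auto
      finally show ?thesis using B1 by linarith
    qed
    show "\<bar>W r s i k - ww i k\<bar> \<le> B i"
    proof -
      have "W r s i k - ww i k = mu i * (real (k i) + 1) * sqrt r"
        by (simp add: W_def ww_def Yc_def algebra_simps)
      then have "\<bar>W r s i k - ww i k\<bar> = mu i * (real (k i) + 1) * sqrt r" using mp r by (simp add: abs_mult)
      also have "\<dots> \<le> mu i * real kmax * (1 * r powr (3/4))"
      proof -
        have "sqrt r \<le> r powr (3/4)" using r unfolding powr_half_sqrt[symmetric, of r, OF order_trans[OF _ r]]
          by (subst powr_half_sqrt[symmetric]) (auto intro!: powr_mono)
        moreover have "real (k i) + 1 \<le> real kmax" using config_le_kmax[of k i] k by (auto simp: edges_def)
        ultimately show ?thesis using mp r by (intro mult_mono) auto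
      qed
      finally show ?thesis using B1 by linarith
    qed
  qed
  \<comment> \<open>On good states the total imbalance is at most
    \<open>mu i * r powr (5/8)\<close>; the second summand, coming from the gap between
    \<open>Gp\<close> and \<open>G\<close>, is of order \<open>sqrt r\<close>.\<close>
  have tail: "(lam i * r - mu i * real (Zc s i)) * A i + (lam i * r + mu i * real (Zc s i)) * (1 / sqrt r)
     \<le> (3 * mu i + 3 * lam i) * (r powr (3/4) * ln r)" for i
  proof -
    have lp: "0 < lam i" and mp: "0 < mu i" by (rule lam_pos mu_pos)+
    have A: "\<bar>A i\<bar> \<le> 3 * ln r" unfolding A_def by (rule vw(5)[OF zero_in_edges])
    have "lam i * r - mu i * real (Zc s i) = - (mu i * (real (Zc s i) - rho i * r))"
      using mp by (simp add: right_diff_distrib)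
    then have "\<bar>lam i * r - mu i * real (Zc s i)\<bar> = mu i * \<bar>real (Zc s i) - rho i * r\<bar>"
      using mp by (simp add: abs_mult)
    also have "\<dots> \<le> mu i * r powr (3/4)"
    proof -
      have "\<bar>real (Zc s i) - rho i * r\<bar> \<le> r powr (5/8)" using g by (auto simp: good_def)
      also have "\<dots> \<le> r powr (3/4)" using r by (intro powr_mono) auto
      finally show ?thesis using mp by (intro mult_left_mono) auto
    qed
    finally have "\<bar>lam i * r - mu i * real (Zc s i)\<bar> * \<bar>A i\<bar> \<le> (mu i * r powr (3/4)) * (3 * ln r)"
      using A mp by (intro mult_mono) auto
    then have 1: "(lam i * r - mu i * real (Zc s i)) * A i \<le> (3 * mu i) * (r powr (3/4) * ln r)"
      unfolding abs_mult[symmetric] by (simp add: mult_ac)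
    have "mu i * real (Zc s i) \<le> mu i * (3 / 2 * rho i * r)" using b(1)[of i] mp by (intro mult_left_mono) auto
    also have "\<dots> = 3 / 2 * (lam i * r)" using mp by simp
    finally have "lam i * r + mu i * real (Zc s i) \<le> 5 / 2 * (lam i * r)" by linarith
    also have "\<dots> \<le> 3 * (lam i * r)" using lp r by (intro mult_right_mono) auto
    finally have "lam i * r + mu i * real (Zc s i) \<le> 3 * lam i * r" by simp
    then have "(lam i * r + mu i * real (Zc s i)) * (1 / sqrt r) \<le> 3 * lam i * r * (1 / sqrt r)"
      using r by (intro mult_right_mono) auto
    also have "\<dots> = 3 * lam i * (r / sqrt r)" by simp
    also have "r / sqrt r = r powr (1/2)" using r by (simp add: real_div_sqrt powr_half_sqrt)
    also have "3 * lam i * r powr (1/2) \<le> 3 * lam i * (r powr (3/4) * ln r)"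
    proof -
      have "r powr (1/2) \<le> r powr (3/4)" using r by (intro powr_mono) auto
      also have "\<dots> \<le> r powr (3/4) * ln r" using ln1 mult_left_mono[OF ln1, of "r powr (3/4)"] by simp
      finally show ?thesis using lp by (intro mult_left_mono) auto
    qed
    finally show ?thesis using 1 by (simp add: distrib_right)
  qed
  have "drift r (Lyap r) s = (\<Sum>i\<in>UNIV. \<Sum>k\<in>edges i.
      vv i k * (Gp r s (add_cust k i) - G r s k) + ww i k * (Gp r s k - G r s (add_cust k i)))"
    unfolding vv_def ww_def using r by (intro drift_Lyap v X) auto
  also have "\<dots> \<le> (\<Sum>i\<in>UNIV. \<Sum>k\<in>edges i. - ((V r s i k - W r s i k) * (ln (V r s i k) - ln (W r s i k))) + 4 * B i * (3 * ln r)
      + (vv i k - ww i k) * A i + (vv i k + ww i k) * (1 / sqrt r))"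
    by (intro sum_mono edge)
  also have "\<dots> = - Diss r s + (\<Sum>i\<in>UNIV. \<Sum>k\<in>edges i. 4 * B i * (3 * ln r))
      + (\<Sum>i\<in>UNIV. (lam i * r - mu i * real (Zc s i)) * A i + (lam i * r + mu i * real (Zc s i)) * (1 / sqrt r))"
    unfolding sum.distrib sum_negf Diss_def sum_distrib_right[symmetric] sum_subtractf sv sw by simp
  also have "\<dots> \<le> - Diss r s + (\<Sum>i\<in>UNIV. \<Sum>k\<in>edges i. 4 * B i * (3 * ln r))
      + (\<Sum>i\<in>UNIV. (3 * mu i + 3 * lam i) * (r powr (3/4) * ln r))"
    by (intro add_left_mono sum_mono tail)
  also have "(\<Sum>i\<in>UNIV. \<Sum>k\<in>edges i. 4 * B i * (3 * ln r)) =
     (\<Sum>i\<in>(UNIV::'i set). \<Sum>k\<in>edges i. 12 * ((2 * lam i + mu i * real kmax) * (2 + real CARD('i)))) * (r powr (3/4) * ln r)"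
    unfolding sum_distrib_right B_def by (simp add: mult_ac)
  also have "(\<Sum>i\<in>UNIV. (3 * mu i + 3 * lam i) * (r powr (3/4) * ln r)) = (\<Sum>i\<in>UNIV. 3 * mu i + 3 * lam i) * (r powr (3/4) * ln r)"
    by (rule sum_distrib_right[symmetric])
  finally show ?thesis unfolding Cdrift_def mult.assoc distrib_right add.assoc .
qed

text \<open>A jump changes \<open>Lyap\<close> by some \<open>Gp\<close> minus some
  \<open>G\<close>. Each \<open>G\<close> is at most \<open>3 * ln r\<close> in absolute value, and
  the gap between \<open>Gp\<close> and \<open>G\<close> is covered by one more
  \<open>ln r\<close>.\<close>

lemma jump_bound:
  assumes v: "valid_state Kb s" and g: "good r s" and la: "large r" and s': "s' \<in> succ s"
    and cfr: "\<And>k. k \<in> Kb \<Longrightarrow> 6 * cf k \<le> r"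
  shows "\<bar>Lyap r s' - Lyap r s\<bar> \<le> 7 * ln r"
proof -
  have r: "10 \<le> r" using la by (auto simp: large_def)
  note y = Y_bounds[OF v g la]
  have ln1: "1 \<le> ln r"
  proof -
    have "exp 1 \<le> (10::real)" using exp_le by linarith
    then show ?thesis using r by (subst ln_ge_iff) auto
  qed
  have G: "\<bar>G r s k\<bar> \<le> 3 * ln r" if k: "k \<in> Kb" for k
    unfolding G_def
  proof (rule abs_ln_le)
    have rp: "1 \<le> r powr p" "r powr p \<le> r" using r p_low p_up powr_mono[of p 1 r] by (auto intro: ge_one_powr_ge_zero)
    have "1 / r \<le> 1 * 1 / r powr p" using rp r by (simp add: frac_le)
    also have "1 * 1 \<le> Yc r s k * cf k" using y(1,3)[of k] cf_ge_1[of k] r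
      by (intro mult_mono) (auto intro: order_trans[of 1 "sqrt r"] less_imp_le)
    then have "1 * 1 / r powr p \<le> Yc r s k * cf k / r powr p" using r by (intro divide_right_mono) auto
    finally have "1 / r \<le> Yc r s k * cf k / r powr p" .
    moreover have "1 / r ^ 3 \<le> 1 / r" using r power_increasing[of 1 3 r] by (intro divide_left_mono) auto
    ultimately show "1 / r ^ 3 \<le> Yc r s k * cf k / r powr p" by linarith
    have "Yc r s k * cf k / r powr p \<le> (3 * r) * (r / 3) / 1"
      using y(2,3)[of k] cfr[OF k] cf_pos[of k] rp r by (intro frac_le mult_mono) auto
    also have "\<dots> \<le> r ^ 3" using r power_increasing[of 2 3 r] by (simp add: power2_eq_square)
    finally show "Yc r s k * cf k / r powr p \<le> r ^ 3" .
  qed (use r in simp)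
  have e: "1 / sqrt r \<le> ln r" using ln1 r by (intro order_trans[OF _ ln1]) auto
  have main: "\<bar>Gp r s k' - G r s k\<bar> \<le> 7 * ln r" if "k \<in> Kb" "k' \<in> Kb" for k k'
    using G[OF that(1)] G[OF that(2)] Gp_le[OF v g la, of k'] e by linarith
  have Kbs: "s l \<in> Kb" for l using v by (auto simp: valid_state_def)
  from s' consider i l where "l \<in> acc Kb s i \<or> l = fe s" "s' = up s l i" | i l where "l \<in> occ s" "0 < s l i" "s' = down s l i"
    unfolding succ_def by auto
  then show ?thesis
  proof cases
    case 1
    have "add_cust (s l) i \<in> Kb" using 1(1) first_empty(2)[OF v] unitv_Kb by (auto simp: acc_def)
    then show ?thesis using main[OF Kbs] Lyap_up[OF v _ 1(1)] r unfolding 1(2) by simp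
  next
    case 2
    have "rem_cust (s l) i \<in> Kb" by (rule Kb_mono[OF Kbs[of l]]) (auto simp: rem_cust_def)
    then show ?thesis using main[OF Kbs] Lyap_down[OF v _ 2(1,2)] r unfolding 2(3) by simp
  qed
qed

end

section \<open>Nearly balanced states\<close>

context grand_ff
begin

section \<open>The linear program\<close>

definition feasible :: "('i config \<Rightarrow> real) \<Rightarrow> bool" where
  "feasible x \<longleftrightarrow> (\<forall>k\<in>Kz. 0 \<le> x k) \<and> (\<forall>i. (\<Sum>k\<in>Kz. real (k i) * x k) = rho i)"

abbreviation "qs \<equiv> q_star Kb lam mu"

lemma q_star_eq: "qs = Inf {(\<Sum>k\<in>Kz. x k) | x. feasible x}"
  by (simp add: q_star_def feasible_def Kz_def)

lemma unitv_Kz: "unitv i \<in> Kz"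
  using unitv_Kb by (auto simp: Kz_def unitv_def fun_eq_iff)

lemma sum_Kz_unitv:
  "(\<Sum>k\<in>Kz. F k * (\<Sum>i\<in>UNIV. if k = unitv i then c i else 0)) = (\<Sum>i\<in>UNIV. F (unitv i) * (c i :: real))"
proof -
  have "(\<Sum>k\<in>Kz. F k * (\<Sum>i\<in>UNIV. if k = unitv i then c i else 0))
     = (\<Sum>k\<in>Kz. \<Sum>i\<in>UNIV. if k = unitv i then F k * c i else 0)"
    unfolding sum_distrib_left by (intro sum.cong refl) auto
  also have "\<dots> = (\<Sum>i\<in>UNIV. \<Sum>k\<in>Kz. if k = unitv i then F k * c i else 0)"
    by (rule sum.swap)
  also have "\<dots> = (\<Sum>i\<in>UNIV. F (unitv i) * c i)"
    using unitv_Kz by simp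
  finally show ?thesis .
qed

lemma sum_unitv: "(\<Sum>i\<in>(UNIV::'i set). real (unitv i j) * c i) = c j"
proof -
  have "(\<Sum>i\<in>(UNIV::'i set). real (unitv i j) * c i) = (\<Sum>i\<in>UNIV. if i = j then c i else 0)"
    by (intro sum.cong) (auto simp: unitv_def)
  then show ?thesis by simp
qed

text \<open>The packing in which every customer has its own server; it makes the infimum range over
  a nonempty set.\<close>

lemma feasible_exists: "feasible (\<lambda>k. \<Sum>i\<in>UNIV. if k = unitv i then rho i else 0)"
  unfolding feasible_def sum_Kz_unitv sum_unitv
  using rho_pos by (auto intro!: sum_nonneg simp: less_imp_le)

lemma q_star_le: "feasible x \<Longrightarrow> qs \<le> (\<Sum>k\<in>Kz. x k)"
  unfolding q_star_eq by (intro cInf_lower bdd_belowI[of _ 0]) (auto simp: feasible_def intro!: sum_nonneg)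

lemma q_star_greatest: "(\<And>x. feasible x \<Longrightarrow> c \<le> (\<Sum>k\<in>Kz. x k)) \<Longrightarrow> c \<le> qs"
  unfolding q_star_eq by (intro cInf_greatest) (use feasible_exists in auto)

lemma q_star_nonneg: "0 \<le> qs"
  by (rule q_star_greatest) (auto simp: feasible_def intro!: sum_nonneg)

section \<open>Small dissipation forces an almost optimal packing\<close>

definition gam :: real where "gam = 1 / (1 + (\<Sum>i\<in>UNIV. 10 * mu i * real kmax / lam i))"
definition lmin :: real where "lmin = Min (range lam)"
text \<open>Dissipation threshold relative to \<open>r powr p\<close>: below it,
  \<open>half_log_gap\<close> applies on every edge, since shifted counts shrink at most by the
  factor \<open>gam\<close> per added customer.\<close>

definition c0 :: real where "c0 = lmin / 5 * gam ^ kmax * (ln 2 / 2)"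
text \<open>Each added customer costs \<open>ln 2\<close> for the factor-two balance and at most
  \<open>ln (real kmax)\<close> for the factor \<open>real (k i) + 1\<close>.\<close>

definition C3 :: real where "C3 = real kmax * (ln 2 + ln (real kmax))"

lemma kmax_ge_1: "1 \<le> kmax"
  by (simp add: kmax_def)

text \<open>In the last bound, 10 is 5 times 2: \<open>Xi\<close> is at most \<open>5 * r\<close>,
  and balanced flows may still differ by a factor 2.\<close>

lemma gam: "0 < gam" "gam \<le> 1" "gam \<le> lam i / (10 * mu i * real kmax)"
proof -
  have nn: "0 \<le> 10 * mu i * real kmax / lam i" for i using lam_pos[of i] mu_pos[of i] by simp
  have s: "0 \<le> (\<Sum>i\<in>UNIV. 10 * mu i * real kmax / lam i)" using nn by (rule sum_nonneg)
  then show "0 < gam" "gam \<le> 1" by (auto simp: gam_def field_simps)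
  have "10 * mu i * real kmax / lam i \<le> (\<Sum>i\<in>UNIV. 10 * mu i * real kmax / lam i)"
    by (rule member_le_sum) (use nn in auto)
  then have "gam \<le> 1 / (10 * mu i * real kmax / lam i)"
    unfolding gam_def using lam_pos[of i] mu_pos[of i] kmax_ge_1 s
    by (intro divide_left_mono mult_pos_pos divide_pos_pos) auto
  then show "gam \<le> lam i / (10 * mu i * real kmax)" by simp
qed

lemma lmin: "0 < lmin" "lmin \<le> lam i"
proof -
  have "lmin \<in> range lam" unfolding lmin_def by (rule Min_in) auto
  then show "0 < lmin" using lam_pos by auto
  show "lmin \<le> lam i" unfolding lmin_def by (rule Min_le) auto
qed

lemma c0_pos: "0 < c0"
  using gam lmin by (simp add: c0_def)

lemma C3_nonneg: "0 \<le> C3"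
  using kmax_ge_1 by (simp add: C3_def)

text \<open>The unnormalised dual price of a type \<open>i\<close> customer: near balance, one more
  such customer multiplies the shifted count by about \<open>exp (alpha r s i)\<close>.\<close>

definition alpha :: "real \<Rightarrow> 'i state \<Rightarrow> 'i \<Rightarrow> real" where
  "alpha r s i = ln (lam i * r / (mu i * real (Xi Kb p s i)))"

lemma Diss_term_nonneg:
  assumes v: "valid_state Kb s" and g: "good r s" and la: "large r" and k: "k \<in> edges i"
  shows "0 \<le> (V r s i k - W r s i k) * (ln (V r s i k) - ln (W r s i k))"
  using V_W_bounds(1,2)[OF v g la k]
  by (cases "V r s i k \<le> W r s i k") (auto intro: mult_nonneg_nonneg mult_nonpos_nonpos)

lemma Diss_nonneg:
  assumes v: "valid_state Kb s" and g: "good r s" and la: "large r"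
  shows "0 \<le> Diss r s"
  unfolding Diss_def by (intro sum_nonneg Diss_term_nonneg[OF assms])

lemma Diss_term_le:
  assumes v: "valid_state Kb s" and g: "good r s" and la: "large r" and k: "k \<in> edges i"
  shows "(V r s i k - W r s i k) * (ln (V r s i k) - ln (W r s i k)) \<le> Diss r s"
proof -
  let ?t = "\<lambda>i k. (V r s i k - W r s i k) * (ln (V r s i k) - ln (W r s i k))"
  have nn: "0 \<le> ?t i k" if "k \<in> edges i" for i k using Diss_term_nonneg[OF v g la that] .
  have "?t i k \<le> (\<Sum>k\<in>edges i. ?t i k)" by (rule member_le_sum) (use k nn in auto)
  also have "\<dots> \<le> (\<Sum>i\<in>UNIV. \<Sum>k\<in>edges i. ?t i k)"
    by (rule member_le_sum) (use nn in \<open>auto intro!: sum_nonneg\<close>)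
  finally show ?thesis by (simp add: Diss_def)
qed

lemma nconf_add: "nconf (add_cust k i) = Suc (nconf k)"
  unfolding nconf_def add_cust_def by (subst (1 2) sum.remove[of UNIV i]) auto

text \<open>The lower bound on \<open>Yc\<close> is carried along because it is what propagates the balance of
  the edges from the empty configuration, where \<open>Yc = r powr p\<close>, to all other configurations.\<close>

lemma near_product_form:
  assumes v: "valid_state Kb s" and g: "good r s" and la: "large r"
    and D: "Diss r s \<le> c0 * r powr p" and k: "k \<in> Kb"
  shows "gam ^ nconf k * r powr p \<le> Yc r s k \<and>
    \<bar>ln (Yc r s k) - p * ln r - (\<Sum>i\<in>UNIV. real (k i) * alpha r s i)\<bar> \<le> real (nconf k) * (ln 2 + ln (real kmax))"
  using k
proof (induction "nconf k" arbitrary: k)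
  case 0
  then have "k = (\<lambda>_. 0)" by (auto simp: nconf_def fun_eq_iff)
  moreover have "0 < r" using la by (auto simp: large_def)
  ultimately show ?case by (simp add: Yc_def nconf_def ln_powr)
next
  case (Suc n)
  note y = Y_bounds[OF v g la]
  have r: "10 \<le> r" using la by (auto simp: large_def)
  have "\<exists>i. 0 < k i"
  proof (rule ccontr)
    assume "\<not> (\<exists>i. 0 < k i)"
    then have "nconf k = 0" by (simp add: nconf_def)
    then show False using Suc(2) by simp
  qed
  then obtain i where i: "0 < k i" ..
  \<comment> \<open>One customer is removed, so the induction follows a path of edges from the empty
    configuration to \<open>k\<close>.\<close>
  define k' where "k' = rem_cust k i"
  have kk: "k = add_cust k' i" using i by (simp add: k'_def)
  have k': "k' \<in> Kb" unfolding k'_def by (rule Kb_mono[OF Suc.prems]) (auto simp: rem_cust_def)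
  have e: "k' \<in> edges i" using k' Suc.prems kk by (auto simp: edges_def)
  have n: "nconf k' = n" using Suc(2) unfolding kk nconf_add by simp
  note IH = Suc(1)[OF n[symmetric] k']
  note vw = V_W_bounds[OF v g la e]
  have lp: "0 < lam i" and mp: "0 < mu i" by (rule lam_pos mu_pos)+
  have X: "0 < real (Xi Kb p s i)" using vw(6) by simp
  have Vlow: "lam i / 5 * Yc r s k' \<le> V r s i k'"
  proof -
    have "lam i / 5 * Yc r s k' = lam i * r * Yc r s k' / (5 * r)" using r by simp
    also have "\<dots> \<le> V r s i k'" unfolding V_def using lp r y(3) X good_bounds(12)[OF v g la, of i]
      by (intro divide_left_mono mult_nonneg_nonneg) (auto simp: less_imp_le)
    finally show ?thesis .
  qed
  \<comment> \<open>The lower bound on \<open>Yc r s k'\<close> from the induction hypothesis makes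
    the flow on this edge so large that the whole dissipation is a small fraction of it.\<close>
  have "(V r s i k' - W r s i k') * (ln (V r s i k') - ln (W r s i k')) \<le> V r s i k' * (ln 2 / 2)"
  proof -
    have "(V r s i k' - W r s i k') * (ln (V r s i k') - ln (W r s i k')) \<le> c0 * r powr p"
      using Diss_term_le[OF v g la e] D by linarith
    also have "\<dots> = lmin / 5 * (gam ^ kmax * r powr p) * (ln 2 / 2)" by (simp add: c0_def)
    also have "\<dots> \<le> lam i / 5 * (gam ^ nconf k' * r powr p) * (ln 2 / 2)"
      using lmin(1) lmin(2)[of i] gam(1,2) nconf_le_kmax[OF k']
      by (intro mult_right_mono mult_mono power_decreasing) auto
    also have "\<dots> \<le> lam i / 5 * Yc r s k' * (ln 2 / 2)"
      using IH lp by (intro mult_right_mono mult_left_mono) auto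
    also have "\<dots> \<le> V r s i k' * (ln 2 / 2)" using Vlow by (intro mult_right_mono) auto
    finally show ?thesis .
  qed
  note bal = half_log_gap[OF vw(1,2) this]
  have ki: "real (k' i) + 1 \<le> real kmax" using config_le_kmax[OF k', of i] by simp
  have "lam i / 10 * Yc r s k' \<le> W r s i k'" using bal(1) Vlow by simp
  also have "\<dots> \<le> mu i * real kmax * Yc r s k"
    unfolding W_def kk[symmetric] using ki mp y(3)[of k] by (intro mult_right_mono mult_left_mono) auto
  finally have "lam i / 10 * Yc r s k' / (mu i * real kmax) \<le> Yc r s k"
    using mp kmax_ge_1 by (subst pos_divide_le_eq) (auto simp: mult_ac)
  moreover have "gam * Yc r s k' \<le> lam i / (10 * mu i * real kmax) * Yc r s k'"
    using gam(3) y(3)[of k'] by (intro mult_right_mono) auto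
  moreover have "gam * (gam ^ nconf k' * r powr p) \<le> gam * Yc r s k'"
    using gam IH by (intro mult_left_mono) auto
  ultimately have 1: "gam ^ nconf k * r powr p \<le> Yc r s k"
    using Suc(2) n by (simp add: Suc(2)[symmetric] mult_ac)
  have "ln (W r s i k') \<le> ln (2 * V r s i k')" "ln (V r s i k' / 2) \<le> ln (W r s i k')"
    using bal vw(1,2) by (auto intro!: ln_mono)
  then have lnb: "\<bar>ln (W r s i k') - ln (V r s i k')\<bar> \<le> ln 2"
    using vw(1) by (simp add: ln_mult ln_div abs_le_iff)
  have "ln (W r s i k') = ln (mu i) + ln (real (k' i) + 1) + ln (Yc r s k)"
    unfolding W_def kk[symmetric] using mp y(3)[of k] by (simp add: ln_mult)
  moreover have "ln (V r s i k') = ln (lam i) + ln r + ln (Yc r s k') - ln (real (Xi Kb p s i))"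
    unfolding V_def using lp r y(3)[of k'] X by (simp add: ln_mult ln_div)
  moreover have "alpha r s i = ln (lam i) + ln r - (ln (mu i) + ln (real (Xi Kb p s i)))"
    unfolding alpha_def using lp mp r X by (simp add: ln_mult ln_div)
  moreover have "0 \<le> ln (real (k' i) + 1)" "ln (real (k' i) + 1) \<le> ln (real kmax)"
    using ki by (auto intro!: ln_mono)
  ultimately have step: "\<bar>ln (Yc r s k) - ln (Yc r s k') - alpha r s i\<bar> \<le> ln 2 + ln (real kmax)"
    using lnb by linarith
  have sums: "(\<Sum>j\<in>UNIV. real (k j) * alpha r s j) = (\<Sum>j\<in>UNIV. real (k' j) * alpha r s j) + alpha r s i"
    unfolding kk by (subst (1 2) sum.remove[of UNIV i]) (auto simp: add_cust_def algebra_simps)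
  have nk: "real (nconf k) = real (nconf k') + 1" using Suc(2) n by simp
  have "\<bar>ln (Yc r s k) - p * ln r - (\<Sum>j\<in>UNIV. real (k j) * alpha r s j)\<bar>
    \<le> real (nconf k') * (ln 2 + ln (real kmax)) + (ln 2 + ln (real kmax))"
    using IH step unfolding sums by linarith
  also have "\<dots> = real (nconf k) * (ln 2 + ln (real kmax))"
    unfolding nk by (simp only: distrib_right mult_1)
  finally show ?case using 1 by blast
qed

definition Cstat :: real where
  "Cstat = ((C3 + 2) * qs + real CARD('i) + real (card Kz) * (1 + 3 * C3)) / (1 - p)"

text \<open>Weak duality on the logarithmic scale. \<open>up\<close> is approximate dual feasibility
  of \<open>alpha\<close>, and \<open>slack\<close> is approximate complementary slackness; both
  errors become of order \<open>r / ln r\<close> after division by \<open>T\<close>.\<close>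

lemma occupied_le_of_Diss:
  assumes v: "valid_state Kb s" and g: "good r s" and la: "large r"
    and D: "Diss r s \<le> c0 * r powr p" and small: "r powr (5/8) * (3 * ln r) \<le> r"
  shows "real (Occ s) \<le> qs * r + Cstat * (r / ln r)"
proof -
  note y = Y_bounds[OF v g la] and b = good_bounds[OF v g la]
  have r: "10 \<le> r" using la by (auto simp: large_def)
  have lnr: "0 < ln r" using r by simp
  define \<beta> where "\<beta> k = (\<Sum>i\<in>UNIV. real (k i) * alpha r s i)" for k
  \<comment> \<open>The logarithm of the ratio of \<open>r\<close>, the largest order of a count, to
    the reference value \<open>r powr p\<close>. Division by it normalises the dual prices.\<close>
  define T where "T = (1 - p) * ln r"
  have T: "0 < T" using p_up lnr by (simp add: T_def)
  have near: "\<bar>ln (Yc r s k) - p * ln r - \<beta> k\<bar> \<le> C3" if k: "k \<in> Kb" for k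
  proof -
    have "\<bar>ln (Yc r s k) - p * ln r - \<beta> k\<bar> \<le> real (nconf k) * (ln 2 + ln (real kmax))"
      using near_product_form[OF v g la D k] by (simp add: \<beta>_def)
    also have "\<dots> \<le> C3" unfolding C3_def using nconf_le_kmax[OF k] kmax_ge_1
      by (intro mult_right_mono) auto
    finally show ?thesis .
  qed
  have KzKb: "k \<in> Kz \<Longrightarrow> k \<in> Kb" for k by (simp add: Kz_def)
  have up: "\<beta> k \<le> T + (C3 + 2)" if k: "k \<in> Kz" for k
  proof -
    have "ln (Yc r s k) \<le> ln (3 * r)" using y[of k] by (intro ln_mono) auto
    also have "\<dots> = ln 3 + ln r" using r by (simp add: ln_mult)
    also have "ln 3 \<le> (2::real)" using ln_le_minus_one[of "3::real"] by simp
    finally show ?thesis using near[OF KzKb[OF k]] by (simp add: T_def algebra_simps)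
  qed
  \<comment> \<open>Configurations with \<open>\<beta> k\<close> far below \<open>T\<close> have few
    servers: the product is controlled by \<open>x * ln (r / x) \<le> r\<close>.\<close>
  have slack: "real (Xc s k) * (T - \<beta> k) \<le> (1 + 3 * C3) * r" if k: "k \<in> Kz" for k
  proof -
    have Y: "0 < Yc r s k" by (rule y(3))
    have XY: "real (Xc s k) \<le> Yc r s k" using k r by (auto simp: Yc_def Kz_def)
    have "T - \<beta> k \<le> ln (r / Yc r s k) + C3"
      using near[OF KzKb[OF k]] Y r by (simp add: T_def ln_div algebra_simps)
    then have "real (Xc s k) * (T - \<beta> k) \<le> real (Xc s k) * (ln (r / Yc r s k) + C3)"
      by (intro mult_left_mono) auto
    also have "\<dots> = real (Xc s k) * ln (r / Yc r s k) + real (Xc s k) * C3" by (simp add: distrib_left)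
    also have "real (Xc s k) * ln (r / Yc r s k) \<le> r"
    proof (cases "0 \<le> ln (r / Yc r s k)")
      case True
      have "real (Xc s k) * ln (r / Yc r s k) \<le> Yc r s k * (r / Yc r s k)"
        using XY Y r True ln_bound[of "r / Yc r s k"] by (intro mult_mono) auto
      then show ?thesis using Y by simp
    next
      case False
      then show ?thesis using r by (intro order_trans[OF mult_nonneg_nonpos]) auto
    qed
    also have "real (Xc s k) * C3 \<le> (3 * r) * C3"
      using XY y(2)[of k] C3_nonneg by (intro mult_right_mono) auto
    finally show ?thesis by (simp add: algebra_simps)
  qed
  have Q: "real (Occ s) = (\<Sum>k\<in>Kz. real (Xc s k))"
    using occ_sum[OF v, of "\<lambda>_. 1"] by (simp add: Occ_def)
  have Z: "real (Zc s i) = (\<Sum>k\<in>Kz. real (Xc s k) * real (k i))" for i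
    using occ_sum[OF v, of "\<lambda>k. real (k i)"] by (simp add: Zc_def)
  have swap: "(\<Sum>k\<in>Kz. f k * \<beta> k) = (\<Sum>i\<in>UNIV. (\<Sum>k\<in>Kz. f k * real (k i)) * alpha r s i)" for f
    unfolding \<beta>_def sum_distrib_left sum_distrib_right by (subst sum.swap) (simp add: mult_ac)
  have "real (Occ s) * T = (\<Sum>k\<in>Kz. real (Xc s k) * \<beta> k) + (\<Sum>k\<in>Kz. real (Xc s k) * (T - \<beta> k))"
    unfolding Q sum_distrib_right sum.distrib[symmetric] by (simp add: algebra_simps)
  also have "(\<Sum>k\<in>Kz. real (Xc s k) * (T - \<beta> k)) \<le> (\<Sum>k\<in>Kz. (1 + 3 * C3) * r)"
    by (intro sum_mono slack)
  also have "(\<Sum>k\<in>Kz. real (Xc s k) * \<beta> k) = (\<Sum>i\<in>UNIV. real (Zc s i) * alpha r s i)"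
    unfolding swap Z ..
  also have "\<dots> \<le> (\<Sum>i\<in>UNIV. rho i * alpha r s i * r + r)"
  proof (intro sum_mono)
    fix i
    have "\<bar>(real (Zc s i) - rho i * r) * alpha r s i\<bar> \<le> r powr (5/8) * (3 * ln r)"
      unfolding abs_mult alpha_def using g V_W_bounds(5)[OF v g la zero_in_edges[of i]]
      by (intro mult_mono) (auto simp: good_def)
    then have "(real (Zc s i) - rho i * r) * alpha r s i \<le> r" using small by linarith
    then show "real (Zc s i) * alpha r s i \<le> rho i * alpha r s i * r + r" by (simp add: algebra_simps)
  qed
  also have "\<dots> = (\<Sum>i\<in>UNIV. rho i * alpha r s i) * r + real CARD('i) * r"
    by (simp add: sum.distrib sum_distrib_right)
  \<comment> \<open>Enlarging \<open>T\<close> by \<open>C3 + 2\<close> makes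
    \<open>alpha / (T + (C3 + 2))\<close> exactly dual feasible.\<close>
  also have "(\<Sum>i\<in>UNIV. rho i * alpha r s i) \<le> qs * (T + (C3 + 2))"
  proof -
    have pos: "0 < T + (C3 + 2)" using T C3_nonneg by linarith
    have "(\<Sum>i\<in>UNIV. rho i * alpha r s i) / (T + (C3 + 2)) \<le> qs"
    proof (rule q_star_greatest)
      fix x assume x: "feasible x"
      have "(\<Sum>i\<in>UNIV. rho i * alpha r s i) = (\<Sum>i\<in>UNIV. (\<Sum>k\<in>Kz. x k * real (k i)) * alpha r s i)"
        using x by (simp add: feasible_def mult.commute)
      also have "\<dots> = (\<Sum>k\<in>Kz. x k * \<beta> k)" by (rule swap[symmetric])
      also have "\<dots> \<le> (\<Sum>k\<in>Kz. x k * (T + (C3 + 2)))"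
        using x up by (intro sum_mono mult_left_mono) (auto simp: feasible_def)
      finally show "(\<Sum>i\<in>UNIV. rho i * alpha r s i) / (T + (C3 + 2)) \<le> (\<Sum>k\<in>Kz. x k)"
        using pos by (subst pos_divide_le_eq) (auto simp: sum_distrib_right)
    qed
    then show ?thesis using pos by (simp add: pos_divide_le_eq)
  qed
  finally have "real (Occ s) * T \<le> qs * (T + (C3 + 2)) * r + real CARD('i) * r + real (card Kz) * ((1 + 3 * C3) * r)"
    using r by simp
  also have "\<dots> = (qs * r) * T + Cstat * (1 - p) * r"
  proof -
    have "Cstat * (1 - p) = (C3 + 2) * qs + real CARD('i) + real (card Kz) * (1 + 3 * C3)"
      using p_up by (simp add: Cstat_def)
    then show ?thesis by (simp only:) (simp add: algebra_simps)
  qed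
  finally have "real (Occ s) \<le> ((qs * r) * T + Cstat * (1 - p) * r) / T"
    using T by (simp add: pos_le_divide_eq)
  also have "\<dots> = qs * r + Cstat * (r / ln r)"
    using T p_up lnr unfolding T_def by (simp add: add_divide_distrib)
  finally show ?thesis .
qed

end

section \<open>Tail of the number of occupied servers\<close>

lemma eventually_const_mult_le:
  fixes f g :: "real \<Rightarrow> real"
  assumes "((\<lambda>r. f r / g r) \<longlongrightarrow> 0) at_top" "\<forall>\<^sub>F r in at_top. 0 < g r" "0 < c"
  shows "\<forall>\<^sub>F r in at_top. C * f r \<le> c * g r"
proof -
  have "((\<lambda>r. C * (f r / g r)) \<longlongrightarrow> C * 0) at_top" by (intro tendsto_mult tendsto_const assms(1))
  then have "\<forall>\<^sub>F r in at_top. C * (f r / g r) < c" by (rule order_tendstoD) (use assms(3) in simp)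
  with assms(2) show ?thesis
  proof eventually_elim
    case (elim r)
    then have "C * f r / g r \<le> c" by simp
    then show ?case using elim(1) by (simp add: pos_divide_le_eq)
  qed
qed

text \<open>A lower bound of Stirling type for the logarithm of the factorial of
  \<open>n\<close>.\<close>

lemma sum_ln_ge: "real n * ln (real n) - real n \<le> (\<Sum>j<n. ln (real j + 1))"
proof (induction n)
  case (Suc n)
  have "real n * (ln (real n + 1) - ln (real n)) \<le> 1"
  proof (cases "n = 0")
    case False
    then have "ln (real n + 1) - ln (real n) = ln ((real n + 1) / real n)"
      by (simp add: ln_div)
    also have "\<dots> \<le> 1 / real n"
      using ln_add_one_self_le_self[of "1 / real n"] False by (simp add: add_divide_distrib)
    finally have "real n * (ln (real n + 1) - ln (real n)) \<le> real n * (1 / real n)" by (intro mult_left_mono) auto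
    then show ?thesis using False by simp
  qed simp
  then show ?case using Suc by (simp add: algebra_simps)
qed simp

context grand_ff
begin

section \<open>Comparison of the entropy with the number of occupied servers\<close>

definition cmax :: real where "cmax = (\<Sum>k\<in>Kb. cf k)"
definition Cu :: real where "Cu = ln (3 * cmax)"

lemma cf_le_cmax: "k \<in> Kb \<Longrightarrow> cf k \<le> cmax"
  unfolding cmax_def by (rule member_le_sum) (use finite_Kb cf_pos in \<open>auto simp: less_imp_le\<close>)

lemma cmax_ge_1: "1 \<le> cmax"
  using cf_le_cmax[OF zero_Kb] by (simp add: cf_zero)

lemma Cu_nonneg: "0 \<le> Cu"
  using cmax_ge_1 by (simp add: Cu_def)

lemma Lyap_le:
  assumes v: "valid_state Kb s" and g: "good r s" and la: "large r"
  shows "Lyap r s \<le> real (Occ s) * ((1 - p) * ln r + Cu)"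
proof -
  have r: "10 \<le> r" using la by (auto simp: large_def)
  have Q: "real (Occ s) = (\<Sum>k\<in>Kz. real (Xc s k))"
    using occ_sum[OF v, of "\<lambda>_. 1"] by (simp add: Occ_def)
  have "Psi r k (Xc s k) \<le> real (Xc s k) * ((1 - p) * ln r + Cu)" if k: "k \<in> Kz" for k
  proof -
    have "Psi r k (Xc s k) \<le> (\<Sum>j<Xc s k. (1 - p) * ln r + Cu)"
      unfolding Psi_def
    proof (intro sum_mono)
      fix j assume "j \<in> {..<Xc s k}"
      then have j: "real j + 1 + sqrt r \<le> 3 * r" "0 < real j + 1 + sqrt r"
        using Y_bounds(2)[OF v g la, of k] k r by (auto simp: Yc_def Kz_def intro: add_pos_nonneg)
      have "(real j + 1 + sqrt r) * cf k \<le> 3 * r * cmax"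
        using j cf_le_cmax[of k] cf_pos[of k] k r by (intro mult_mono) (auto simp: Kz_def less_imp_le)
      then have "ln ((real j + 1 + sqrt r) * cf k / r powr p) \<le> ln ((3 * cmax) * r / r powr p)"
        using j cf_pos[of k] r by (intro ln_mono divide_right_mono divide_pos_pos mult_pos_pos) (auto simp: mult_ac)
      also have "\<dots> = Cu + ln r - p * ln r"
        unfolding Cu_def using cmax_ge_1 r by (simp add: ln_div ln_mult ln_powr)
      finally show "ln ((real j + 1 + sqrt r) * cf k / r powr p) \<le> (1 - p) * ln r + Cu"
        by (simp add: algebra_simps)
    qed
    then show ?thesis by simp
  qed
  then show ?thesis unfolding Lyap_def Q sum_distrib_right by (intro sum_mono) auto
qed

text \<open>The sum of logarithms is bounded by \<open>sum_ln_ge\<close>; replacing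
  \<open>ln n\<close> by \<open>ln r\<close> costs \<open>n * ln (r / n) \<le> r\<close> for each
  configuration. With \<open>Lyap_le\<close> this ties \<open>Lyap\<close> to
  \<open>(1 - p) * ln r * Occ\<close> up to order \<open>r\<close>.\<close>

lemma Lyap_ge:
  assumes v: "valid_state Kb s" and r: "10 \<le> r"
  shows "real (Occ s) * ((1 - p) * ln r - 1) - real (card Kz) * r \<le> Lyap r s"
proof -
  have Q: "real (Occ s) = (\<Sum>k\<in>Kz. real (Xc s k))"
    using occ_sum[OF v, of "\<lambda>_. 1"] by (simp add: Occ_def)
  have "real (Xc s k) * ((1 - p) * ln r - 1) - r \<le> Psi r k (Xc s k)" for k
  proof -
    let ?n = "Xc s k"
    have "(\<Sum>j<?n. ln (real j + 1) - p * ln r) \<le> Psi r k ?n"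
      unfolding Psi_def
    proof (intro sum_mono)
      fix j
      have "real j + 1 + 0 \<le> (real j + 1 + sqrt r) * 1" using r by simp
      also have "\<dots> \<le> (real j + 1 + sqrt r) * cf k" using cf_ge_1 r by (intro mult_left_mono) auto
      finally have "ln ((real j + 1) / r powr p) \<le> ln ((real j + 1 + sqrt r) * cf k / r powr p)"
        using r by (intro ln_mono divide_right_mono divide_pos_pos) auto
      then show "ln (real j + 1) - p * ln r \<le> ln ((real j + 1 + sqrt r) * cf k / r powr p)"
        using r by (simp add: ln_div ln_powr)
    qed
    then have 1: "real ?n * ln (real ?n) - real ?n - real ?n * (p * ln r) \<le> Psi r k ?n"
      using sum_ln_ge[of ?n] by (simp add: sum_subtractf)
    have "real ?n * (ln r - ln (real ?n)) \<le> r"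
    proof (cases "?n = 0")
      case False
      then have "real ?n * (ln r - ln (real ?n)) = real ?n * ln (r / real ?n)" using r by (simp add: ln_div)
      also have "\<dots> \<le> real ?n * (r / real ?n)" using False r by (intro mult_left_mono ln_bound) auto
      finally show ?thesis using False by simp
    qed (use r in simp)
    then show ?thesis using 1 by (simp add: algebra_simps)
  qed
  then have "(\<Sum>k\<in>Kz. real (Xc s k) * ((1 - p) * ln r - 1) - r) \<le> Lyap r s"
    unfolding Lyap_def by (intro sum_mono) auto
  then show ?thesis unfolding Q by (simp add: sum_subtractf sum_distrib_right)
qed

section \<open>The exponential test function\<close>

definition Cg :: real where "Cg = Lam + 2 * mumax"

lemma out_le_good:
  assumes v: "valid_state Kb s" and g: "good r s" and la: "large r"
  shows "out r s \<le> Cg * r"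
proof -
  have "out r s \<le> Lam * r + mumax * real (Ztot s)" by (rule out_le)
  also have "\<dots> \<le> Lam * r + mumax * (2 * r)"
    using good_bounds(3)[OF v g la] la mumax by (intro add_left_mono mult_left_mono) (auto simp: large_def)
  finally show ?thesis by (simp add: Cg_def algebra_simps)
qed

text \<open>The cap at \<open>r powr B\<close> makes the exponential integrable; it is not active on good states.\<close>

definition level :: "real \<Rightarrow> real \<Rightarrow> real \<Rightarrow> 'i state \<Rightarrow> real" where
  "level K B r s = exp (min (K / r * Lyap r s) (B * ln r))"

text \<open>All asymptotic comparisons used below are gathered here, so that the drift estimates can
  be made at a fixed \<open>r\<close>.\<close>

definition admissible :: "real \<Rightarrow> real \<Rightarrow> real \<Rightarrow> bool" where
  "admissible \<delta> K r \<longleftrightarrow> large r \<and> (\<forall>k\<in>Kb. 6 * cf k \<le> r) \<and> r powr (5/8) * (3 * ln r) \<le> r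
     \<and> Cstat < \<delta> / 2 * ln r \<and> Cdrift * (r powr (3/4) * ln r) \<le> c0 / 2 * r powr p
     \<and> Cdrift * (r powr (3/4) * ln r) \<le> r \<and> 2 * K * Cu \<le> ln r \<and> 7 * K * ln r \<le> r
     \<and> 49 * K * Cg * (ln r)\<^sup>2 \<le> c0 / 4 * r powr p \<and> 1 \<le> c0 / 4 * r powr p \<and> 49 * K * Cg * (ln r)\<^sup>2 \<le> r
     \<and> 1 \<le> (1 - p) * ln r \<and> real (card Kz) \<le> (qs + \<delta>) * ((1 - p) * ln r - 1)"

lemma eventually_admissible:
  assumes "0 < \<delta>" "0 < K"
  shows "\<forall>\<^sub>F r in at_top. admissible \<delta> K r"
proof -
  have ln_top: "filterlim (\<lambda>r::real. ln r) at_top at_top" by real_asymp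
  have ln_ge: "\<forall>\<^sub>F r in at_top. c < ln (r::real)" for c
    using ln_top by (simp add: filterlim_at_top_dense)
  have pp: "\<forall>\<^sub>F r in at_top. r powr (7/8) \<le> r powr p"
    using eventually_ge_at_top[of 1] by eventually_elim (use p_low in \<open>auto intro!: powr_mono\<close>)
  have via: "\<forall>\<^sub>F r in at_top. C * f r \<le> c * r powr p"
    if f: "((\<lambda>r. f r / r powr (7/8)) \<longlongrightarrow> 0) at_top" and c: "0 < c" for f :: "real \<Rightarrow> real" and C c
  proof -
    have "\<forall>\<^sub>F r in at_top. C * f r \<le> c * r powr (7/8)"
      by (rule eventually_const_mult_le[OF f _ c]) (use eventually_gt_at_top[of 0] in \<open>auto elim: eventually_mono\<close>)
    then show ?thesis using pp
    proof eventually_elim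
      case (elim r)
      then show ?case using mult_left_mono[OF elim(2), of c] c by linarith
    qed
  qed
  have via1: "\<forall>\<^sub>F r in at_top. C * f r \<le> r"
    if f: "((\<lambda>r. f r / r) \<longlongrightarrow> 0) at_top" for f :: "real \<Rightarrow> real" and C
    using eventually_const_mult_le[where f = f and g = "\<lambda>r. r" and c = 1 and C = C, OF f eventually_gt_at_top] by simp
  have c4: "0 < c0 / 4" "0 < c0 / 2" using c0_pos by auto
  have q: "0 < qs + \<delta>" using q_star_nonneg assms by linarith
  have "\<forall>\<^sub>F r in at_top. Cstat < \<delta> / 2 * ln r"
    using ln_ge[of "Cstat / (\<delta> / 2)"] by eventually_elim (use assms in \<open>simp add: field_simps\<close>)
  moreover have "\<forall>\<^sub>F r in at_top. \<forall>k\<in>Kb. 6 * cf k \<le> r"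
    by (intro eventually_ball_finite finite_Kb ballI eventually_ge_at_top)
  moreover have "\<forall>\<^sub>F r in at_top. r powr (5/8) * (3 * ln r) \<le> (r::real)" by real_asymp
  moreover have "\<forall>\<^sub>F r in at_top. Cdrift * (r powr (3/4) * ln r) \<le> c0 / 2 * r powr p"
    by (rule via[OF _ c4(2)]) real_asymp
  moreover have "\<forall>\<^sub>F r in at_top. Cdrift * (r powr (3/4) * ln r) \<le> r"
    by (rule via1) real_asymp
  moreover have "\<forall>\<^sub>F r in at_top. 2 * K * Cu \<le> ln r"
    using ln_ge[of "2 * K * Cu"] by eventually_elim simp
  moreover have "\<forall>\<^sub>F r in at_top. 7 * K * ln r \<le> r"
    by (rule via1) real_asymp
  moreover have "\<forall>\<^sub>F r in at_top. 49 * K * Cg * (ln r)\<^sup>2 \<le> c0 / 4 * r powr p"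
    by (rule via[OF _ c4(1)]) real_asymp
  moreover have "\<forall>\<^sub>F r in at_top. 1 * 1 \<le> c0 / 4 * r powr p"
    by (rule via[OF _ c4(1)]) real_asymp
  moreover have "\<forall>\<^sub>F r in at_top. 49 * K * Cg * (ln r)\<^sup>2 \<le> r"
    by (rule via1) real_asymp
  moreover have "\<forall>\<^sub>F r in at_top. 1 \<le> (1 - p) * ln r"
    using ln_ge[of "1 / (1 - p)"] by eventually_elim (use p_up in \<open>simp add: field_simps\<close>)
  moreover have "\<forall>\<^sub>F r in at_top. real (card Kz) \<le> (qs + \<delta>) * ((1 - p) * ln r - 1)"
    using ln_ge[of "(real (card Kz) / (qs + \<delta>) + 1) / (1 - p)"]
  proof eventually_elim
    case (elim r)
    then have "real (card Kz) / (qs + \<delta>) + 1 < ln r * (1 - p)" using p_up by (simp add: pos_divide_less_eq)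
    then have "real (card Kz) / (qs + \<delta>) \<le> (1 - p) * ln r - 1" by (simp add: mult.commute)
    then show ?case using q by (simp add: pos_divide_le_eq mult.commute)
  qed
  ultimately show ?thesis
    unfolding admissible_def using eventually_large by eventually_elim simp
qed

text \<open>On good states \<open>Lyap\<close> is at most \<open>2 * r * (ln r + Cu)\<close>, so the
  exponent stays below \<open>2 * K * ln r + 2 * K * Cu\<close>. This explains the choice
  \<open>2 * K + 1\<close> for the cap.\<close>

lemma level_good:
  assumes v: "valid_state Kb s" and g: "good r s" and ad: "admissible \<delta> K r" and K: "0 < K"
  shows "level K (2 * K + 1) r s = exp (K / r * Lyap r s)"
proof -
  have la: "large r" using ad by (simp add: admissible_def)
  have r: "10 \<le> r" using la by (auto simp: large_def)
  have lnr: "0 < ln r" using r by simp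
  have nn: "0 \<le> (1 - p) * ln r + Cu" using p_up lnr Cu_nonneg by simp
  have "Lyap r s \<le> real (Occ s) * ((1 - p) * ln r + Cu)" by (rule Lyap_le[OF v g la])
  also have "\<dots> \<le> (2 * r) * (1 * ln r + Cu)"
    using good_bounds(3,6)[OF v g la] nn r lnr p_up p_low Cu_nonneg
    by (intro mult_mono add_right_mono mult_right_mono) auto
  finally have "K / r * Lyap r s \<le> K / r * ((2 * r) * (1 * ln r + Cu))"
    using K r by (intro mult_left_mono) auto
  also have "\<dots> = 2 * K * ln r + 2 * K * Cu" using r by (simp add: field_simps)
  also have "\<dots> \<le> (2 * K + 1) * ln r" using ad by (simp add: admissible_def algebra_simps)
  finally show ?thesis by (simp add: level_def)
qed

text \<open>Second-order expansion of the exponential: jumps of the exponent are at most 1, and the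
  squared jumps times the total rate give the additional term with \<open>(ln r)\<close>
  squared.\<close>

lemma drift_level_good:
  assumes v: "valid_state Kb s" and g: "good r s" and ad: "admissible \<delta> K r" and K: "0 < K"
  shows "drift r (level K (2 * K + 1) r) s
    \<le> level K (2 * K + 1) r s * (K / r) * (drift r (Lyap r) s + 49 * K * Cg * (ln r)\<^sup>2)"
proof -
  let ?f = "level K (2 * K + 1) r"
  have la: "large r" using ad by (simp add: admissible_def)
  have r: "10 \<le> r" using la by (auto simp: large_def)
  have lnr: "0 < ln r" using r by simp
  have fpos: "0 < ?f s" by (simp add: level_def)
  have "drift r ?f s \<le> (?f s * (K / r)) * drift r (Lyap r) s + (?f s * ((K / r)\<^sup>2 * (49 * (ln r)\<^sup>2))) * out r s"
  proof (rule drift_le[OF v])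
    fix s' assume s': "s' \<in> succ s"
    define \<Delta> where "\<Delta> = Lyap r s' - Lyap r s"
    have d: "\<bar>\<Delta>\<bar> \<le> 7 * ln r" unfolding \<Delta>_def
      by (rule jump_bound[OF v g la s']) (use ad in \<open>auto simp: admissible_def\<close>)
    have "K / r * \<bar>\<Delta>\<bar> \<le> K / r * (7 * ln r)" using d K r by (intro mult_left_mono) auto
    also have "\<dots> \<le> 1" using ad r by (simp add: admissible_def field_simps)
    finally have t: "\<bar>K / r * \<Delta>\<bar> \<le> 1" using K r by (simp add: abs_mult)
    have "\<Delta>\<^sup>2 \<le> (7 * ln r)\<^sup>2" using d lnr by (subst abs_le_square_iff[symmetric]) auto
    then have sq: "(K / r * \<Delta>)\<^sup>2 \<le> (K / r)\<^sup>2 * (49 * (ln r)\<^sup>2)"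
      unfolding power_mult_distrib by (intro mult_left_mono) auto
    \<comment> \<open>The target need not be good; the cap can only lower its value, which is the
      favourable direction.\<close>
    have "?f s' \<le> exp (K / r * Lyap r s')" by (simp add: level_def)
    also have "\<dots> = ?f s * exp (K / r * \<Delta>)"
      unfolding level_good[OF v g ad K] exp_add[symmetric] by (simp add: \<Delta>_def algebra_simps)
    also have "\<dots> \<le> ?f s * (1 + K / r * \<Delta> + (K / r)\<^sup>2 * (49 * (ln r)\<^sup>2))"
      using exp_le_quadratic[OF t] sq fpos by (intro mult_left_mono) auto
    finally show "?f s' - ?f s \<le> (?f s * (K / r)) * (Lyap r s' - Lyap r s) + ?f s * ((K / r)\<^sup>2 * (49 * (ln r)\<^sup>2))"
      unfolding \<Delta>_def[symmetric] by (simp add: algebra_simps)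
  qed (use r in simp)
  also have "(?f s * ((K / r)\<^sup>2 * (49 * (ln r)\<^sup>2))) * out r s \<le> (?f s * ((K / r)\<^sup>2 * (49 * (ln r)\<^sup>2))) * (Cg * r)"
    using fpos out_le_good[OF v g la] by (intro mult_left_mono) auto
  also have "\<dots> = ?f s * (K / r) * (49 * K * Cg * (ln r)\<^sup>2)"
    using r by (simp add: power2_eq_square field_simps)
  finally show ?thesis by (simp add: distrib_left)
qed

text \<open>An upper bound for \<open>level\<close> on good states with \<open>Occ\<close> below
  \<open>(qs + \<delta> / 2) * r\<close>; \<open>Ehigh\<close> is a lower bound on good states with
  \<open>Occ\<close> at least \<open>(qs + \<delta>) * r\<close>.\<close>

definition Elow :: "real \<Rightarrow> real \<Rightarrow> real \<Rightarrow> real" where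
  "Elow \<delta> K r = exp (K * (qs + \<delta> / 2) * ((1 - p) * ln r + Cu))"

definition Ehigh :: "real \<Rightarrow> real \<Rightarrow> real \<Rightarrow> real" where
  "Ehigh \<delta> K r = exp (K * ((qs + \<delta>) * ((1 - p) * ln r - 1) - real (card Kz)))"

text \<open>There are three regimes. Off the good states only the cap is used; for large
  \<open>Occ\<close> the dissipation makes the drift negative; otherwise the drift is at most
  \<open>2 * K\<close> times a value below \<open>Elow\<close>.\<close>

lemma drift_level_le:
  assumes v: "valid_state Kb s" and ad: "admissible \<delta> K r" and K: "0 < K" and \<delta>: "0 < \<delta>"
  shows "drift r (level K (2 * K + 1) r) s
    \<le> - (K / r * Ehigh \<delta> K r) * indicator {s. good r s \<and> (qs + \<delta>) * r \<le> real (Occ s)} s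
      + 2 * K * Elow \<delta> K r + r powr (2 * K + 1) * (out r s * indicator {s. \<not> good r s} s)"
proof -
  let ?f = "level K (2 * K + 1) r"
  have la: "large r" using ad by (simp add: admissible_def)
  have r: "10 \<le> r" using la by (auto simp: large_def)
  have lnr: "0 < ln r" using r by simp
  have fpos: "0 < ?f s" by (simp add: level_def)
  have El: "0 \<le> 2 * K * Elow \<delta> K r" using K by (simp add: Elow_def)
  show ?thesis
  proof (cases "good r s")
    case False
    have "drift r ?f s \<le> 0 * drift r (Lyap r) s + r powr (2 * K + 1) * out r s"
    proof (rule drift_le[OF v])
      fix s'
      have "?f s' \<le> exp ((2 * K + 1) * ln r)" by (simp add: level_def)
      also have "\<dots> = r powr (2 * K + 1)" using r by (simp add: powr_def)
      finally show "?f s' - ?f s \<le> 0 * (Lyap r s' - Lyap r s) + r powr (2 * K + 1)" using fpos by simp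
    qed (use r in simp)
    then show ?thesis using False El by (simp add: indicator_def)
  next
    case g: True
    note dl = drift_level_good[OF v g ad K] and dL = drift_Lyap_le[OF v g la]
    have dL': "drift r (Lyap r) s \<le> - Diss r s + Cdrift * (r powr (3/4) * ln r)" using dL by (simp add: mult.assoc)
    have Kr: "0 < ?f s * (K / r)" using fpos K r by simp
    show ?thesis
    proof (cases "(qs + \<delta> / 2) * r \<le> real (Occ s)")
      case True
      \<comment> \<open>Contrapositive of \<open>occupied_le_of_Diss\<close>: too many occupied
        servers force dissipation above the threshold.\<close>
      have "\<not> Diss r s \<le> c0 * r powr p"
      proof
        assume "Diss r s \<le> c0 * r powr p"
        then have "real (Occ s) \<le> qs * r + Cstat * (r / ln r)"
          by (rule occupied_le_of_Diss[OF v g la]) (use ad in \<open>auto simp: admissible_def\<close>)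
        also have "Cstat * (r / ln r) = Cstat / ln r * r" by simp
        also have "Cstat / ln r * r < \<delta> / 2 * r"
          using ad lnr r by (intro mult_strict_right_mono) (auto simp: admissible_def pos_divide_less_eq)
        finally show False using True by (simp add: distrib_right)
      qed
      moreover have "Cdrift * (r powr (3/4) * ln r) \<le> c0 / 2 * r powr p"
        "49 * K * Cg * (ln r)\<^sup>2 \<le> c0 / 4 * r powr p" "1 \<le> c0 / 4 * r powr p"
        using ad by (auto simp: admissible_def)
      \<comment> \<open>Of the \<open>c0 * r powr p\<close> gained, one half pays for the drift
        error and one quarter for the second-order term; the last quarter is at least 1.\<close>
      ultimately have "drift r (Lyap r) s + 49 * K * Cg * (ln r)\<^sup>2 \<le> -1" using dL' by linarith
      then have "?f s * (K / r) * (drift r (Lyap r) s + 49 * K * Cg * (ln r)\<^sup>2) \<le> ?f s * (K / r) * (-1)"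
        using Kr by (intro mult_left_mono) auto
      with dl have neg: "drift r ?f s \<le> - (K / r * ?f s)" by (simp add: mult.commute)
      have "drift r ?f s \<le> - (K / r * Ehigh \<delta> K r) * indicator {s. good r s \<and> (qs + \<delta>) * r \<le> real (Occ s)} s"
      proof (cases "(qs + \<delta>) * r \<le> real (Occ s)")
        case high: True
        have "Ehigh \<delta> K r \<le> ?f s"
        proof -
          have "K * ((qs + \<delta>) * ((1 - p) * ln r - 1) - real (card Kz))
            = K / r * ((qs + \<delta>) * r * ((1 - p) * ln r - 1) - real (card Kz) * r)"
            using r by (simp add: field_simps)
          also have "\<dots> \<le> K / r * (real (Occ s) * ((1 - p) * ln r - 1) - real (card Kz) * r)"
            using K r high ad by (intro mult_left_mono diff_right_mono mult_right_mono) (auto simp: admissible_def)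
          also have "\<dots> \<le> K / r * Lyap r s"
            using K r Lyap_ge[OF v r] by (intro mult_left_mono) auto
          finally show ?thesis unfolding level_good[OF v g ad K] Ehigh_def by simp
        qed
        then have "K / r * Ehigh \<delta> K r \<le> K / r * ?f s" using K r by (intro mult_left_mono) auto
        then show ?thesis using neg g high by (simp add: indicator_def)
      next
        case low: False
        have "0 \<le> K / r * ?f s" using K r fpos by simp
        then show ?thesis using neg low by (simp add: indicator_def)
      qed
      then show ?thesis using El g by (simp add: indicator_def)
    next
      case False
      have nn: "0 \<le> (1 - p) * ln r + Cu" using p_up lnr Cu_nonneg by simp
      have "drift r (Lyap r) s + 49 * K * Cg * (ln r)\<^sup>2 \<le> 2 * r"
        using dL' Diss_nonneg[OF v g la] ad unfolding admissible_def by linarith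
      then have "?f s * (K / r) * (drift r (Lyap r) s + 49 * K * Cg * (ln r)\<^sup>2) \<le> ?f s * (K / r) * (2 * r)"
        using Kr by (intro mult_left_mono) auto
      with dl have "drift r ?f s \<le> 2 * K * ?f s" using r by (simp add: mult_ac)
      also have "?f s \<le> Elow \<delta> K r"
      proof -
        have "K / r * Lyap r s \<le> K / r * (real (Occ s) * ((1 - p) * ln r + Cu))"
          using Lyap_le[OF v g la] K r by (intro mult_left_mono) auto
        also have "\<dots> \<le> K / r * ((qs + \<delta> / 2) * r * ((1 - p) * ln r + Cu))"
          using False nn K r by (intro mult_left_mono mult_right_mono) auto
        also have "\<dots> = K * (qs + \<delta> / 2) * ((1 - p) * ln r + Cu)" using r by simp
        finally show ?thesis unfolding level_good[OF v g ad K] Elow_def by simp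
      qed
      finally have "drift r ?f s \<le> 2 * K * Elow \<delta> K r" using K by simp
      moreover have "\<not> (qs + \<delta>) * r \<le> real (Occ s)"
      proof -
        have "(qs + \<delta> / 2) * r \<le> (qs + \<delta>) * r" using \<delta> r by (intro mult_right_mono) auto
        then show ?thesis using False by linarith
      qed
      ultimately show ?thesis using g by (simp add: indicator_def)
    qed
  qed
qed

lemma Elow_Ehigh:
  assumes "0 < r"
  shows "Elow \<delta> K r = exp (K * ((qs + \<delta> / 2) * Cu + (qs + \<delta>) + real (card Kz))) * r powr - (K * \<delta> * (1 - p) / 2) * Ehigh \<delta> K r"
  unfolding Elow_def Ehigh_def powr_def using assms
  by (simp add: exp_add[symmetric]) (simp add: field_simps)

text \<open>Zero mean drift of \<open>level\<close> weighs \<open>Ehigh\<close> times the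
  probability of large \<open>Occ\<close> against \<open>Elow\<close> and the exceptional states. By
  \<open>Elow_Ehigh\<close> the ratio of the two levels is a power of \<open>r\<close> that decays
  as fast as desired when \<open>K\<close> grows.\<close>

lemma occupied_tail:
  assumes \<delta>: "0 < \<delta>" and M: "0 \<le> M"
  shows "\<forall>\<^sub>F r in at_top. \<forall>\<pi>. stationary Kb lam mu p r \<pi> \<longrightarrow>
    measure (measure_pmf \<pi>) {s. (qs + \<delta>) * r \<le> real (Occ s)} \<le> r powr - M"
proof -
  \<comment> \<open>Chosen so that the ratio of \<open>Elow\<close> to \<open>Ehigh\<close> decays
    like \<open>r powr - (M + 3)\<close>. One factor \<open>r\<close> is lost with
    \<open>K / r\<close> and another one absorbs the constants.\<close>
  define K where "K = 2 * (M + 3) / (\<delta> * (1 - p))"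
  have K: "0 < K" using \<delta> M p_up by (simp add: K_def)
  have Kd: "K * \<delta> * (1 - p) / 2 = M + 3" using \<delta> p_up by (simp add: K_def)
  define C where "C = exp (K * ((qs + \<delta> / 2) * Cu + (qs + \<delta>) + real (card Kz)))"
  let ?B = "2 * K + 1"
  show ?thesis
    \<comment> \<open>The first use adds \<open>?B\<close> to the exponent to offset the cap
      \<open>r powr ?B\<close>.\<close>
    using eventually_admissible[OF \<delta> K] eventually_not_good_small[of "M + 3 + ?B"] eventually_not_good_small[of "M + 3"]
      eventually_ge_at_top[of "2 * C + 1 / K + 1"]
  proof eventually_elim
    case (elim r)
    have r: "10 \<le> r" using elim(1) by (auto simp: admissible_def large_def)
    show ?case
    proof (intro allI impI)
      fix \<pi> assume st: "stationary Kb lam mu p r \<pi>"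
      let ?f = "level K ?B r" and ?H = "{s. good r s \<and> (qs + \<delta>) * r \<le> real (Occ s)}" and ?N = "{s. \<not> good r s}"
      have r1: "1 \<le> r" "0 < r" using r by auto
      have f0: "0 \<le> ?f s" for s by (simp add: level_def)
      have fB: "?f s \<le> r powr ?B" for s using r by (simp add: level_def powr_def)
      note io = out_integrable[OF st r1(1)]
      have int: "integrable (measure_pmf \<pi>) (\<lambda>s. ?f s * out r s)"
      proof (rule Bochner_Integration.integrable_bound[OF integrable_mult_right[OF io, of "r powr ?B"]])
        show "AE s in measure_pmf \<pi>. norm (?f s * out r s) \<le> norm (r powr ?B * out r s)"
          using f0 fB out_nonneg[OF r1(2)] by (intro AE_I2) (auto simp: abs_mult intro!: mult_right_mono)
      qed auto
      note bal = balance[OF st r1(2) f0 int]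
      have iN: "integrable (measure_pmf \<pi>) (\<lambda>s. out r s * indicator ?N s)"
        by (rule integrable_real_mult_indicator[OF _ io]) simp
      have iH: "integrable (measure_pmf \<pi>) (indicator ?H :: 'i state \<Rightarrow> real)"
        by (rule measure_pmf.integrable_const_bound[where B=1]) auto
      have "0 = (\<integral>s. drift r ?f s \<partial>measure_pmf \<pi>)" using bal by simp
      also have "\<dots> \<le> (\<integral>s. - (K / r * Ehigh \<delta> K r) * indicator ?H s + 2 * K * Elow \<delta> K r
          + r powr ?B * (out r s * indicator ?N s) \<partial>measure_pmf \<pi>)"
      proof (rule integral_mono_AE[OF bal(1)])
        show "integrable (measure_pmf \<pi>) (\<lambda>s. - (K / r * Ehigh \<delta> K r) * indicator ?H s + 2 * K * Elow \<delta> K r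
          + r powr ?B * (out r s * indicator ?N s))"
          using iN iH by (intro Bochner_Integration.integrable_add integrable_mult_right) auto
        show "AE s in measure_pmf \<pi>. drift r ?f s \<le> - (K / r * Ehigh \<delta> K r) * indicator ?H s + 2 * K * Elow \<delta> K r
          + r powr ?B * (out r s * indicator ?N s)"
          using drift_level_le[OF _ elim(1) K \<delta>] st by (auto simp: AE_measure_pmf_iff stationary_def)
      qed
      also have "\<dots> = - (K / r * Ehigh \<delta> K r) * measure (measure_pmf \<pi>) ?H + 2 * K * Elow \<delta> K r
          + r powr ?B * (\<integral>s. out r s * indicator ?N s \<partial>measure_pmf \<pi>)"
        using iN iH by simp
      also have "\<dots> \<le> - (K / r * Ehigh \<delta> K r) * measure (measure_pmf \<pi>) ?H + 2 * K * Elow \<delta> K r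
          + r powr ?B * r powr - (M + 3 + ?B)"
        using elim(2) st by (intro add_left_mono mult_left_mono) auto
      also have "r powr ?B * r powr - (M + 3 + ?B) = r powr - (M + 3)"
        by (subst powr_add[symmetric]) (simp add: algebra_simps)
      finally have "K / r * Ehigh \<delta> K r * measure (measure_pmf \<pi>) ?H \<le> 2 * K * Elow \<delta> K r + r powr - (M + 3)"
        by simp
      also have "\<dots> \<le> 2 * K * Elow \<delta> K r + r powr - (M + 3) * Ehigh \<delta> K r"
      proof -
        have "1 \<le> Ehigh \<delta> K r" using elim(1) K by (simp add: Ehigh_def admissible_def)
        from mult_left_mono[OF this, of "r powr - (M + 3)"] show ?thesis by simp
      qed
      also have "\<dots> = (2 * K * C * r powr - (M + 3) + r powr - (M + 3)) * Ehigh \<delta> K r"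
        unfolding Elow_Ehigh[OF r1(2)] Kd C_def by (simp add: algebra_simps)
      finally have "(K / r * measure (measure_pmf \<pi>) ?H) * Ehigh \<delta> K r \<le> (2 * K * C * r powr - (M + 3) + r powr - (M + 3)) * Ehigh \<delta> K r"
        by (simp add: mult_ac)
      then have "K / r * measure (measure_pmf \<pi>) ?H \<le> 2 * K * C * r powr - (M + 3) + r powr - (M + 3)"
        by (rule mult_right_le_imp_le) (simp add: Ehigh_def)
      then have "r / K * (K / r * measure (measure_pmf \<pi>) ?H) \<le> r / K * (2 * K * C * r powr - (M + 3) + r powr - (M + 3))"
        using r1 K by (intro mult_left_mono) auto
      then have PH: "measure (measure_pmf \<pi>) ?H \<le> (2 * C + 1 / K) * (r * r powr - (M + 3))"
        using r1 K by (simp add: field_simps)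
      have "measure (measure_pmf \<pi>) {s. (qs + \<delta>) * r \<le> real (Occ s)} \<le> measure (measure_pmf \<pi>) (?H \<union> ?N)"
        by (intro measure_pmf.finite_measure_mono) auto
      also have "\<dots> \<le> measure (measure_pmf \<pi>) ?H + measure (measure_pmf \<pi>) ?N"
        by (rule measure_Un_le) auto
      also have "\<dots> \<le> (2 * C + 1 / K) * (r * r powr - (M + 3)) + r powr - (M + 3)"
        using PH elim(3) st by (intro add_mono) auto
      also have "\<dots> \<le> (2 * C + 1 / K) * (r * r powr - (M + 3)) + 1 * (r * r powr - (M + 3))"
        using r1 by simp
      also have "\<dots> = (2 * C + 1 / K + 1) * (r * r powr - (M + 3))" by (simp only: distrib_right)
      also have "\<dots> \<le> r * (r * r powr - (M + 3))"
        using elim(4) r1 by (intro mult_right_mono) auto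
      also have "\<dots> = r powr 1 * (r powr 1 * r powr - (M + 3))" using r1 by simp
      also have "\<dots> = r powr (- M - 1)" by (simp only: powr_add[symmetric]) (rule arg_cong[where f="(powr) r"], simp)
      also have "\<dots> \<le> r powr - M" using r1 by (intro powr_mono) auto
      finally show "measure (measure_pmf \<pi>) {s. (qs + \<delta>) * r \<le> real (Occ s)} \<le> r powr - M" .
    qed
  qed
qed

end

section \<open>Rank of the right-most occupied server\<close>

text \<open>The limiting distribution function jumps at \<open>c\<close> and is constant on either
  side, so only points away from \<open>c\<close> have to be tested.\<close>

lemma weak_conv_m_return:
  assumes low: "\<And>\<delta>. 0 < \<delta> \<Longrightarrow> (\<lambda>n. measure_pmf.prob (M n) {s. Y n s \<le> c - \<delta>}) \<longlonglongrightarrow> 0"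
    and high: "\<And>\<delta>. 0 < \<delta> \<Longrightarrow> (\<lambda>n. measure_pmf.prob (M n) {s. Y n s \<le> c + \<delta>}) \<longlonglongrightarrow> 1"
  shows "weak_conv_m (\<lambda>n. distr (measure_pmf (M n)) borel (Y n)) (return borel (c::real))"
  unfolding weak_conv_m_def weak_conv_def
proof (intro allI impI)
  fix x assume cont: "isCont (cdf (return borel c)) x"
  have ret: "cdf (return borel c) y = (if c \<le> y then 1 else 0)" for y
    by (simp add: cdf_def measure_return indicator_def)
  have dis: "cdf (distr (measure_pmf (M n)) borel (Y n)) y = measure_pmf.prob (M n) {s. Y n s \<le> y}" for n y
    by (simp add: cdf_def measure_distr vimage_def)
  have "x \<noteq> c"
  proof
    assume "x = c"
    have "(\<lambda>n. c - inverse (real (Suc n))) \<longlonglongrightarrow> c - 0"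
      by (intro tendsto_diff tendsto_const LIMSEQ_inverse_real_of_nat)
    then have "(\<lambda>n. cdf (return borel c) (c - inverse (real (Suc n)))) \<longlonglongrightarrow> cdf (return borel c) c"
      using cont \<open>x = c\<close> by (intro isCont_tendsto_compose[of c "cdf (return borel c)"]) auto
    then have "(\<lambda>n::nat. 0::real) \<longlonglongrightarrow> 1" unfolding ret by simp
    then show False using LIMSEQ_unique[OF tendsto_const] by fastforce
  qed
  then consider "x < c" | "c < x" by linarith
  then show "(\<lambda>n. cdf (distr (measure_pmf (M n)) borel (Y n)) x) \<longlonglongrightarrow> cdf (return borel c) x"
  proof cases
    case 1
    then show ?thesis using low[of "c - x"] unfolding ret dis by simp
  next
    case 2
    then show ?thesis using high[of "x - c"] unfolding ret dis by simp
  qed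
qed

section \<open>Servers above a given rank\<close>

context grand_ff
begin

text \<open>The geometric ratio of successive increments of \<open>hfun\<close>, taken large enough
  that a single departure outweighs arrivals at rate \<open>Lam * r\<close>.\<close>

definition hB :: "real \<Rightarrow> real" where "hB r = (Lam * r + 1) / mumin + 2"

definition hfun :: "real \<Rightarrow> nat \<Rightarrow> real" where
  "hfun r n = hB r ^ kmax - hB r ^ (kmax - n)"

text \<open>\<open>hfun\<close> is a Lyapunov function of the birth-death chain with birth rate \<open>Lam * r\<close> that
  bounds the content of a single server; its size is only polynomial in \<open>r\<close>.\<close>

definition tailsum :: "real \<Rightarrow> nat \<Rightarrow> 'i state \<Rightarrow> real" where
  "tailsum r N s = (\<Sum>l\<in>occ s. if N < l then hfun r (nconf (s l)) else 0)"

lemma hB: "0 < r \<Longrightarrow> 2 \<le> hB r" "0 < r \<Longrightarrow> Lam * r + 1 \<le> mumin * hB r"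
proof -
  assume r: "0 < r"
  have "0 \<le> (Lam * r + 1) / mumin" using r Lam_pos mumin by (intro divide_nonneg_pos) auto
  then show "2 \<le> hB r" by (simp add: hB_def)
  have "mumin * hB r = mumin * ((Lam * r + 1) / mumin) + 2 * mumin" by (simp only: hB_def distrib_left mult.commute)
  also have "mumin * ((Lam * r + 1) / mumin) = Lam * r + 1" using mumin(1) by simp
  finally have "mumin * hB r = Lam * r + 1 + 2 * mumin" .
  then show "Lam * r + 1 \<le> mumin * hB r" using mumin by simp
qed

lemma hfun_nonneg: "0 < r \<Longrightarrow> 0 \<le> hfun r n"
  using hB(1)[of r] by (auto simp: hfun_def intro!: power_increasing)

lemma hfun_le: "0 < r \<Longrightarrow> hfun r n \<le> hB r ^ kmax"
  using hB(1)[of r] by (auto simp: hfun_def)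

lemma hfun_zero: "hfun r 0 = 0"
  by (simp add: hfun_def)

lemma hfun_step:
  assumes "n < kmax"
  shows "hfun r (Suc n) - hfun r n = hB r ^ (kmax - Suc n) * (hB r - 1)"
proof -
  have "hB r ^ (kmax - n) = hB r * hB r ^ (kmax - Suc n)"
    using assms by (metis Suc_diff_Suc power_Suc)
  then show ?thesis by (simp add: hfun_def algebra_simps)
qed

text \<open>If \<open>D\<close> is the upward increment, the downward one is
  \<open>hB r * D\<close>, so the drift is at most
  \<open>(Lam * r - mumin * hB r) * D \<le> - D\<close>, and \<open>D\<close> is at least 1.\<close>

lemma hfun_drift:
  assumes r: "0 < r" and n: "0 < n" "n < kmax"
  shows "Lam * r * (hfun r (Suc n) - hfun r n) + mumin * real n * (hfun r (n - 1) - hfun r n) \<le> - 1"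
proof -
  define D where "D = hB r ^ (kmax - Suc n) * (hB r - 1)"
  obtain m where m: "n = Suc m" using n by (cases n) auto
  have D1: "1 \<le> D"
  proof -
    have "1 * 1 \<le> D" unfolding D_def using hB(1)[OF r] by (intro mult_mono one_le_power) auto
    then show ?thesis by simp
  qed
  have u: "hfun r (Suc n) - hfun r n = D" unfolding D_def by (rule hfun_step[OF n(2)])
  have "hfun r n - hfun r (n - 1) = hB r ^ (kmax - n) * (hB r - 1)"
    using hfun_step[of m r] n m by simp
  also have "\<dots> = hB r * D"
    using n(2) unfolding D_def by (metis Suc_diff_Suc mult.assoc power_Suc)
  finally have d: "hfun r (n - 1) - hfun r n = - (hB r * D)" by simp
  have "1 * (mumin * hB r * D) \<le> real n * (mumin * hB r * D)"
    using n mumin hB(1)[OF r] D1 by (intro mult_right_mono mult_nonneg_nonneg) auto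
  moreover have "(Lam * r + 1) * D \<le> mumin * hB r * D"
    using hB(2)[OF r] D1 by (intro mult_right_mono) auto
  moreover have "mumin * real n * (- (hB r * D)) = - (real n * (mumin * hB r * D))" by simp
  ultimately show ?thesis unfolding u d using D1 by (simp only: distrib_right mult_1)
qed

lemma tailsum_update:
  assumes v: "valid_state Kb s" and l: "0 < l"
  shows "tailsum r N (s(l := k)) - tailsum r N s = (if N < l then hfun r (nconf k) - hfun r (nconf (s l)) else 0)"
  using occ_sum_update[OF finite_occ[OF v] l, of "\<lambda>l k. if N < l then hfun r (nconf k) else 0" k]
  by (simp add: tailsum_def hfun_zero nconf_def)

lemma nconf_unitv: "nconf (unitv i) = 1"
  using nconf_add[of "\<lambda>_. 0" i] by (simp add: nconf_def)

lemma nconf_rem: "0 < k i \<Longrightarrow> nconf (rem_cust k i) = nconf k - 1"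
  using nconf_add[of "rem_cust k i" i] by simp

text \<open>Each occupied server above \<open>N\<close> contributes at most -1 by
  \<open>hfun_drift\<close>. The only positive term is the opening of an empty server, which counts
  only if the first empty rank exceeds \<open>N\<close>.\<close>

lemma drift_tailsum:
  assumes v: "valid_state Kb s" and r: "0 < r"
  shows "drift r (tailsum r N) s \<le> Lam * r * hB r ^ kmax * of_bool (N < fe s) - real (card {l \<in> occ s. N < l})"
proof -
  let ?D = "\<lambda>n. hfun r (Suc n) - hfun r n"
  let ?h = "\<lambda>l. hfun r (nconf (s l) - 1) - hfun r (nconf (s l))"
  define U where "U l = (if N < l then ?D (nconf (s l)) else 0)" for l
  have kn: "nconf (s l) < kmax" for l using v nconf_le_kmax by (auto simp: valid_state_def)
  have B: "2 \<le> hB r" by (rule hB(1)[OF r])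
  have Dnn: "0 \<le> ?D n" if "n < kmax" for n
    unfolding hfun_step[OF that] using B by (intro mult_nonneg_nonneg zero_le_power) auto
  have U0: "0 \<le> U l" for l using Dnn[OF kn[of l]] by (simp add: U_def)
  have fin: "finite (occ s)" by (rule finite_occ[OF v])
  have arr: "w0 s i * (tailsum r N (up s (fe s) i) - tailsum r N s)
        + (\<Sum>l\<in>acc Kb s i. (tailsum r N (up s l i) - tailsum r N s) / real (Xi Kb p s i))
      \<le> hB r ^ kmax * of_bool (N < fe s) + (\<Sum>l\<in>occ s. U l)" for i
  proof (intro add_mono)
    have w1: "w0 s i \<le> 1" using weights_sum[OF v, of i]
      by (smt (verit) divide_nonneg_nonneg of_nat_0_le_iff)
    have "tailsum r N (up s (fe s) i) - tailsum r N s = (if N < fe s then hfun r 1 else 0)"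
      unfolding up_def tailsum_update[OF v first_empty(1)[OF v]]
      by (simp add: first_empty(2)[OF v] nconf_unitv hfun_zero) (simp add: nconf_def hfun_zero)
    also have "w0 s i * \<dots> \<le> 1 * (hB r ^ kmax * of_bool (N < fe s))"
      using w1 w0_nonneg[of s i] hfun_nonneg[OF r, of 1] hfun_le[OF r, of 1] by (intro mult_mono) auto
    finally show "w0 s i * (tailsum r N (up s (fe s) i) - tailsum r N s) \<le> hB r ^ kmax * of_bool (N < fe s)" by simp
    have "(\<Sum>l\<in>acc Kb s i. (tailsum r N (up s l i) - tailsum r N s) / real (Xi Kb p s i)) \<le> (\<Sum>l\<in>acc Kb s i. U l)"
    proof (intro sum_mono)
      fix l assume l: "l \<in> acc Kb s i"
      then have l0: "0 < l" by (auto simp: acc_def occ_def)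
      have "0 < card (acc Kb s i)" using l finite_acc[OF v] by (auto simp: card_gt_0_iff)
      then have X: "1 \<le> real (Xi Kb p s i)" by (simp add: Xi_def)
      have "tailsum r N (up s l i) - tailsum r N s = U l"
        unfolding up_def tailsum_update[OF v l0] U_def nconf_add ..
      \<comment> \<open>The selection probability is bounded by 1, so each server is treated as if
        it received all arrivals; the size of \<open>hB\<close> pays for this.\<close>
      then show "(tailsum r N (up s l i) - tailsum r N s) / real (Xi Kb p s i) \<le> U l"
        using U0[of l] X by (simp add: divide_le_eq mult_le_cancel_left1)
    qed
    also have "\<dots> \<le> (\<Sum>l\<in>occ s. U l)"
      by (intro sum_mono2 fin) (auto simp: acc_def U0)
    finally show "(\<Sum>l\<in>acc Kb s i. (tailsum r N (up s l i) - tailsum r N s) / real (Xi Kb p s i)) \<le> (\<Sum>l\<in>occ s. U l)" .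
  qed
  have "(\<Sum>i\<in>UNIV. lam i * r * (w0 s i * (tailsum r N (up s (fe s) i) - tailsum r N s)
        + (\<Sum>l\<in>acc Kb s i. (tailsum r N (up s l i) - tailsum r N s) / real (Xi Kb p s i))))
    \<le> (\<Sum>i\<in>UNIV. lam i * r * (hB r ^ kmax * of_bool (N < fe s) + (\<Sum>l\<in>occ s. U l)))"
    using lam_pos r by (intro sum_mono mult_left_mono arr) (auto simp: less_imp_le)
  also have "\<dots> = Lam * r * hB r ^ kmax * of_bool (N < fe s) + (\<Sum>l\<in>occ s. Lam * r * U l)"
    unfolding sum_distrib_right[symmetric] Lam_def[symmetric] sum_distrib_left[symmetric] by (simp add: algebra_simps)
  finally have A: "(\<Sum>i\<in>UNIV. lam i * r * (w0 s i * (tailsum r N (up s (fe s) i) - tailsum r N s)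
        + (\<Sum>l\<in>acc Kb s i. (tailsum r N (up s l i) - tailsum r N s) / real (Xi Kb p s i))))
    \<le> Lam * r * hB r ^ kmax * of_bool (N < fe s) + (\<Sum>l\<in>occ s. Lam * r * U l)" .
  have "(\<Sum>l\<in>occ s. \<Sum>i\<in>UNIV. mu i * real (s l i) * (tailsum r N (down s l i) - tailsum r N s))
    \<le> (\<Sum>l\<in>occ s. if N < l then mumin * real (nconf (s l)) * ?h l else 0)"
  proof (intro sum_mono)
    fix l assume l: "l \<in> occ s"
    then have l0: "0 < l" by (auto simp: occ_def)
    have hn: "?h l \<le> 0"
    proof (cases "nconf (s l)")
      case (Suc m)
      then show ?thesis using Dnn[of m] kn[of l] by simp
    qed simp
    have "(\<Sum>i\<in>UNIV. mu i * real (s l i) * (tailsum r N (down s l i) - tailsum r N s))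
      \<le> (\<Sum>i\<in>UNIV. real (s l i) * (if N < l then mumin * ?h l else 0))"
    proof (intro sum_mono)
      fix i
      show "mu i * real (s l i) * (tailsum r N (down s l i) - tailsum r N s) \<le> real (s l i) * (if N < l then mumin * ?h l else 0)"
      proof (cases "s l i = 0")
        case False
        then have "tailsum r N (down s l i) - tailsum r N s = (if N < l then ?h l else 0)"
          unfolding down_def tailsum_update[OF v l0] by (simp add: nconf_rem)
        moreover have "mu i * ?h l \<le> mumin * ?h l" using mumin(2)[of i] hn by (rule mult_right_mono_neg)
        then have "real (s l i) * (mu i * ?h l) \<le> real (s l i) * (mumin * ?h l)" by (intro mult_left_mono) auto
        ultimately show ?thesis by (simp add: mult_ac)
      qed simp
    qed
    also have "\<dots> = (if N < l then mumin * real (nconf (s l)) * ?h l else 0)"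
      unfolding sum_distrib_right[symmetric] nconf_def of_nat_sum by simp
    finally show "(\<Sum>i\<in>UNIV. mu i * real (s l i) * (tailsum r N (down s l i) - tailsum r N s))
      \<le> (if N < l then mumin * real (nconf (s l)) * ?h l else 0)" .
  qed
  with A have "drift r (tailsum r N) s \<le> Lam * r * hB r ^ kmax * of_bool (N < fe s)
     + (\<Sum>l\<in>occ s. Lam * r * U l + (if N < l then mumin * real (nconf (s l)) * ?h l else 0))"
    unfolding drift_def sum.distrib by linarith
  also have "(\<Sum>l\<in>occ s. Lam * r * U l + (if N < l then mumin * real (nconf (s l)) * ?h l else 0))
    \<le> (\<Sum>l\<in>occ s. if N < l then - 1 else 0)"
  proof (intro sum_mono)
    fix l assume l: "l \<in> occ s"
    have "nconf (s l) \<noteq> 0"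
      using l by (auto simp: occ_def nconf_def fun_eq_iff)
    then show "Lam * r * U l + (if N < l then mumin * real (nconf (s l)) * ?h l else 0) \<le> (if N < l then - 1 else 0)"
      using hfun_drift[OF r _ kn[of l]] by (simp add: U_def)
  qed
  also have "\<dots> = - real (card {l \<in> occ s. N < l})"
    using fin by (simp add: sum.inter_filter[symmetric])
  finally show ?thesis by simp
qed

lemma tailsum_nonneg: "0 < r \<Longrightarrow> 0 \<le> tailsum r N s"
  unfolding tailsum_def by (intro sum_nonneg) (auto simp: hfun_nonneg)

text \<open>Zero mean drift of \<open>tailsum\<close> turns \<open>drift_tailsum\<close> into an
  inequality between probabilities. As \<open>tailsum\<close> grows linearly in \<open>Ztot\<close>,
  integrability rests on the second moments.\<close>

lemma rank_tail:
  assumes st: "stationary Kb lam mu p r \<pi>" and r: "1 \<le> r"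
  shows "measure (measure_pmf \<pi>) {s. N < Urank s} \<le> Lam * r * hB r ^ kmax * measure (measure_pmf \<pi>) {s. N \<le> Occ s}"
proof -
  have r0: "0 < r" using r by simp
  have valid: "valid_state Kb s" if "s \<in> set_pmf \<pi>" for s using st that by (auto simp: stationary_def)
  let ?g = "tailsum r N" and ?C = "Lam * r * hB r ^ kmax"
  have C: "0 \<le> ?C" using Lam_pos r0 hB(1)[OF r0] by simp
  have g: "?g s \<le> hB r ^ kmax * real (Ztot s)" if v: "valid_state Kb s" for s
  proof -
    have "?g s \<le> (\<Sum>l\<in>occ s. hB r ^ kmax)" unfolding tailsum_def
      using hfun_le[OF r0] hB(1)[OF r0] by (intro sum_mono) auto
    also have "\<dots> = hB r ^ kmax * real (Occ s)" by (simp add: Occ_def)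
    also have "\<dots> \<le> hB r ^ kmax * real (Ztot s)"
      using Occ_le_Ztot[OF v] hB(1)[OF r0] by (intro mult_left_mono) auto
    finally show ?thesis .
  qed
  have int: "integrable (measure_pmf \<pi>) (\<lambda>s. ?g s * out r s)"
  proof (rule Bochner_Integration.integrable_bound[OF integrable_mult_right[OF out_second_moment(3)[OF st r], of "hB r ^ kmax"]])
    have "norm (?g s * out r s) \<le> norm (hB r ^ kmax * (real (Ztot s) * out r s))" if "valid_state Kb s" for s
      using g[OF that] tailsum_nonneg[OF r0] out_nonneg[OF r0] hB(1)[OF r0]
      by (simp add: abs_mult mult.assoc[symmetric] mult_right_mono)
    then show "AE s in measure_pmf \<pi>. norm (?g s * out r s) \<le> norm (hB r ^ kmax * (real (Ztot s) * out r s))"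
      using valid by (auto simp: AE_measure_pmf_iff)
  qed auto
  note bal = balance[OF st r0 tailsum_nonneg[OF r0] int]
  have i1: "integrable (measure_pmf \<pi>) (indicator {s. N \<le> Occ s} :: 'i state \<Rightarrow> real)"
    and i2: "integrable (measure_pmf \<pi>) (indicator {s. N < Urank s} :: 'i state \<Rightarrow> real)"
    by (rule measure_pmf.integrable_const_bound[where B=1]; simp)+
  have pw: "drift r ?g s \<le> ?C * indicator {s. N \<le> Occ s} s - indicator {s. N < Urank s} s" if v: "valid_state Kb s" for s
  proof -
    have fin: "finite (occ s)" by (rule finite_occ[OF v])
    \<comment> \<open>First-Fit enters here: if the first empty rank exceeds \<open>N\<close>, all
      ranks from 1 to \<open>N\<close> are occupied.\<close>
    have "N \<le> Occ s" if "N < fe s"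
    proof -
      have "{1..N} \<subseteq> occ s" using first_empty(4)[OF v] that by auto
      then have "card {1..N} \<le> card (occ s)" by (rule card_mono[OF fin])
      then show ?thesis by (simp add: Occ_def)
    qed
    then have 1: "?C * of_bool (N < fe s) \<le> ?C * indicator {s. N \<le> Occ s} s"
      using C by (intro mult_left_mono) auto
    have "1 \<le> card {l \<in> occ s. N < l}" if "N < Urank s"
    proof -
      have "Urank s \<in> insert 0 (occ s)" unfolding Urank_def by (rule Max_in) (use fin in auto)
      then have "{l \<in> occ s. N < l} \<noteq> {}" using that by auto
      then have "0 < card {l \<in> occ s. N < l}" using fin by (simp add: card_gt_0_iff)
      then show ?thesis by linarith
    qed
    then have 2: "indicator {s. N < Urank s} s \<le> real (card {l \<in> occ s. N < l})"
      by (auto simp: indicator_def)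
    show ?thesis using drift_tailsum[OF v r0, of N] 1 2 by linarith
  qed
  have "0 = (\<integral>s. drift r ?g s \<partial>measure_pmf \<pi>)" using bal by simp
  also have "\<dots> \<le> (\<integral>s. ?C * indicator {s. N \<le> Occ s} s - indicator {s. N < Urank s} s \<partial>measure_pmf \<pi>)"
  proof (rule integral_mono_AE[OF bal(1)])
    show "integrable (measure_pmf \<pi>) (\<lambda>s. ?C * indicator {s. N \<le> Occ s} s - indicator {s. N < Urank s} s)"
      using i1 i2 by (intro Bochner_Integration.integrable_diff integrable_mult_right) auto
    show "AE s in measure_pmf \<pi>. drift r ?g s \<le> ?C * indicator {s. N \<le> Occ s} s - indicator {s. N < Urank s} s"
      using pw valid by (auto simp: AE_measure_pmf_iff)
  qed
  also have "\<dots> = ?C * measure (measure_pmf \<pi>) {s. N \<le> Occ s} - measure (measure_pmf \<pi>) {s. N < Urank s}"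
    using i1 i2 by simp
  finally show ?thesis by simp
qed

lemma eventually_rank_le:
  assumes \<delta>: "0 < \<delta>"
  shows "\<forall>\<^sub>F r in at_top. \<forall>\<pi>. stationary Kb lam mu p r \<pi> \<longrightarrow>
    measure (measure_pmf \<pi>) {s. (qs + \<delta>) * r < real (Urank s)} \<le> 1 / r"
proof -
  define c where "c = (Lam + 1) / mumin + 2"
  have c: "2 \<le> c" using Lam_pos mumin by (simp add: c_def)
  \<comment> \<open>The factor in \<open>rank_tail\<close> is of order
    \<open>r powr (kmax + 1)\<close>, so two powers of \<open>r\<close> are left, one of them for
    the constant.\<close>
  define M where "M = real kmax + 3"
  have d2: "0 < \<delta> / 2" using \<delta> by simp
  have M: "0 \<le> M" by (simp add: M_def)
  show ?thesis
    using occupied_tail[OF d2 M] eventually_ge_at_top[of 1] eventually_ge_at_top[of "2 / \<delta>"] eventually_ge_at_top[of "Lam * c ^ kmax"]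
  proof eventually_elim
    case (elim r)
    have r0: "0 < r" using elim(2) by simp
    have hBc: "hB r \<le> c * r"
    proof -
      have "(Lam * r + 1) / mumin \<le> (Lam + 1) * r / mumin"
        using elim(2) mumin by (intro divide_right_mono) (auto simp: algebra_simps)
      then show ?thesis using elim(2) by (simp add: hB_def c_def distrib_right)
    qed
    show ?case
    proof (intro allI impI)
      fix \<pi> assume st: "stationary Kb lam mu p r \<pi>"
      \<comment> \<open>The tail bound is used with \<open>\<delta> / 2\<close>; the other half
        covers the rounding, which costs at most 1.\<close>
      define N where "N = nat \<lfloor>(qs + \<delta>) * r\<rfloor>"
      have q0: "0 \<le> (qs + \<delta>) * r" using q_star_nonneg \<delta> r0 by (intro mult_nonneg_nonneg) auto
      have N1: "real N \<le> (qs + \<delta>) * r" using q0 by (simp add: N_def of_nat_nat)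
      have N2: "(qs + \<delta>) * r - 1 \<le> real N" using q0 by (simp add: N_def of_nat_nat)
      have "measure (measure_pmf \<pi>) {s. (qs + \<delta>) * r < real (Urank s)} \<le> measure (measure_pmf \<pi>) {s. N < Urank s}"
        using N1 by (intro measure_pmf.finite_measure_mono) auto
      also have "\<dots> \<le> Lam * r * hB r ^ kmax * measure (measure_pmf \<pi>) {s. N \<le> Occ s}"
        by (rule rank_tail[OF st elim(2)])
      also have "\<dots> \<le> Lam * r * (c * r) ^ kmax * r powr - M"
      proof (intro mult_mono mult_left_mono power_mono hBc)
        have "{s. N \<le> Occ s} \<subseteq> {s. (qs + \<delta> / 2) * r \<le> real (Occ s)}"
        proof clarify
          fix s :: "'i state" assume "N \<le> Occ s"
          then have "real N \<le> real (Occ s)" by simp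
          moreover have "1 \<le> \<delta> / 2 * r" using elim(3) \<delta> by (simp add: field_simps)
          ultimately show "(qs + \<delta> / 2) * r \<le> real (Occ s)" using N2 by (simp add: algebra_simps)
        qed
        then have "measure (measure_pmf \<pi>) {s. N \<le> Occ s} \<le> measure (measure_pmf \<pi>) {s. (qs + \<delta> / 2) * r \<le> real (Occ s)}"
          by (intro measure_pmf.finite_measure_mono) auto
        then show "measure (measure_pmf \<pi>) {s. N \<le> Occ s} \<le> r powr - M" using elim(1) st by fastforce
      qed (use Lam_pos r0 hB(1)[OF r0] c in \<open>auto intro!: mult_nonneg_nonneg\<close>)
      also have "\<dots> = (Lam * c ^ kmax) * (r powr 1 * r powr real kmax * r powr - M)"
        using r0 by (simp add: power_mult_distrib powr_realpow)
      also have "r powr 1 * r powr real kmax * r powr - M = r powr - 2"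
        unfolding M_def by (simp only: powr_add[symmetric]) (rule arg_cong[where f="(powr) r"], simp)
      also have "(Lam * c ^ kmax) * r powr - 2 \<le> r * r powr - 2" using elim(4) by (intro mult_right_mono) auto
      also have "\<dots> = 1 / r" using r0 by (simp add: powr_minus power2_eq_square field_simps)
      finally show "measure (measure_pmf \<pi>) {s. (qs + \<delta>) * r < real (Urank s)} \<le> 1 / r" .
    qed
  qed
qed

section \<open>Lower bound for the rank\<close>

definition rhoinv :: real where "rhoinv = (\<Sum>i\<in>UNIV. 1 / rho i)"

text \<open>Topping up the scaled configuration counts with single-customer servers gives a feasible
  point of the linear program.\<close>

lemma occupied_ge:
  assumes v: "valid_state Kb s" and g: "good r s" and la: "large r"
  shows "qs * r \<le> real (Occ s) + (real CARD('i) + rhoinv) * r powr (5/8)"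
proof -
  let ?t = "r powr (5/8)"
  have r: "10 \<le> r" using la by (auto simp: large_def)
  have ri: "1 / rho i \<le> rhoinv" for i unfolding rhoinv_def
    by (rule member_le_sum) (use lam_pos mu_pos in \<open>auto simp: less_imp_le\<close>)
  have r0: "0 \<le> rhoinv" unfolding rhoinv_def using lam_pos mu_pos by (intro sum_nonneg) (auto simp: less_imp_le)
  \<comment> \<open>Scaling by slightly more than \<open>r\<close> ensures
    \<open>real (Zc s i) / R \<le> rho i\<close>, so the mass added on the unit vectors is
    nonnegative.\<close>
  define R where "R = r + rhoinv * ?t"
  have R: "r \<le> R" "0 < R" using r r0 by (auto simp: R_def intro: add_pos_nonneg)
  have Zle: "real (Zc s i) / R \<le> rho i" for i
  proof -
    have "real (Zc s i) \<le> rho i * r + 1 * ?t" using g by (auto simp: good_def abs_le_iff algebra_simps dest!: spec[of _ i])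
    also have "1 = rho i * (1 / rho i)" using rho_pos[of i] lam_pos[of i] mu_pos[of i] by simp
    also have "rho i * r + rho i * (1 / rho i) * ?t \<le> rho i * r + rho i * rhoinv * ?t"
      using ri[of i] rho_pos[of i] by (intro add_left_mono mult_right_mono mult_left_mono) (auto simp: less_imp_le)
    also have "\<dots> = rho i * R" by (simp only: R_def distrib_left mult.assoc)
    finally show ?thesis using R by (simp add: pos_divide_le_eq)
  qed
  define x where "x k = real (Xc s k) / R + (\<Sum>i\<in>UNIV. if k = unitv i then rho i - real (Zc s i) / R else 0)" for k
  have sx: "(\<Sum>k\<in>Kz. F k * x k) = (\<Sum>k\<in>Kz. real (Xc s k) * F k) / R + (\<Sum>i\<in>UNIV. F (unitv i) * (rho i - real (Zc s i) / R))" for F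
    unfolding x_def distrib_left sum.distrib sum_Kz_unitv by (simp add: sum_divide_distrib mult.commute)
  have "feasible x"
    unfolding feasible_def
  proof (intro conjI ballI allI)
    show "0 \<le> x k" for k unfolding x_def using R Zle by (intro add_nonneg_nonneg sum_nonneg) auto
    show "(\<Sum>k\<in>Kz. real (k j) * x k) = rho j" for j
      unfolding sx sum_unitv using occ_sum[OF v, of "\<lambda>k. real (k j)"] by (simp add: Zc_def)
  qed
  then have "qs \<le> (\<Sum>k\<in>Kz. 1 * x k)" using q_star_le by simp
  also have "\<dots> = real (Occ s) / R + (1 - real (Ztot s) / R)"
    unfolding sx using occ_sum[OF v, of "\<lambda>_. 1"]
    by (simp add: Occ_def sum_subtractf load Ztot_Zc sum_divide_distrib)
  finally have "qs * R \<le> (real (Occ s) / R + (1 - real (Ztot s) / R)) * R" using R by (intro mult_right_mono) auto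
  also have "\<dots> = real (Occ s) + R - real (Ztot s)" using R by (simp add: field_simps)
  also have "\<dots> \<le> real (Occ s) + (real CARD('i) + rhoinv) * ?t"
    using good_bounds(5)[OF v g la] by (simp add: R_def distrib_right)
  finally have "qs * R \<le> real (Occ s) + (real CARD('i) + rhoinv) * ?t" .
  moreover have "qs * r \<le> qs * R" using R q_star_nonneg by (intro mult_left_mono) auto
  ultimately show ?thesis by linarith
qed

lemma Occ_le_Urank:
  assumes "valid_state Kb s"
  shows "Occ s \<le> Urank s"
proof -
  have "occ s \<subseteq> {1..Urank s}"
    using finite_occ[OF assms] by (auto simp: Urank_def occ_def Suc_le_eq)
  then have "card (occ s) \<le> card {1..Urank s}" by (intro card_mono) auto
  then show ?thesis by (simp add: Occ_def)
qed

text \<open>The rank is at least the number of occupied servers, which \<open>occupied_ge\<close>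
  bounds below on good states; hence the event is contained in the exceptional one up to null
  sets.\<close>

lemma eventually_rank_ge:
  assumes \<delta>: "0 < \<delta>"
  shows "\<forall>\<^sub>F r in at_top. \<forall>\<pi>. stationary Kb lam mu p r \<pi> \<longrightarrow>
    measure (measure_pmf \<pi>) {s. real (Urank s) \<le> (qs - \<delta>) * r} \<le> 1 / r"
proof -
  have "\<forall>\<^sub>F r in at_top. (real CARD('i) + rhoinv) * r powr (5/8) \<le> (\<delta> / 2) * r"
    by (rule eventually_const_mult_le) (real_asymp, rule eventually_gt_at_top, use \<delta> in simp)
  with eventually_large eventually_not_good_small[of 1]
  show ?thesis
  proof eventually_elim
    case (elim r)
    have r: "10 \<le> r" using elim(1) by (auto simp: large_def)
    show ?case
    proof (intro allI impI)
      fix \<pi> assume st: "stationary Kb lam mu p r \<pi>"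
      have "measure (measure_pmf \<pi>) {s. real (Urank s) \<le> (qs - \<delta>) * r} \<le> measure (measure_pmf \<pi>) {s. \<not> good r s}"
      proof (intro measure_pmf.finite_measure_mono_AE)
        have "\<not> good r s" if v: "valid_state Kb s" and u: "real (Urank s) \<le> (qs - \<delta>) * r" for s
        proof
          assume "good r s"
          from occupied_ge[OF v this elim(1)] have "qs * r \<le> real (Urank s) + \<delta> / 2 * r"
            using Occ_le_Urank[OF v] elim(3) by linarith
          with u have "\<delta> * r \<le> \<delta> / 2 * r" by (simp add: algebra_simps)
          moreover have "0 < \<delta> * r" using \<delta> r by simp
          ultimately show False by simp
        qed
        then show "AE s in measure_pmf \<pi>. s \<in> {s. real (Urank s) \<le> (qs - \<delta>) * r} \<longrightarrow> s \<in> {s. \<not> good r s}"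
          using st by (auto simp: AE_measure_pmf_iff stationary_def)
      qed auto
      also have "\<dots> \<le> r powr - 1" using elim(2) st by blast
      also have "\<dots> = 1 / r" using r by (simp add: powr_minus_divide)
      finally show "measure (measure_pmf \<pi>) {s. real (Urank s) \<le> (qs - \<delta>) * r} \<le> 1 / r" .
    qed
  qed
qed

section \<open>Limits along the sequence of systems\<close>

context
  fixes r :: "nat \<Rightarrow> real" and \<pi> :: "nat \<Rightarrow> 'i state pmf"
  assumes r_pos: "\<And>n. 0 < r n"
    and r_lim: "filterlim r at_top sequentially"
    and stat: "\<And>n. stationary Kb lam mu p (r n) (\<pi> n)"
begin

lemma tendsto_zero_of_eventually:
  assumes "\<forall>\<^sub>F r in at_top. \<forall>\<pi>. stationary Kb lam mu p r \<pi> \<longrightarrow> measure (measure_pmf \<pi>) (A r) \<le> 1 / r"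
  shows "(\<lambda>n. measure_pmf.prob (\<pi> n) (A (r n))) \<longlonglongrightarrow> 0"
proof (rule tendsto_sandwich[of "\<lambda>_. 0" _ _ "\<lambda>n. 1 / r n"])
  show "\<forall>\<^sub>F n in sequentially. measure_pmf.prob (\<pi> n) (A (r n)) \<le> 1 / r n"
    using eventually_compose_filterlim[OF assms r_lim] by eventually_elim (use stat in auto)
  show "(\<lambda>n. 1 / r n) \<longlonglongrightarrow> 0"
    by (intro tendsto_divide_0[OF tendsto_const] filterlim_at_top_imp_at_infinity r_lim)
qed auto

lemma rank_le_tendsto:
  assumes "0 < \<delta>"
  shows "(\<lambda>n. measure_pmf.prob (\<pi> n) {s. real (Urank s) \<le> (qs + \<delta>) * r n}) \<longlonglongrightarrow> 1"
proof -
  have "(\<lambda>n. 1 - measure_pmf.prob (\<pi> n) {s. (qs + \<delta>) * r n < real (Urank s)}) \<longlonglongrightarrow> 1 - 0"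
    by (intro tendsto_diff tendsto_const tendsto_zero_of_eventually[OF eventually_rank_le[OF assms]])
  moreover have "1 - measure_pmf.prob (\<pi> n) {s. (qs + \<delta>) * r n < real (Urank s)} =
    measure_pmf.prob (\<pi> n) {s. real (Urank s) \<le> (qs + \<delta>) * r n}" for n
    by (subst measure_pmf.prob_compl[symmetric]) (auto intro!: arg_cong[where f="measure _"])
  ultimately show ?thesis by simp
qed

lemma rank_weak_conv:
  "weak_conv_m (\<lambda>n. distr (measure_pmf (\<pi> n)) borel (\<lambda>s. real (Urank s) / r n)) (return borel qs)"
proof (rule weak_conv_m_return)
  fix \<delta> :: real assume \<delta>: "0 < \<delta>"
  show "(\<lambda>n. measure_pmf.prob (\<pi> n) {s. real (Urank s) / r n \<le> qs - \<delta>}) \<longlonglongrightarrow> 0"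
    using tendsto_zero_of_eventually[OF eventually_rank_ge[OF \<delta>]] r_pos by (simp add: pos_divide_le_eq)
  show "(\<lambda>n. measure_pmf.prob (\<pi> n) {s. real (Urank s) / r n \<le> qs + \<delta>}) \<longlonglongrightarrow> 1"
    using rank_le_tendsto[OF \<delta>] r_pos by (simp add: pos_divide_le_eq)
qed

text \<open>Above 0 the truncation has no effect and the event is that of
  \<open>rank_le_tendsto\<close>; below 0 the event is empty.\<close>

lemma excess_weak_conv:
  "weak_conv_m (\<lambda>n. distr (measure_pmf (\<pi> n)) borel
     (\<lambda>s. max 0 ((real (Urank s) - r n * qs) / r n))) (return borel 0)"
proof (rule weak_conv_m_return)
  fix \<delta> :: real assume \<delta>: "0 < \<delta>"
  have "measure_pmf.prob (\<pi> n) {s. max 0 ((real (Urank s) - r n * qs) / r n) \<le> 0 - \<delta>} = 0" for n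
  proof -
    have "{s :: 'i state. max 0 ((real (Urank s) - r n * qs) / r n) \<le> 0 - \<delta>} = {}" using \<delta> by auto
    then show ?thesis by (simp only: measure_empty)
  qed
  then show "(\<lambda>n. measure_pmf.prob (\<pi> n) {s. max 0 ((real (Urank s) - r n * qs) / r n) \<le> 0 - \<delta>}) \<longlonglongrightarrow> 0"
    by (simp only: tendsto_const)
  have "{s :: 'i state. max 0 ((real (Urank s) - r n * qs) / r n) \<le> 0 + \<delta>} = {s. real (Urank s) \<le> (qs + \<delta>) * r n}" for n
    using \<delta> r_pos[of n] by (auto simp: pos_divide_le_eq algebra_simps)
  then show "(\<lambda>n. measure_pmf.prob (\<pi> n) {s. max 0 ((real (Urank s) - r n * qs) / r n) \<le> 0 + \<delta>}) \<longlonglongrightarrow> 1"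
    using rank_le_tendsto[OF \<delta>] by (simp only:)
qed

end

end

theorem theorem3p2:
  fixes Kb :: "('i::finite) config set"
    and lam mu :: "'i \<Rightarrow> real"
    and p :: real
    and r :: "nat \<Rightarrow> real"
    and \<pi> :: "nat \<Rightarrow> 'i state pmf"
  assumes Kb: "allowed_set Kb"
    and lam_pos: "\<And>i. 0 < lam i"
    and mu_pos: "\<And>i. 0 < mu i"
    and load: "(\<Sum>i\<in>UNIV. lam i / mu i) = 1"
    and p_low: "1 - 1 / (8 * real (kappa Kb)) < p"
    and p_up: "p < 1"
    and r_pos: "\<And>n. 0 < r n"
    and r_lim: "filterlim r at_top sequentially"
    and stat: "\<And>n. stationary Kb lam mu p (r n) (\<pi> n)"
  shows "(\<forall>\<delta>>0. (\<lambda>n. measure_pmf.prob (\<pi> n)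
              {s. real (Urank s) - q_star Kb lam mu * r n \<le> \<delta> * r n}) \<longlonglongrightarrow> 1)
       \<and> weak_conv_m (\<lambda>n. distr (measure_pmf (\<pi> n)) borel
              (\<lambda>s. max 0 ((real (Urank s) - r n * q_star Kb lam mu) / r n))) (return borel 0)
       \<and> weak_conv_m (\<lambda>n. distr (measure_pmf (\<pi> n)) borel (\<lambda>s. real (Urank s) / r n))
              (return borel (q_star Kb lam mu))"
proof -
  \<comment> \<open>Since \<open>kappa Kb\<close> is at least 1, the assumed range of
    \<open>p\<close> lies above 7/8.\<close>
  have "1 / (8 * real (kappa Kb)) \<le> 1 / 8"
    by (intro divide_left_mono) (auto simp: kappa_def)
  then interpret grand_ff Kb lam mu p
    by unfold_locales (use Kb lam_pos mu_pos load p_low p_up in auto)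
  have "(\<lambda>n. measure_pmf.prob (\<pi> n) {s. real (Urank s) - q_star Kb lam mu * r n \<le> \<delta> * r n}) \<longlonglongrightarrow> 1"
    if "0 < \<delta>" for \<delta>
    using rank_le_tendsto[OF r_pos r_lim stat that] by (simp add: algebra_simps)
  then show ?thesis
    using excess_weak_conv[OF r_pos r_lim stat] rank_weak_conv[OF r_pos r_lim stat] by blast
qed

end
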